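(* Assume (A1) and (A2) hold (see context) and that $\mathbf\Sigma$ is invertible. Fix $J\subseteq[p]$ and $\delta\in(0,1)$. Suppose in addition that $$N\ge18B_X^2\,p\,\|\mathbf\Sigma^{-1}\|\log(3p/\delta)$$ and $$\lambda\ge8B_XB_Y\Big(\frac{\log(6p/\delta)}{n}\Big)^{1/2}\bigg[1+\frac{B_X}{3}\Big(\frac{\log(6p/\delta)}{n}\Big)^{1/2}\bigg].$$ Then, with probability larger than $1-\delta$, the semi-supervised lasso estimator $$\hat{\boldsymbol\beta}\in\operatorname*{arg\,min}_{\boldsymbol\beta\in\mathbb R^p}\Big\{\|\hat{\mathbf\Sigma}_{\rm all}^{1/2}\boldsymbol\beta\|_2^2-\frac2n\boldsymbol Y^\top\mathbf X_{\rm lab}\boldsymbol\beta+2\lambda\|\boldsymbol\beta\|_1\Big\}$$ satisfies $$\mathcal E(f_{\hat{\boldsymbol\beta}})\le\inf_{\boldsymbol\beta\in\mathbb R^p}\bigg\{\mathcal E(f_{\boldsymbol\beta})+4\lambda\|\boldsymbol\beta_{J^c}\|_1+\frac{9\lambda^2|J|}{2\,\kappa_{\hat{\mathbf\Sigma}_{\rm all}}(J,3)}\bigg\}.$$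
   Context: Setting. $p\ge1$ and $1\le n<N$ are integers, $[k]=\{1,\dots,k\}$. $(\boldsymbol X,Y)$ is a random pair in $\mathbb R^p\times\mathbb R$ with distribution $P$; $P_X$ is the marginal distribution of $\boldsymbol X=(X^1,\dots,X^p)^\top$; $f^\star(\boldsymbol x)=\mathbb E[Y\mid\boldsymbol X=\boldsymbol x]$; $\mathbf\Sigma=\mathbb E[\boldsymbol X\boldsymbol X^\top]$. The labeled data $(\boldsymbol X_1,Y_1),\dots,(\boldsymbol X_n,Y_n)$ are i.i.d. with distribution $P$; the unlabeled data $\boldsymbol X_{n+1},\dots,\boldsymbol X_N$ are i.i.d. with distribution $P_X$ and independent of the labeled data. $\boldsymbol Y=(Y_1,\dots,Y_n)^\top$ and $\mathbf X_{\rm lab}\in\mathbb R^{n\times p}$ is the matrix with rows $\boldsymbol X_1^\top,\dots,\boldsymbol X_n^\top$. $\hat{\mathbf\Sigma}_{\rm all}=\frac1N\sum_{i=1}^N\boldsymbol X_i\boldsymbol X_i^\top$. $\|\mathbf A\|$ denotes the spectral norm of a matrix $\mathbf A$. Assumptions. (A1): $Y$ and $\boldsymbol X$ have zero mean and finite variance, and $\mathbb E[(X^j)^2]=1$ for all $j\in[p]$. (A2): there exist constants $B_Y,B_X$ such that $\mathbf P(|Y|\le B_Y;\ \max_{j\in[p]}|X^j|\le B_X)=1$. Linear predictors: $f_{\boldsymbol\beta}(\boldsymbol x)=\boldsymbol x^\top\boldsymbol\beta$. The excess risk is $\mathcal E(f)=\int(f(\boldsymbol x)-f^\star(\boldsymbol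 x))^2P_X(d\boldsymbol x)$; for a data-dependent $\hat{\boldsymbol\beta}$, $\mathcal E(f_{\hat{\boldsymbol\beta}})$ is the (random) value of $\boldsymbol\beta\mapsto\mathcal E(f_{\boldsymbol\beta})$ at $\hat{\boldsymbol\beta}$. The tuning parameter satisfies $\lambda>0$. For $J\subseteq[p]$ and $\boldsymbol v\in\mathbb R^p$, $\boldsymbol v_J\in\mathbb R^p$ has $j$-th coordinate $v_j$ if $j\in J$ and $0$ otherwise; $J^c=[p]\setminus J$. For a symmetric positive semidefinite $p\times p$ matrix $\mathbf A$ and $c>0$, the compatibility constant is $$\kappa_{\mathbf A}(J,c)=\inf\bigg\{\frac{c^2|J|\,\|\mathbf A^{1/2}\boldsymbol v\|_2^2}{(c\|\boldsymbol v_J\|_1-\|\boldsymbol v_{J^c}\|_1)^2}:\ \boldsymbol v\in\mathbb R^p,\ \|\boldsymbol v_{J^c}\|_1<c\|\boldsymbol v_J\|_1\bigg\}.$$ Conventions: the infimum over the empty set is $+\infty$; a ratio with denominator $+\infty$ is $0$, and a positive number divided by $0$ is $+\infty$. *)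

theory Defs
  imports "HOL-Probability.Probability"
begin

text \<open>
  The law \<open>P\<close> of the pair $(X,Y)$ is a measure on \<open>(real ^ 'p) \<times> real\<close>;
  the dimension $p$ is \<open>CARD('p)\<close> and the index set $[p]$ is the type \<open>'p\<close>.
\<close>

definition marginal_X :: "((real ^ 'p::finite) \<times> real) measure \<Rightarrow> (real ^ 'p) measure" where
  "marginal_X P = distr P borel fst"

text \<open>
  The regression function is determined only up to null sets of the marginal, so it is
  a predicate that holds for every Borel version $f$ of $x \mapsto E[Y \mid X = x]$, i.e.
  $f(X)$ is a version of the conditional expectation of $Y$ given the sigma-algebra of $X$.
\<close>

definition is_regression_function ::
    "((real ^ 'p::finite) \<times> real) measure \<Rightarrow> (real ^ 'p \<Rightarrow> real) \<Rightarrow> bool" where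
  "is_regression_function P f \<longleftrightarrow>
     f \<in> borel_measurable borel \<and>
     (AE z in P. real_cond_exp P (vimage_algebra (space P) fst borel) snd z = f (fst z))"

definition excess_risk ::
    "((real ^ 'p::finite) \<times> real) measure \<Rightarrow> (real ^ 'p \<Rightarrow> real) \<Rightarrow> (real ^ 'p \<Rightarrow> real) \<Rightarrow> real" where
  "excess_risk P fstar f = (\<integral>x. (f x - fstar x)\<^sup>2 \<partial>marginal_X P)"

definition lin_pred :: "real ^ 'p::finite \<Rightarrow> real ^ 'p \<Rightarrow> real" where
  "lin_pred \<beta> x = x \<bullet> \<beta>"

definition pop_cov :: "((real ^ 'p::finite) \<times> real) measure \<Rightarrow> real ^ 'p ^ 'p" where
  "pop_cov P = (\<chi> j k. \<integral>x. x $ j * x $ k \<partial>marginal_X P)"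

definition emp_cov :: "nat \<Rightarrow> (nat \<Rightarrow> real ^ 'p::finite) \<Rightarrow> real ^ 'p ^ 'p" where
  "emp_cov N x = (1 / real N) *\<^sub>R (\<Sum>i = 1..N. \<chi> j k. x i $ j * x i $ k)"

text \<open>The library norm on matrices is the Frobenius norm, so it is not used here.\<close>

definition spectral_norm :: "real ^ 'p::finite ^ 'p \<Rightarrow> real" where
  "spectral_norm A = onorm (\<lambda>v. A *v v)"

definition psd :: "real ^ 'p::finite ^ 'p \<Rightarrow> bool" where
  "psd A \<longleftrightarrow> transpose A = A \<and> (\<forall>v. 0 \<le> v \<bullet> (A *v v))"

text \<open>Meaningful for positive semidefinite \<open>A\<close> only.\<close>

definition psd_sqrt :: "real ^ 'p::finite ^ 'p \<Rightarrow> real ^ 'p ^ 'p" where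
  "psd_sqrt A = (THE B. psd B \<and> B ** B = A)"

definition l1_norm :: "real ^ 'p::finite \<Rightarrow> real" where
  "l1_norm v = (\<Sum>j\<in>UNIV. \<bar>v $ j\<bar>)"

definition restr :: "'p::finite set \<Rightarrow> real ^ 'p \<Rightarrow> real ^ 'p" where
  "restr J v = (\<chi> j. if j \<in> J then v $ j else 0)"

text \<open>
  Extended-real valued: the infimum over the empty set is \<open>\<infinity>\<close>. On the index set the
  denominator is positive, so the real division is never by zero.
\<close>

definition compat_const :: "real ^ 'p::finite ^ 'p \<Rightarrow> 'p set \<Rightarrow> real \<Rightarrow> ereal" where
  "compat_const A J c =
     (INF v \<in> {v. l1_norm (restr (- J) v) < c * l1_norm (restr J v)}.
        ereal (c\<^sup>2 * real (card J) * (norm (psd_sqrt A *v v))\<^sup>2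
               / (c * l1_norm (restr J v) - l1_norm (restr (- J) v))\<^sup>2))"

text \<open>
  The data are \<open>x 1, \<dots>, x N\<close> and \<open>y 1, \<dots>, y n\<close>. The sum is the bilinear form
  $Y^T X_{lab} \beta$, where $X_{lab}$ has rows \<open>x 1, \<dots>, x n\<close>.
\<close>

definition ssl_objective ::
    "nat \<Rightarrow> nat \<Rightarrow> real \<Rightarrow> (nat \<Rightarrow> real ^ 'p::finite) \<Rightarrow> (nat \<Rightarrow> real) \<Rightarrow> real ^ 'p \<Rightarrow> real" where
  "ssl_objective n N lam x y \<beta> =
     (norm (psd_sqrt (emp_cov N x) *v \<beta>))\<^sup>2
     - 2 / real n * (\<Sum>i = 1..n. y i * (x i \<bullet> \<beta>))
     + 2 * lam * l1_norm \<beta>"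

end

theory Submission
  imports Defs
begin

text \<open>
  Write $\Sigma$ for the population and $\hat\Sigma$ for the empirical second-moment matrix, $c=E[YX]$ and
  $\hat c=\frac1n\sum_{i\le n}Y_iX_i$. Up to an additive constant the excess risk of $f_\beta$ is
  $\beta\cdot\Sigma\beta-2c\cdot\beta$ (\<open>excess_risk_eq\<close>), and the estimator minimises the
  empirical counterpart $\beta\cdot\hat\Sigma\beta-2\hat c\cdot\beta$ plus the $\ell_1$ penalty.
  The compatibility term on the right-hand side of the claim does not depend on $\beta$, so it
  suffices to compete with a fixed minimiser $b$ of
  $\beta\mapsto\mathcal E(f_\beta)+4\lambda\|\beta_{J^c}\|_1$. With $\Delta=\hat\beta-b$, strong
  convexity of the objective yields
  \[ \mathcal E(f_{\hat\beta})-\mathcal E(f_b)\le\Delta\cdot\Sigma\Delta-2\Delta\cdot\hat\Sigma\Delta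
     +2Z\cdot\Delta+2\lambda(\|b\|_1-\|\hat\beta\|_1),\qquad Z=(\Sigma-\hat\Sigma)b+\hat c-c. \]
  On the event $\Sigma\le\frac32\hat\Sigma$, $\|Z\|_\infty\le\lambda/2$, the right-hand side is at
  most $-\frac12\Delta\cdot\hat\Sigma\Delta+\lambda(3\|\Delta_J\|_1-\|\Delta_{J^c}\|_1)
  +4\lambda\|b_{J^c}\|_1$, and the definition of the compatibility constant bounds the first two
  terms by $9\lambda^2|J|/(2\kappa)$ (\<open>lasso_oracle_inequality\<close>).
  
  The bound on $Z$ is possible because $b$ is deterministic: Bernstein's inequality applies to each
  coordinate of $Z$. It needs a bound on $b$ in terms of the data constants, and
  \<open>penalized_risk_minimizer\<close> provides $b\cdot\Sigma b\le B_Y^2$, since shrinking a longer vector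
  does not increase the objective.
  
  The comparison of $\Sigma$ with $\hat\Sigma$ is a matrix Chernoff bound with only the factor $p$ in
  front of the exponential (\<open>matrix_Chernoff_lower\<close>). In place of the matrix exponential it uses
  the polynomial potential $\mathrm{tr}\,(I-\tau\sum_iw_iw_i^T)^m$ of the whitened and scaled covariates
  $w_i$. The step that usually rests on the Golden--Thompson inequality is
  \<open>trace_rank_one_update\<close>; for rank-one updates it follows by differentiating along a segment and
  from the log-convexity of the spectral moments $k\mapsto w\cdot B^kw$.
\<close>

section \<open>Positive semidefinite matrices and their square roots\<close>

lemma symmetric_inner:
  fixes A :: "real^'n^'n"
  assumes "transpose A = A"
  shows "(A *v x) \<bullet> y = x \<bullet> (A *v y)"
proof -
  have "x v* A = A *v x"
    using vector_transpose_matrix[of x A] by (simp add: assms)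
  then show ?thesis using dot_lmul_matrix[of x A y] by simp
qed

lemma psd_symmetric: "psd A \<Longrightarrow> transpose A = A"
  by (simp add: psd_def)

lemma psd_inner: "psd A \<Longrightarrow> (A *v x) \<bullet> y = x \<bullet> (A *v y)"
  by (simp add: psd_symmetric symmetric_inner)

lemma psd_nonneg: "psd A \<Longrightarrow> 0 \<le> v \<bullet> (A *v v)"
  by (simp add: psd_def)

lemma psd_Cauchy_Schwarz:
  assumes "psd A"
  shows "(x \<bullet> (A *v y))\<^sup>2 \<le> (x \<bullet> (A *v x)) * (y \<bullet> (A *v y))"
proof -
  define a b c where "a = x \<bullet> (A *v x)" and "b = x \<bullet> (A *v y)" and "c = y \<bullet> (A *v y)"
  have form: "0 \<le> s\<^sup>2 * a + 2 * s * t * b + t\<^sup>2 * c" for s t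
  proof -
    have "y \<bullet> (A *v x) = b"
      using psd_inner[OF assms, of x y] by (simp add: b_def inner_commute)
    then have "(s *\<^sub>R x + t *\<^sub>R y) \<bullet> (A *v (s *\<^sub>R x + t *\<^sub>R y))
        = s\<^sup>2 * a + 2 * s * t * b + t\<^sup>2 * c"
      by (simp add: a_def b_def c_def matrix_vector_right_distrib matrix_vector_mult_scaleR
          inner_add_left inner_add_right power2_eq_square algebra_simps)
    then show ?thesis
      using psd_nonneg[OF assms] by metis
  qed
  have "0 \<le> c"
    using psd_nonneg[OF assms] by (simp add: c_def)
  then consider "c > 0" | "c = 0" by linarith
  then have "b\<^sup>2 \<le> a * c"
  proof cases
    case 1
    have "0 \<le> c * (a * c - b\<^sup>2)"
      using form[of c "- b"] by (simp add: power2_eq_square algebra_simps)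
    with 1 show ?thesis
      by (simp add: zero_le_mult_iff)
  next
    case 2
    \<comment> \<open>With \<open>c = 0\<close> the form \<open>s\<^sup>2 a + 2stb\<close> is linear in \<open>t\<close>; these \<open>s, t\<close> make it \<open>- b\<^sup>2\<close>.\<close>
    have "0 \<le> - b\<^sup>2"
      using form[of b "- (a + 1) / 2"] 2 by (simp add: power2_eq_square field_simps)
    with 2 show ?thesis by simp
  qed
  then show ?thesis by (simp add: a_def b_def c_def)
qed

text \<open>
  By Cauchy--Schwarz an isotropic vector of a positive semidefinite form is orthogonal to
  everything in that form. This is how eigenvector equations are obtained below, without calculus.
\<close>

lemma psd_kernel:
  assumes "psd A" "v \<bullet> (A *v v) = 0"
  shows "A *v v = 0"
proof -
  have "((A *v v) \<bullet> (A *v v))\<^sup>2 \<le> 0"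
    using psd_Cauchy_Schwarz[OF assms(1), of "A *v v" v] assms(2) by simp
  then show ?thesis by simp
qed

lemma norm_symmetric_mult_sq:
  fixes B :: "real^'n^'n"
  assumes "transpose B = B"
  shows "(norm (B *v v))\<^sup>2 = v \<bullet> ((B ** B) *v v)"
  using symmetric_inner[OF assms, of v "B *v v"]
  by (simp add: power2_norm_eq_inner matrix_vector_mul_assoc)

text \<open>
  A maximiser of the Rayleigh quotient on the compact unit sphere is an eigenvector for the
  largest eigenvalue.
\<close>

lemma symmetric_top_eigenvector:
  fixes A :: "real^'n^'n"
  assumes sym: "transpose A = A"
  obtains v where "norm v = 1" "A *v v = (v \<bullet> (A *v v)) *\<^sub>R v"
    "\<And>u. u \<bullet> (A *v u) \<le> (v \<bullet> (A *v v)) * (u \<bullet> u)"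
proof -
  let ?S = "sphere 0 1 :: (real^'n) set"
  have "axis undefined 1 \<in> ?S" by simp
  then have "?S \<noteq> {}" by blast
  moreover have "continuous_on ?S (\<lambda>v. v \<bullet> (A *v v))"
    by (intro continuous_intros linear_continuous_on matrix_vector_mul_bounded_linear)
  ultimately obtain v where v: "v \<in> ?S" and max: "\<And>u. u \<in> ?S \<Longrightarrow> u \<bullet> (A *v u) \<le> v \<bullet> (A *v v)"
    using continuous_attains_sup[OF compact_sphere, of 0 1 "\<lambda>v. v \<bullet> (A *v v)"] by blast
  define \<mu> where "\<mu> = v \<bullet> (A *v v)"
  have bound: "u \<bullet> (A *v u) \<le> \<mu> * (u \<bullet> u)" for u
  proof (cases "u = 0")
    case False
    have "(inverse (norm u) *\<^sub>R u) \<bullet> (A *v (inverse (norm u) *\<^sub>R u)) \<le> \<mu>"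
      unfolding \<mu>_def by (rule max) (use False in simp)
    then have "(u \<bullet> (A *v u)) / (norm u)\<^sup>2 \<le> \<mu>"
      by (simp add: matrix_vector_mult_scaleR power2_eq_square divide_inverse algebra_simps)
    then show ?thesis
      using False by (simp add: divide_le_eq power2_norm_eq_inner)
  qed simp
  \<comment> \<open>\<open>\<mu> I - A\<close> is positive semidefinite and its form vanishes at \<open>v\<close>, so \<open>v\<close> is in its kernel.\<close>
  define C where "C = \<mu> *\<^sub>R mat 1 - A"
  have C: "C *v u = \<mu> *\<^sub>R u - A *v u" for u
    by (simp add: C_def matrix_vector_mult_diff_rdistrib scaleR_matrix_vector_assoc[symmetric])
  have "transpose C = C"
  proof -
    have "transpose C = transpose (\<mu> *\<^sub>R mat 1) - transpose A"
      by (simp add: C_def transpose_def vec_eq_iff)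
    then show ?thesis by (simp add: C_def transpose_scalar sym)
  qed
  then have "psd C"
    using bound by (auto simp: psd_def C inner_diff_right)
  moreover have "v \<bullet> (C *v v) = 0"
    using v by (simp add: C inner_diff_right \<mu>_def dot_square_norm)
  ultimately have "C *v v = 0" by (rule psd_kernel)
  then have "A *v v = \<mu> *\<^sub>R v" by (simp add: C)
  show ?thesis
  proof (rule that)
    show "norm v = 1" using v by simp
    show "A *v v = (v \<bullet> (A *v v)) *\<^sub>R v"
      using \<open>A *v v = \<mu> *\<^sub>R v\<close> unfolding \<mu>_def .
    show "u \<bullet> (A *v u) \<le> (v \<bullet> (A *v v)) * (u \<bullet> u)" for u
      using bound unfolding \<mu>_def .
  qed
qed

definition outer :: "real^'n \<Rightarrow> real^'n^'n" where
  "outer z = (\<chi> i j. z $ i * z $ j)"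

lemma outer_mult: "outer z *v v = (z \<bullet> v) *\<^sub>R z"
proof (rule vec_eq_iff[THEN iffD2], rule allI)
  fix i
  have "(outer z *v v) $ i = (\<Sum>j\<in>UNIV. z $ i * (z $ j * v $ j))"
    by (simp add: outer_def matrix_vector_mult_def mult.assoc)
  also have "\<dots> = z $ i * (z \<bullet> v)"
    by (simp add: inner_vec_def sum_distrib_left)
  finally show "(outer z *v v) $ i = ((z \<bullet> v) *\<^sub>R z) $ i" by simp
qed

lemma transpose_outer [simp]: "transpose (outer z) = outer z"
  by (simp add: outer_def transpose_def vec_eq_iff mult.commute)

lemma transpose_add: "transpose (A + B) = transpose A + transpose B"
  by (simp add: transpose_def vec_eq_iff)

lemma transpose_diff: "transpose (A - B) = transpose A - transpose B"
  by (simp add: transpose_def vec_eq_iff)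

text \<open>
  Splitting off a top eigenpair $(\mu, v)$ leaves the positive semidefinite matrix
  $A - \mu vv^T$, whose kernel is strictly larger since it also contains $v$. If $B'$ is a square
  root of that matrix, then $B'v = 0$, the cross terms vanish, and $B' + \sqrt\mu\, vv^T$ is a
  square root of $A$.
\<close>

lemma psd_sqrt_exists:
  fixes A :: "real^'n^'n"
  assumes "psd A"
  shows "\<exists>B. psd B \<and> B ** B = A"
  using assms
proof (induction "CARD('n) - dim {v. A *v v = 0}" arbitrary: A rule: less_induct)
  case less
  show ?case
  proof (cases "A = 0")
    case True
    have "psd (0 :: real^'n^'n)"
      by (simp add: psd_def transpose_def vec_eq_iff)
    moreover have "(0 :: real^'n^'n) ** 0 = A"
      by (simp add: True matrix_matrix_mult_def vec_eq_iff)
    ultimately show ?thesis by blast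
  next
    case False
    obtain v where v: "norm v = 1" "A *v v = (v \<bullet> (A *v v)) *\<^sub>R v"
      and top: "\<And>u. u \<bullet> (A *v u) \<le> (v \<bullet> (A *v v)) * (u \<bullet> u)"
      using symmetric_top_eigenvector[OF psd_symmetric[OF less.prems]] by blast
    define \<mu> where "\<mu> = v \<bullet> (A *v v)"
    have vv: "v \<bullet> v = 1" using v(1) by (simp add: dot_square_norm)
    have Av: "A *v v = \<mu> *\<^sub>R v" using v(2) by (simp add: \<mu>_def)
    have "\<mu> \<noteq> 0"
    proof
      assume "\<mu> = 0"
      then have "u \<bullet> (A *v u) = 0" for u
        using top[of u] psd_nonneg[OF less.prems, of u] by (simp add: \<mu>_def)
      then have "A *v u = 0" for u
        using psd_kernel[OF less.prems] by blast
      then have "A = 0"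
        by (simp add: matrix_eq)
      with False show False by simp
    qed
    moreover have "\<mu> \<ge> 0"
      using psd_nonneg[OF less.prems] by (simp add: \<mu>_def)
    ultimately have \<mu>: "\<mu> > 0" by simp
    define A' where "A' = A - \<mu> *\<^sub>R outer v"
    have A': "A' *v u = A *v u - (\<mu> * (v \<bullet> u)) *\<^sub>R v" for u
      by (simp add: A'_def matrix_vector_mult_diff_rdistrib scaleR_matrix_vector_assoc[symmetric]
          outer_mult)
    have "psd A'"
      unfolding psd_def
    proof
      show "transpose A' = A'"
        by (simp add: A'_def transpose_diff transpose_scalar psd_symmetric[OF less.prems])
      show "\<forall>u. 0 \<le> u \<bullet> (A' *v u)"
      proof
        fix u
        have "v \<bullet> (A *v u) = \<mu> * (v \<bullet> u)"
          using psd_inner[OF less.prems, of v u] by (simp add: Av)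
        then have "(\<mu> * (v \<bullet> u))\<^sup>2 \<le> \<mu> * (u \<bullet> (A *v u))"
          using psd_Cauchy_Schwarz[OF less.prems, of v u] by (simp add: \<mu>_def[symmetric])
        then have "\<mu> * (\<mu> * (v \<bullet> u)\<^sup>2) \<le> \<mu> * (u \<bullet> (A *v u))"
          by (simp add: power2_eq_square algebra_simps)
        then have "\<mu> * (v \<bullet> u)\<^sup>2 \<le> u \<bullet> (A *v u)"
          using \<mu> by (simp add: mult_le_cancel_left_pos)
        then show "0 \<le> u \<bullet> (A' *v u)"
          by (simp add: A' inner_diff_right power2_eq_square inner_commute[of u v])
      qed
    qed
    have A'v: "A' *v v = 0" by (simp add: A' Av vv)
    have sub: "subspace {u. A' *v u = 0}" "subspace {u. A *v u = 0}"
      by (simp_all add: subspace_def matrix_vector_right_distrib matrix_vector_mult_scaleR)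
    have "{u. A *v u = 0} \<subset> {u. A' *v u = 0}"
    proof
      show "{u. A *v u = 0} \<subseteq> {u. A' *v u = 0}"
      proof clarsimp
        fix u assume u: "A *v u = 0"
        have "\<mu> * (v \<bullet> u) = 0"
          using psd_inner[OF less.prems, of v u] by (simp add: Av u)
        then show "A' *v u = 0" using \<mu> by (simp add: A' u)
      qed
      have "A *v v \<noteq> 0" using \<mu> vv by (auto simp: Av)
      with A'v show "{u. A *v u = 0} \<noteq> {u. A' *v u = 0}" by blast
    qed
    then have "dim {u. A *v u = 0} < dim {u. A' *v u = 0}"
      using dim_psubset sub span_eq_iff by metis
    moreover have "dim {u. A' *v u = 0} \<le> CARD('n)"
      using dim_subset_UNIV[of "{u. A' *v u = 0}"] by simp
    ultimately have "CARD('n) - dim {u. A' *v u = 0} < CARD('n) - dim {u. A *v u = 0}"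
      by linarith
    then obtain B' where B': "psd B'" "B' ** B' = A'"
      using less.hyps \<open>psd A'\<close> by blast
    have "norm (B' *v v) = 0"
      using norm_symmetric_mult_sq[OF psd_symmetric[OF B'(1)], of v] by (simp add: B'(2) A'v)
    then have B'v: "B' *v v = 0" by simp
    define B where "B = B' + sqrt \<mu> *\<^sub>R outer v"
    have B: "B *v u = B' *v u + (sqrt \<mu> * (v \<bullet> u)) *\<^sub>R v" for u
      by (simp add: B_def matrix_vector_mult_add_rdistrib scaleR_matrix_vector_assoc[symmetric]
          outer_mult)
    have "psd B"
      unfolding psd_def
    proof
      show "transpose B = B"
        by (simp add: B_def transpose_add transpose_scalar psd_symmetric[OF B'(1)])
      show "\<forall>u. 0 \<le> u \<bullet> (B *v u)"
        using psd_nonneg[OF B'(1)] \<mu>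
        by (auto simp: B inner_add_right inner_commute[of _ v] mult.assoc)
    qed
    moreover have "B ** B = A"
      unfolding matrix_eq
    proof
      fix u
      have "v \<bullet> (B' *v u) = 0"
        using psd_inner[OF B'(1), of v u] by (simp add: B'v)
      then have "B *v (B *v u) = B' *v (B' *v u) + (\<mu> * (v \<bullet> u)) *\<^sub>R v"
        using \<mu> by (simp add: B matrix_vector_right_distrib matrix_vector_mult_scaleR B'v
            inner_add_right vv algebra_simps)
      also have "\<dots> = A *v u"
        by (simp add: matrix_vector_mul_assoc B'(2) A')
      finally show "(B ** B) *v u = A *v u"
        by (simp add: matrix_vector_mul_assoc)
    qed
    ultimately show ?thesis by blast
  qed
qed

text \<open>
  If no unit eigenvector has a nonzero eigenvalue, then the top eigenvalues of \<open>D\<close> and of \<open>- D\<close>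
  both vanish, so the quadratic form of \<open>D\<close> is identically zero.
\<close>

lemma symmetric_eq_0:
  fixes D :: "real^'n^'n"
  assumes sym: "transpose D = D" and form: "\<And>v c. D *v v = c *\<^sub>R v \<Longrightarrow> norm v = 1 \<Longrightarrow> c = 0"
  shows "D = 0"
proof -
  have le: "u \<bullet> (E *v u) \<le> 0" if E: "E = D \<or> E = - D" for E u
  proof -
    have "transpose E = E"
      using E sym by (auto simp: transpose_def vec_eq_iff)
    then obtain v where v: "norm v = 1" "E *v v = (v \<bullet> (E *v v)) *\<^sub>R v"
      "u \<bullet> (E *v u) \<le> (v \<bullet> (E *v v)) * (u \<bullet> u)"
      using symmetric_top_eigenvector by metis
    have "v \<bullet> (E *v v) = 0"
    proof (cases "E = D")
      case True
      then show ?thesis using form v(1,2) by blast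
    next
      case False
      then have "E = - D" using E by blast
      moreover have "(- D) *v v = - (D *v v)"
        using matrix_vector_mult_diff_rdistrib[of 0 D v] by simp
      ultimately have "D *v v = (- (v \<bullet> (E *v v))) *\<^sub>R v"
        using v(2) by (metis add.inverse_inverse scaleR_minus_left)
      then show ?thesis using form[OF _ v(1)] by fastforce
    qed
    with v(3) show ?thesis by simp
  qed
  have zero: "u \<bullet> (D *v u) = 0" for u
  proof -
    have "(- D) *v u = - (D *v u)"
      using matrix_vector_mult_diff_rdistrib[of 0 D u] by simp
    then show ?thesis using le[of D u] le[of "- D" u] by simp
  qed
  then have "psd D" using sym by (simp add: psd_def)
  then have "D *v u = 0" for u using zero psd_kernel by blast
  then show ?thesis by (simp add: matrix_eq)
qed

text \<open>
  On an eigenvector $v$ of $B - C$ with eigenvalue $c$, the equality $B^2 = C^2$ reads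
  $c\,(v\cdot Bv + v\cdot Cv) = 0$, and if the bracket vanishes then $Bv = Cv = 0$; so $c = 0$.
\<close>

lemma psd_sqrt_unique:
  fixes B C :: "real^'n^'n"
  assumes "psd B" "psd C" "B ** B = C ** C"
  shows "B = C"
proof -
  have "transpose (B - C) = B - C"
    using assms by (simp add: transpose_diff psd_symmetric)
  then have "B - C = 0"
  proof (rule symmetric_eq_0)
    fix v c assume eig: "(B - C) *v v = c *\<^sub>R v" and v: "norm v = 1"
    have diff: "B *v v = C *v v + c *\<^sub>R v"
      using eig by (simp add: matrix_vector_mult_diff_rdistrib algebra_simps)
    have "B *v (B *v v) = C *v (C *v v)"
      using assms(3) by (simp add: matrix_vector_mul_assoc)
    then have "(B *v v) \<bullet> (B *v v) = (C *v v) \<bullet> (C *v v)"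
      using psd_inner[OF assms(1)] psd_inner[OF assms(2)] by simp
    then have "c * (v \<bullet> (B *v v) + v \<bullet> (C *v v)) = 0"
      by (simp add: diff inner_add_left inner_add_right inner_commute algebra_simps)
    moreover have "c = 0" if "v \<bullet> (B *v v) + v \<bullet> (C *v v) = 0"
    proof -
      have "v \<bullet> (B *v v) = 0" "v \<bullet> (C *v v) = 0"
        using that psd_nonneg[OF assms(1), of v] psd_nonneg[OF assms(2), of v] by linarith+
      then have "B *v v = 0" "C *v v = 0"
        using psd_kernel assms by blast+
      then show "c = 0" using diff v by auto
    qed
    ultimately show "c = 0" by auto
  qed
  then show ?thesis by simp
qed

lemma psd_sqrt:
  assumes "psd A"
  shows "psd (psd_sqrt A)" "psd_sqrt A ** psd_sqrt A = A"
proof -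
  have "\<exists>!B. psd B \<and> B ** B = A"
    using psd_sqrt_exists[OF assms] psd_sqrt_unique by metis
  then have "psd (psd_sqrt A) \<and> psd_sqrt A ** psd_sqrt A = A"
    unfolding psd_sqrt_def by (rule theI')
  then show "psd (psd_sqrt A)" "psd_sqrt A ** psd_sqrt A = A" by auto
qed

lemma norm_psd_sqrt_sq:
  assumes "psd A"
  shows "(norm (psd_sqrt A *v v))\<^sup>2 = v \<bullet> (A *v v)"
  by (simp add: norm_symmetric_mult_sq psd_symmetric psd_sqrt[OF assms])

section \<open>Spectral moments and traces of matrix powers\<close>

primrec matpow :: "real^'n^'n \<Rightarrow> nat \<Rightarrow> real^'n^'n" where
  "matpow A 0 = mat 1"
| "matpow A (Suc k) = A ** matpow A k"

lemma matpow_add: "matpow A (i + j) = matpow A i ** matpow A j"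
  by (induction i) (simp_all add: matrix_mul_assoc)

lemma matpow_Suc_right: "matpow A (Suc k) = matpow A k ** A"
  using matpow_add[of A k 1] by simp

lemma psd_matpow_inner:
  assumes "psd B"
  shows "(matpow B i *v x) \<bullet> y = x \<bullet> (matpow B i *v y)"
proof (induction i arbitrary: x y)
  case (Suc i)
  have "(matpow B (Suc i) *v x) \<bullet> y = (B *v (matpow B i *v x)) \<bullet> y"
    by (simp add: matrix_vector_mul_assoc)
  also have "\<dots> = x \<bullet> (matpow B i *v (B *v y))"
    using psd_inner[OF assms] Suc by simp
  also have "\<dots> = x \<bullet> (matpow B (Suc i) *v y)"
    by (simp add: matrix_vector_mul_assoc matpow_Suc_right del: matpow.simps)
  finally show ?case .
qed simp

lemma transpose_eqI:
  fixes A :: "real^'n^'n"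
  assumes "\<And>x y. (A *v x) \<bullet> y = x \<bullet> (A *v y)"
  shows "transpose A = A"
proof -
  have "A $ i $ j = A $ j $ i" for i j
    using assms[of "axis j 1" "axis i 1"]
    by (simp add: matrix_vector_mult_basis column_def inner_axis inner_axis')
  then show ?thesis by (simp add: transpose_def vec_eq_iff)
qed

text \<open>
  Induction in steps of two: $v\cdot B^{k+2}v = (Bv)\cdot B^k(Bv)$.
\<close>

lemma psd_matpow:
  assumes "psd B"
  shows "psd (matpow B k)"
proof -
  have "0 \<le> v \<bullet> (matpow B k *v v)" for v
  proof (induction k arbitrary: v rule: induct_nat_012)
    case 1
    then show ?case using psd_nonneg[OF assms] by simp
  next
    case (ge2 k)
    have "v \<bullet> (matpow B (Suc (Suc k)) *v v) = v \<bullet> (B *v (matpow B k *v (B *v v)))"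
      using matpow_Suc_right[of B "Suc k"]
      by (simp add: matrix_vector_mul_assoc matrix_mul_assoc matpow_Suc_right[of B k, simplified])
    also have "\<dots> = (B *v v) \<bullet> (matpow B k *v (B *v v))"
      using psd_inner[OF assms] by simp
    finally show ?case using ge2 by simp
  qed simp
  then show ?thesis
    unfolding psd_def using psd_matpow_inner[OF assms] transpose_eqI by blast
qed

text \<open>
  In terms of the spectral measure of \<open>B\<close> at \<open>z\<close> these are the moments $\int x^k\,d\mu(x)$,
  so they form a log-convex sequence when \<open>B\<close> is positive semidefinite.
\<close>

definition moment :: "real^'n^'n \<Rightarrow> real^'n \<Rightarrow> nat \<Rightarrow> real" where
  "moment B z k = z \<bullet> (matpow B k *v z)"

lemma moment_0 [simp]: "moment B z 0 = z \<bullet> z"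
  by (simp add: moment_def)

lemma moment_nonneg: "psd B \<Longrightarrow> 0 \<le> moment B z k"
  by (simp add: moment_def psd_matpow psd_nonneg)

lemma moment_add2: "psd B \<Longrightarrow> moment B z (k + 2 * j) = moment B (matpow B j *v z) k"
proof -
  assume "psd B"
  have "k + 2 * j = j + (k + j)" by simp
  then have "moment B z (k + 2 * j) = z \<bullet> (matpow B j *v (matpow B k *v (matpow B j *v z)))"
    unfolding moment_def by (simp only: matpow_add matrix_vector_mul_assoc matrix_mul_assoc)
  then show ?thesis
    using psd_matpow_inner[OF \<open>psd B\<close>] by (simp add: moment_def)
qed

lemma moment_even: "psd B \<Longrightarrow> moment B z (2 * j) = (norm (matpow B j *v z))\<^sup>2"
  using moment_add2[of B z 0 j] by (simp add: power2_norm_eq_inner)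

lemma moment_odd: "psd B \<Longrightarrow> moment B z (Suc (2 * j)) = (matpow B j *v z) \<bullet> (B *v (matpow B j *v z))"
  using moment_add2[of B z 1 j] by (simp add: moment_def)

lemma moment_log_convex:
  assumes "psd B"
  shows "(moment B z (Suc k))\<^sup>2 \<le> moment B z k * moment B z (Suc (Suc k))"
proof -
  have "moment B z (Suc k) = z \<bullet> (matpow B k *v (B *v z))"
    by (simp add: moment_def matpow_Suc_right matrix_vector_mul_assoc del: matpow.simps)
  moreover have "moment B z (Suc (Suc k)) = (B *v z) \<bullet> (matpow B k *v (B *v z))"
    using moment_add2[OF assms, of z k 1] by (simp add: moment_def)
  ultimately show ?thesis
    using psd_Cauchy_Schwarz[OF psd_matpow[OF assms], of z k "B *v z"]
    by (simp add: moment_def)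
qed

text \<open>
  The ratios $m_{k+1}/m_k$ of a log-convex sequence increase, so weight can be moved from the
  smaller index to the larger one until the smaller index is $0$. Zero terms are why the proof
  avoids the ratios themselves.
\<close>

lemma log_convex_Chebyshev:
  fixes m :: "nat \<Rightarrow> real"
  assumes nonneg: "\<And>k. 0 \<le> m k" and lc: "\<And>k. (m (Suc k))\<^sup>2 \<le> m k * m (Suc (Suc k))"
  shows "m i * m j \<le> m 0 * m (i + j)"
proof -
  have shift: "m (Suc i) * m (i + d) \<le> m i * m (Suc (i + d))" for i d
  proof (induction d)
    case (Suc d)
    define a b c where "a = m (i + d)" and "b = m (Suc (i + d))" and "c = m (Suc (Suc (i + d)))"
    have abc: "0 \<le> a" "0 \<le> b" "0 \<le> c" "b\<^sup>2 \<le> a * c" and IH: "m (Suc i) * a \<le> m i * b"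
      using nonneg lc Suc.IH by (simp_all add: a_def b_def c_def)
    have "m (Suc i) * b \<le> m i * c"
    proof (cases "b = 0")
      case True
      then show ?thesis using nonneg[of i] abc by simp
    next
      case False
      then have b: "b > 0" using abc by simp
      have "b * (m (Suc i) * b) = m (Suc i) * b\<^sup>2"
        by (simp add: power2_eq_square)
      also have "\<dots> \<le> m (Suc i) * (a * c)"
        using abc nonneg by (intro mult_left_mono) auto
      also have "\<dots> \<le> m i * b * c"
        using IH abc(3) mult_right_mono[of "m (Suc i) * a" "m i * b" c] by (simp add: mult.assoc)
      finally have "b * (m (Suc i) * b) \<le> b * (m i * c)"
        by (simp add: mult_ac)
      with b show ?thesis by (simp add: mult_le_cancel_left_pos)
    qed
    then show ?case by (simp add: b_def c_def)
  qed (simp add: mult.commute)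
  have le: "m i * m j \<le> m 0 * m (i + j)" if "i \<le> j" for i j
    using that
  proof (induction i arbitrary: j)
    case (Suc i)
    have "m (Suc i) * m j \<le> m i * m (Suc j)"
      using shift[of i "j - i"] Suc.prems by simp
    also have "\<dots> \<le> m 0 * m (i + Suc j)"
      using Suc.IH[of "Suc j"] Suc.prems by simp
    finally show ?case by simp
  qed simp
  show ?thesis
    using le[of i j] le[of j i] by (cases "i \<le> j") (auto simp: mult.commute add.commute)
qed

lemma moment_Chebyshev:
  "psd B \<Longrightarrow> moment B z i * moment B z j \<le> (z \<bullet> z) * moment B z (i + j)"
  using log_convex_Chebyshev[of "moment B z", OF moment_nonneg moment_log_convex, of i j] by simp

text \<open>
  Jensen's inequality for the spectral measure at a unit vector.
\<close>

lemma moment_power_le: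
  assumes "psd B" "norm u = 1"
  shows "(u \<bullet> (B *v u)) ^ k \<le> moment B u k"
proof (induction k)
  case 0
  show ?case using assms(2) by (simp add: dot_square_norm)
next
  case (Suc k)
  have u: "u \<bullet> u = 1" using assms(2) by (simp add: dot_square_norm)
  have "(u \<bullet> (B *v u)) ^ Suc k \<le> (u \<bullet> (B *v u)) * moment B u k"
    using Suc psd_nonneg[OF assms(1)] by (simp add: mult_left_mono)
  also have "\<dots> = moment B u 1 * moment B u k"
    by (simp add: moment_def)
  also have "\<dots> \<le> moment B u (Suc k)"
    using moment_Chebyshev[OF assms(1), of u 1 k] u by simp
  finally show ?case .
qed

lemma psd_contraction_norm:
  assumes "psd B" and le: "\<And>v. v \<bullet> (B *v v) \<le> v \<bullet> v"
  shows "(norm (B *v v))\<^sup>2 \<le> v \<bullet> (B *v v)"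
proof -
  define y where "y = B *v v"
  have "(y \<bullet> y)\<^sup>2 = (y \<bullet> (B *v v))\<^sup>2"
    by (simp add: y_def)
  also have "\<dots> \<le> (y \<bullet> (B *v y)) * (v \<bullet> (B *v v))"
    by (rule psd_Cauchy_Schwarz[OF assms(1)])
  also have "\<dots> \<le> (y \<bullet> y) * (v \<bullet> (B *v v))"
    using le psd_nonneg[OF assms(1)] by (intro mult_right_mono)
  finally have "(y \<bullet> y) * (y \<bullet> y) \<le> (y \<bullet> y) * (v \<bullet> (B *v v))"
    by (simp add: power2_eq_square)
  then have "y \<bullet> y \<le> v \<bullet> (B *v v)"
    using psd_nonneg[OF assms(1), of v]
    by (cases "y = 0") (auto simp: mult_le_cancel_left_pos)
  then show ?thesis by (simp add: power2_norm_eq_inner y_def)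
qed

lemma norm_matpow_le:
  assumes "psd B" and "\<And>v. v \<bullet> (B *v v) \<le> v \<bullet> v"
  shows "norm (matpow B k *v v) \<le> norm v"
proof (induction k)
  case (Suc k)
  let ?y = "matpow B k *v v"
  have "(norm (B *v ?y))\<^sup>2 \<le> (norm ?y)\<^sup>2"
    using psd_contraction_norm[OF assms, of ?y] assms(2)[of ?y] by (simp add: power2_norm_eq_inner)
  then have "norm (B *v ?y) \<le> norm ?y"
    by (rule power2_le_imp_le) simp
  with Suc show ?case by (simp add: matrix_vector_mul_assoc)
qed simp

lemma trace_eq_sum_moment: "trace B = (\<Sum>i\<in>UNIV. axis i 1 \<bullet> (B *v axis i 1))"
  for B :: "real^'n^'n"
  by (simp add: trace_def matrix_vector_mult_basis column_def inner_axis')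

lemma trace_symmetric_sq:
  fixes C :: "real^'n^'n"
  assumes "transpose C = C"
  shows "trace (C ** C) = (\<Sum>i\<in>UNIV. (norm (C *v axis i 1))\<^sup>2)"
  by (simp add: trace_eq_sum_moment norm_symmetric_mult_sq[OF assms])

lemma norm_mult_sq_le_trace:
  fixes C :: "real^'n^'n"
  assumes sym: "transpose C = C" and u: "norm u = 1"
  shows "(norm (C *v u))\<^sup>2 \<le> trace (C ** C)"
proof -
  have "(norm (C *v u))\<^sup>2 = (\<Sum>i\<in>UNIV. ((C *v u) $ i)\<^sup>2)"
    unfolding power2_norm_eq_inner by (simp add: inner_vec_def power2_eq_square)
  also have "\<dots> \<le> (\<Sum>i\<in>UNIV. (norm (C *v axis i 1))\<^sup>2)"
  proof (rule sum_mono)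
    fix i
    have "(C *v u) $ i = axis i 1 \<bullet> (C *v u)"
      by (simp add: inner_axis')
    also have "\<dots> = (C *v axis i 1) \<bullet> u"
      by (rule symmetric_inner[OF sym, symmetric])
    finally have "\<bar>(C *v u) $ i\<bar> \<le> norm (C *v axis i 1)"
      using Cauchy_Schwarz_ineq2[of "C *v axis i 1" u] u by simp
    then show "((C *v u) $ i)\<^sup>2 \<le> (norm (C *v axis i 1))\<^sup>2"
      using abs_le_square_iff by fastforce
  qed
  also have "\<dots> = trace (C ** C)"
    by (simp add: trace_symmetric_sq[OF sym])
  finally show ?thesis .
qed

text \<open>
  For even \<open>m\<close> the matrix $B^m$ is the square of the symmetric matrix $B^{m/2}$, so the trace is
  the squared Frobenius norm of $B^{m/2}$, which dominates its operator norm.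
\<close>

lemma moment_le_trace:
  assumes "psd B" "even m" "norm u = 1"
  shows "moment B u m \<le> trace (matpow B m)"
proof -
  obtain j where j: "m = 2 * j" using assms(2) by blast
  have "matpow B m = matpow B j ** matpow B j"
    by (simp add: j mult_2 matpow_add)
  then show ?thesis
    using norm_mult_sq_le_trace[OF psd_symmetric[OF psd_matpow[OF assms(1)]] assms(3), of j]
    by (simp add: j moment_even[OF assms(1)])
qed

lemma trace_outer_mult: "trace (outer w ** A) = w \<bullet> (A *v w)"
proof -
  have "trace (outer w ** A) = trace (A ** outer w)"
    by (rule trace_mul_sym)
  also have "\<dots> = (\<Sum>i\<in>UNIV. (w \<bullet> axis i 1) * ((A *v w) $ i))"
    by (simp add: trace_eq_sum_moment matrix_vector_mul_assoc[symmetric] outer_mult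
        matrix_vector_mult_scaleR inner_axis')
  also have "\<dots> = w \<bullet> (A *v w)"
    by (simp add: inner_axis) (simp add: inner_vec_def)
  finally show ?thesis .
qed

lemma bounded_bilinear_matrix_mult:
  "bounded_bilinear ((**) :: real^'n^'m \<Rightarrow> real^'k^'n \<Rightarrow> real^'k^'m)"
proof -
  have "bilinear ((**) :: real^'n^'m \<Rightarrow> real^'k^'n \<Rightarrow> real^'k^'m)"
    unfolding bilinear_def
    by (intro conjI allI linearI)
      (simp_all add: matrix_matrix_mult_def vec_eq_iff sum.distrib sum_distrib_left algebra_simps)
  then show ?thesis by (simp add: bilinear_conv_bounded_bilinear)
qed

lemma has_vector_derivative_matpow:
  fixes B D :: "real^'n^'n"
  shows "((\<lambda>s. matpow (B - s *\<^sub>R D) k) has_vector_derivative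
     - (\<Sum>i<k. matpow (B - s *\<^sub>R D) i ** (D ** matpow (B - s *\<^sub>R D) (k - Suc i)))) (at s)"
proof (induction k)
  case (Suc k)
  let ?B = "B - s *\<^sub>R D"
  let ?S = "\<Sum>i<k. matpow ?B i ** (D ** matpow ?B (k - Suc i))"
  have "((\<lambda>s. B - s *\<^sub>R D) has_vector_derivative - D) (at s)"
    by (auto intro!: derivative_eq_intros)
  from bounded_bilinear.has_vector_derivative[OF bounded_bilinear_matrix_mult this Suc.IH]
  have "((\<lambda>s. matpow (B - s *\<^sub>R D) (Suc k)) has_vector_derivative
      (?B ** - ?S + (- D) ** matpow ?B k)) (at s)"
    by simp
  also have "?B ** - ?S + (- D) ** matpow ?B k
      = - (\<Sum>i<Suc k. matpow ?B i ** (D ** matpow ?B (Suc k - Suc i)))"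
  proof -
    have "?B ** - ?S = - (\<Sum>i<k. matpow ?B (Suc i) ** (D ** matpow ?B (k - Suc i)))"
      by (simp add: bounded_bilinear.minus_right[OF bounded_bilinear_matrix_mult]
          bounded_bilinear.sum_right[OF bounded_bilinear_matrix_mult] matrix_mul_assoc)
    moreover have "(- D) ** matpow ?B k = - (D ** matpow ?B k)"
      by (rule bounded_bilinear.minus_left[OF bounded_bilinear_matrix_mult])
    ultimately show ?thesis
      by (simp add: sum.lessThan_Suc_shift del: sum.lessThan_Suc matpow.simps(2))
  qed
  finally show ?case .
qed simp

lemma linear_trace: "linear (trace :: real^'n^'n \<Rightarrow> real)"
  by (rule linearI) (simp_all add: trace_def sum.distrib sum_distrib_left)

text \<open>
  The product rule gives $m$ terms $B_s^i\,ww^T B_s^{m-1-i}$; by cyclicity they all have the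
  same trace $w\cdot B_s^{m-1}w$.
\<close>

lemma has_real_derivative_trace_matpow:
  fixes B :: "real^'n^'n"
  shows "((\<lambda>s. trace (matpow (B - s *\<^sub>R outer w) m)) has_real_derivative
     - (real m * moment (B - s *\<^sub>R outer w) w (m - 1))) (at s)"
proof -
  let ?B = "B - s *\<^sub>R outer w"
  have bl: "bounded_linear (trace :: real^'n^'n \<Rightarrow> real)"
    using linear_trace by (simp only: linear_conv_bounded_linear)
  have "trace (matpow ?B i ** (outer w ** matpow ?B (m - Suc i))) = moment ?B w (m - 1)"
    if "i < m" for i
  proof -
    have "trace (matpow ?B i ** (outer w ** matpow ?B (m - Suc i)))
        = trace (outer w ** (matpow ?B (m - Suc i) ** matpow ?B i))"
      by (subst trace_mul_sym) (simp add: matrix_mul_assoc)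
    also have "matpow ?B (m - Suc i) ** matpow ?B i = matpow ?B (m - 1)"
      using that by (simp add: matpow_add[symmetric])
    finally show ?thesis by (simp add: trace_outer_mult moment_def)
  qed
  then have "trace (- (\<Sum>i<m. matpow ?B i ** (outer w ** matpow ?B (m - Suc i))))
      = - (real m * moment ?B w (m - 1))"
    by (simp add: linear_neg[OF linear_trace] linear_sum[OF linear_trace])
  then show ?thesis
    using bounded_linear.has_vector_derivative[OF bl has_vector_derivative_matpow[of B "outer w" m s]]
    by (simp add: has_real_derivative_iff_has_vector_derivative)
qed

lemma has_real_derivative_moment:
  fixes B :: "real^'n^'n"
  shows "((\<lambda>s. moment (B - s *\<^sub>R outer w) w k) has_real_derivative
     - (\<Sum>i<k. moment (B - s *\<^sub>R outer w) w i * moment (B - s *\<^sub>R outer w) w (k - Suc i))) (at s)"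
proof -
  let ?B = "B - s *\<^sub>R outer w"
  have lin: "linear (\<lambda>A :: real^'n^'n. w \<bullet> (A *v w))"
    by (rule linearI)
      (simp_all add: matrix_vector_mult_add_rdistrib inner_add_right scaleR_matrix_vector_assoc[symmetric])
  then have bl: "bounded_linear (\<lambda>A :: real^'n^'n. w \<bullet> (A *v w))"
    by (simp only: linear_conv_bounded_linear)
  have mm: "w \<bullet> ((matpow ?B i ** (outer w ** matpow ?B j)) *v w) = moment ?B w i * moment ?B w j" for i j
    by (simp add: matrix_vector_mul_assoc[symmetric] outer_mult matrix_vector_mult_scaleR moment_def)
  then have "w \<bullet> ((- (\<Sum>i<k. matpow ?B i ** (outer w ** matpow ?B (k - Suc i)))) *v w)
      = - (\<Sum>i<k. moment ?B w i * moment ?B w (k - Suc i))"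
    by (simp only: linear_neg[OF lin] linear_sum[OF lin] mm)
  then show ?thesis
    using bounded_linear.has_vector_derivative[OF bl has_vector_derivative_matpow[of B "outer w" k s]]
    by (simp add: has_real_derivative_iff_has_vector_derivative moment_def)
qed

text \<open>
  A polynomial, rank-one form of the Golden--Thompson inequality. As \<open>m \<rightarrow> \<infinity>\<close> with $B = I - A/m$
  and $t = \theta/m$ it becomes
  $\mathrm{tr}\,e^{-A-\theta ww^T} \le \mathrm{tr}\,e^{-A}e^{-\theta ww^T}$ for a unit vector $w$.
  
  Put $B_s = B - s\,ww^T$. The trace of $B_s^m$ has derivative $-m\,g(s)$ with
  $g(s) = w\cdot B_s^{m-1}w$. The derivative of $g$ is minus a sum of $m-1$ products of moments;
  Chebyshev's inequality and $b I \le B_s$ bound each product by $g(s)/b$. Hence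
  $g(s) \ge g(0)e^{-ms/b}$, and integrating this over $[0,t]$ gives the claim, with $g(0)$ replaced
  by the smaller number $w\cdot B^m w$.
\<close>

lemma trace_rank_one_update:
  fixes B :: "real^'n^'n"
  assumes sym: "transpose B = B" and m: "even m" "m > 0" and b: "b > 0" and t: "0 \<le> t"
    and w: "w \<bullet> w \<le> 1"
    and upper: "\<And>v. v \<bullet> (B *v v) \<le> v \<bullet> v"
    and lower: "\<And>v. b * (v \<bullet> v) \<le> v \<bullet> ((B - t *\<^sub>R outer w) *v v)"
  shows "trace (matpow (B - t *\<^sub>R outer w) m)
     \<le> trace (matpow B m) - b * (1 - exp (- (t * m / b))) * moment B w m"
proof -
  define Bs where "Bs s = B - s *\<^sub>R outer w" for s
  have Bs: "Bs s *v v = B *v v - (s * (w \<bullet> v)) *\<^sub>R w" for s v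
    by (simp add: Bs_def matrix_vector_mult_diff_rdistrib scaleR_matrix_vector_assoc[symmetric] outer_mult)
  have form: "v \<bullet> (Bs s *v v) = v \<bullet> (B *v v) - s * (w \<bullet> v)\<^sup>2" for s v
    by (simp add: Bs inner_diff_right power2_eq_square inner_commute[of v w])
  have lowers: "b * (v \<bullet> v) \<le> v \<bullet> (Bs s *v v)" if "s \<le> t" for s v
  proof -
    have "s * (w \<bullet> v)\<^sup>2 \<le> t * (w \<bullet> v)\<^sup>2"
      using that by (rule mult_right_mono) simp
    then show ?thesis
      using lower[of v] form[of v s] form[of v t] by (simp add: Bs_def)
  qed
  have psd: "psd (Bs s)" if "s \<le> t" for s
    unfolding psd_def
  proof
    show "transpose (Bs s) = Bs s"
      by (simp add: Bs_def transpose_diff transpose_scalar sym)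
    show "\<forall>v. 0 \<le> v \<bullet> (Bs s *v v)"
      using lowers[OF that] b by (meson inner_ge_zero less_imp_le mult_nonneg_nonneg order_trans)
  qed
  obtain j where j: "m = 2 * Suc j"
    using m by (metis dvd_def gr0_implies_Suc mult_is_0 neq0_conv)
  define g where "g s = moment (Bs s) w (m - 1)" for s
  have g_nonneg: "0 \<le> g s" if "s \<le> t" for s
    by (simp add: g_def moment_nonneg psd that)
  have summand: "moment (Bs s) w i * moment (Bs s) w (m - 1 - Suc i) \<le> g s / b"
    if "s \<le> t" "i < m - 1" for s i
  proof -
    have "moment (Bs s) w i * moment (Bs s) w (m - 1 - Suc i) \<le> (w \<bullet> w) * moment (Bs s) w (m - 2)"
      using moment_Chebyshev[OF psd[OF that(1)], of w i "m - 1 - Suc i"] that(2)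
      by (simp add: numeral_2_eq_2)
    also have "\<dots> \<le> moment (Bs s) w (m - 2)"
      using w moment_nonneg[OF psd[OF that(1)]] by (simp add: mult_left_le_one_le)
    also have "\<dots> \<le> g s / b"
    proof -
      have "b * moment (Bs s) w (2 * j) \<le> moment (Bs s) w (Suc (2 * j))"
        using lowers[OF that(1)] by (simp add: moment_even moment_odd psd that(1) power2_norm_eq_inner)
      then show ?thesis
        using b by (simp add: g_def j le_divide_eq mult.commute)
    qed
    finally show ?thesis .
  qed
  \<comment> \<open>Monotonicity of \<open>\<phi>\<close> expresses \<open>g s \<ge> g 0 * exp (- m s / b)\<close>.\<close>
  define \<phi> where "\<phi> s = g s * exp (m * s / b)" for s :: real
  have \<phi>_mono: "\<phi> 0 \<le> \<phi> s" if s: "0 \<le> s" "s \<le> t" for s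
  proof (rule DERIV_nonneg_imp_nondecreasing[of 0 s \<phi>])
    show "0 \<le> s" by (rule s(1))
  next
    fix x assume x: "0 \<le> x" "x \<le> s"
    have xt: "x \<le> t" using x s by simp
    let ?S = "\<Sum>i<m - 1. moment (Bs x) w i * moment (Bs x) w (m - 1 - Suc i)"
    have "?S \<le> (\<Sum>i<m - 1. g x / b)"
      using summand[OF xt] by (intro sum_mono) simp
    also have "\<dots> = real (m - 1) * (g x / b)"
      by simp
    also have "\<dots> \<le> m * (g x / b)"
      using g_nonneg[OF xt] b by (intro mult_right_mono) auto
    finally have S: "?S \<le> m * (g x / b)" .
    have g': "(g has_real_derivative - ?S) (at x)"
      unfolding g_def Bs_def by (rule has_real_derivative_moment)
    have "(\<phi> has_real_derivative (- ?S) * exp (m * x / b) + g x * (exp (m * x / b) * (m / b))) (at x)"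
      unfolding \<phi>_def by (rule derivative_eq_intros g' refl | simp add: b less_imp_neq[OF b, symmetric])+
    moreover have "0 \<le> (- ?S) * exp (m * x / b) + g x * (exp (m * x / b) * (m / b))"
    proof -
      have "(- ?S) * exp (m * x / b) + g x * (exp (m * x / b) * (m / b))
          = (m * (g x / b) - ?S) * exp (m * x / b)"
        by (simp add: algebra_simps)
      then show ?thesis using S by simp
    qed
    ultimately show "\<exists>y. (\<phi> has_real_derivative y) (at x) \<and> y \<ge> 0" by blast
  qed
  \<comment> \<open>Integrating that bound amounts to \<open>\<psi>\<close> being nonincreasing.\<close>
  define \<psi> where "\<psi> s = trace (matpow (Bs s) m) - b * g 0 * exp (- (m * s / b))" for s :: real
  have "\<psi> t \<le> \<psi> 0"
  proof (rule DERIV_nonpos_imp_nonincreasing[of 0 t \<psi>])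
    show "0 \<le> t" by (rule t)
  next
    fix x assume x: "0 \<le> x" "x \<le> t"
    have tr: "((\<lambda>s. trace (matpow (Bs s) m)) has_real_derivative - (m * g x)) (at x)"
      unfolding g_def Bs_def by (rule has_real_derivative_trace_matpow)
    have "(\<psi> has_real_derivative
        - (m * g x) - b * g 0 * (exp (- (m * x / b)) * (- (m / b)))) (at x)"
      unfolding \<psi>_def by (rule derivative_eq_intros tr refl | simp add: b less_imp_neq[OF b, symmetric])+
    moreover have "- (m * g x) - b * g 0 * (exp (- (m * x / b)) * (- (m / b))) \<le> 0"
    proof -
      have "g 0 \<le> g x * exp (m * x / b)"
        using \<phi>_mono[OF x] by (simp add: \<phi>_def)
      then have "g 0 * exp (- (m * x / b)) \<le> g x"
        by (simp add: exp_minus field_simps)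
      then have "m * (g 0 * exp (- (m * x / b))) \<le> m * g x"
        by (rule mult_left_mono) simp
      then show ?thesis using b by (simp add: algebra_simps)
    qed
    ultimately show "\<exists>y. (\<psi> has_real_derivative y) (at x) \<and> y \<le> 0" by blast
  qed
  then have "trace (matpow (Bs t) m) \<le> trace (matpow B m) - b * (1 - exp (- (t * m / b))) * g 0"
    by (simp add: \<psi>_def Bs_def algebra_simps)
  moreover have "moment B w m \<le> g 0"
  proof -
    have B0: "Bs 0 = B" by (simp add: Bs_def)
    have psdB: "psd B" using psd[OF t] B0 by simp
    have "moment B w (2 * Suc j) = (norm (B *v (matpow B j *v w)))\<^sup>2"
      by (simp only: moment_even[OF psdB] matpow.simps matrix_vector_mul_assoc)
    also have "\<dots> \<le> (matpow B j *v w) \<bullet> (B *v (matpow B j *v w))"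
      by (rule psd_contraction_norm[OF psdB upper])
    also have "\<dots> = moment B w (Suc (2 * j))"
      by (simp add: moment_odd[OF psdB])
    finally show ?thesis by (simp add: g_def B0 j)
  qed
  then have "b * (1 - exp (- (t * m / b))) * moment B w m \<le> b * (1 - exp (- (t * m / b))) * g 0"
    using b t by (intro mult_left_mono mult_nonneg_nonneg) auto
  ultimately show ?thesis by (simp add: Bs_def)
qed

section \<open>A matrix Chernoff bound for rank-one summands\<close>

text \<open>
  The argument of the trace potential $\mathrm{tr}\,(I-\tau\sum_i w_iw_i^T)^m$, a polynomial
  substitute for $\mathrm{tr}\exp(-\theta\sum_i w_iw_i^T)$.
\<close>

definition deflated :: "real \<Rightarrow> nat \<Rightarrow> (nat \<Rightarrow> real^'n) \<Rightarrow> real^'n^'n" where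
  "deflated \<tau> k w = mat 1 - \<tau> *\<^sub>R (\<Sum>i=1..k. outer (w i))"

lemma deflated_0: "deflated \<tau> 0 w = mat 1"
  by (simp add: deflated_def)

lemma deflated_Suc: "deflated \<tau> (Suc k) w = deflated \<tau> k w - \<tau> *\<^sub>R outer (w (Suc k))"
  by (simp add: deflated_def algebra_simps)

lemma deflated_cong: "(\<And>i. i \<in> {1..k} \<Longrightarrow> w i = w' i) \<Longrightarrow> deflated \<tau> k w = deflated \<tau> k w'"
  by (simp add: deflated_def)

lemma transpose_deflated: "transpose (deflated \<tau> k w) = deflated \<tau> k w"
proof (induction k)
  case 0
  then show ?case by (simp add: deflated_0)
next
  case (Suc k)
  then show ?case by (simp add: deflated_Suc transpose_diff transpose_scalar)
qed

lemma deflated_form: "v \<bullet> (deflated \<tau> k w *v v) = v \<bullet> v - \<tau> * (\<Sum>i=1..k. (w i \<bullet> v)\<^sup>2)"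
proof (induction k)
  case (Suc k)
  have "v \<bullet> (deflated \<tau> (Suc k) w *v v) = v \<bullet> (deflated \<tau> k w *v v) - \<tau> * (w (Suc k) \<bullet> v)\<^sup>2"
    by (simp add: deflated_Suc matrix_vector_mult_diff_rdistrib inner_diff_right
        scaleR_matrix_vector_assoc[symmetric] outer_mult power2_eq_square inner_commute[of v "w (Suc k)"])
  with Suc show ?case by (simp add: algebra_simps)
qed (simp add: deflated_0)

lemma deflated_le: "0 \<le> \<tau> \<Longrightarrow> v \<bullet> (deflated \<tau> k w *v v) \<le> v \<bullet> v"
  by (simp add: deflated_form sum_nonneg)

lemma deflated_ge:
  assumes "0 \<le> \<tau>" "real k * \<tau> \<le> 1 - b" "\<And>i. i \<in> {1..k} \<Longrightarrow> norm (w i) \<le> 1"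
  shows "b * (v \<bullet> v) \<le> v \<bullet> (deflated \<tau> k w *v v)"
proof -
  have "(\<Sum>i=1..k. (w i \<bullet> v)\<^sup>2) \<le> (\<Sum>i=1..k. v \<bullet> v)"
  proof (rule sum_mono)
    fix i assume "i \<in> {1..k}"
    then have "norm (w i) \<le> 1" by (rule assms(3))
    then have "(norm (w i))\<^sup>2 \<le> 1" by (simp add: power_le_one)
    then have "(w i \<bullet> w i) * (v \<bullet> v) \<le> v \<bullet> v"
      by (simp add: power2_norm_eq_inner mult_left_le_one_le)
    with Cauchy_Schwarz_ineq[of "w i" v] show "(w i \<bullet> v)\<^sup>2 \<le> v \<bullet> v" by simp
  qed
  then have "\<tau> * (\<Sum>i=1..k. (w i \<bullet> v)\<^sup>2) \<le> \<tau> * (real k * (v \<bullet> v))"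
    using assms(1) by (simp add: mult_left_mono)
  also have "\<dots> \<le> (1 - b) * (v \<bullet> v)"
    using mult_right_mono[OF assms(2), of "v \<bullet> v"] by (simp add: mult_ac)
  finally show ?thesis by (simp add: deflated_form algebra_simps)
qed

lemma deflated_psd:
  assumes "0 \<le> \<tau>" "real k * \<tau> \<le> 1 - b" "\<And>i. i \<in> {1..k} \<Longrightarrow> norm (w i) \<le> 1" "0 \<le> b"
  shows "psd (deflated \<tau> k w)"
proof -
  have "0 \<le> v \<bullet> (deflated \<tau> k w *v v)" for v
  proof -
    have "b * (v \<bullet> v) \<le> v \<bullet> (deflated \<tau> k w *v v)"
      using assms(1-3) by (rule deflated_ge)
    moreover have "0 \<le> b * (v \<bullet> v)" using assms(4) by simp
    ultimately show ?thesis by linarith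
  qed
  then show ?thesis by (simp add: psd_def transpose_deflated)
qed

lemma continuous_on_outer: "continuous_on UNIV (outer :: real^'n \<Rightarrow> _)"
  unfolding outer_def by (intro continuous_intros)

lemma continuous_on_matpow: "continuous_on UNIV (\<lambda>A :: real^'n^'n. matpow A k)"
proof (induction k)
  case (Suc k)
  show ?case
    using bounded_bilinear.continuous_on[OF bounded_bilinear_matrix_mult continuous_on_id Suc.IH]
    by simp
qed simp

lemma measurable_matpow [measurable]:
  "(\<lambda>A :: real^'n^'n. matpow A k) \<in> borel_measurable borel"
  by (rule borel_measurable_continuous_onI[OF continuous_on_matpow])

lemma measurable_outer [measurable]: "(outer :: real^'n \<Rightarrow> _) \<in> borel_measurable borel"
  by (rule borel_measurable_continuous_onI[OF continuous_on_outer])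

lemma measurable_deflated:
  fixes W :: "nat \<Rightarrow> 'a \<Rightarrow> real^'n"
  assumes "\<And>i. i \<in> {1..k} \<Longrightarrow> W i \<in> borel_measurable M"
  shows "(\<lambda>x. deflated \<tau> k (\<lambda>i. W i x)) \<in> borel_measurable M"
  unfolding deflated_def
  by (intro borel_measurable_diff borel_measurable_const borel_measurable_scaleR
      borel_measurable_sum measurable_compose[OF assms measurable_outer])

lemma measurable_vec_nth [measurable (raw)]:
  "f \<in> borel_measurable M \<Longrightarrow> (\<lambda>x. f x $ a :: real) \<in> borel_measurable M"
  by (erule measurable_compose) (intro borel_measurable_continuous_onI continuous_intros)

lemma measurable_matrix_entry:
  "(\<lambda>A :: real^'n^'m. A $ a $ b) \<in> borel_measurable borel"
  by (intro borel_measurable_continuous_onI continuous_intros)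

lemma matrix_entry: "A $ a $ b = axis a 1 \<bullet> (A *v axis b 1)" for A :: "real^'n^'m"
  by (simp add: matrix_vector_mult_basis column_def inner_axis')

text \<open>
  Expanded into entries, the moment separates the vector from the matrix, so that independence of
  the two can be used.
\<close>

lemma moment_eq_sum_entries:
  "moment B z k = (\<Sum>a\<in>UNIV. \<Sum>b\<in>UNIV. z $ a * z $ b * matpow B k $ a $ b)"
  unfolding moment_def by (simp add: inner_vec_def matrix_vector_mult_def sum_distrib_left mult_ac)

context prob_space
begin

text \<open>
  Adding one vector multiplies the expected potential by at most $1-\mu b(1-e^{-\tau m/b})$: by
  \<open>trace_rank_one_update\<close> the potential drops by a multiple of $w\cdot B^mw$, where $B$ depends on
  the earlier vectors only. As $w$ is independent of them and $E[ww^T]=\mu I$, the expectation of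
  $w\cdot B^mw$ is $\mu\,E\,\mathrm{tr}\,B^m$. The potential starts at $\mathrm{tr}\,I$, the
  dimension.
\<close>

lemma expectation_trace_deflated_le:
  fixes W :: "nat \<Rightarrow> 'a \<Rightarrow> real^'n"
  assumes indep: "indep_vars (\<lambda>_. borel) W {1..N}"
    and bounded: "\<And>i. i \<in> {1..N} \<Longrightarrow> AE x in M. norm (W i x) \<le> 1"
    and second: "\<And>i a c. i \<in> {1..N} \<Longrightarrow>
      expectation (\<lambda>x. W i x $ a * W i x $ c) = (if a = c then \<mu> else 0)"
    and \<mu>: "0 \<le> \<mu>" "\<mu> \<le> 1"
    and m: "even m" "m > 0" and b: "0 < b" "b \<le> 1" and \<tau>: "0 \<le> \<tau>" "real N * \<tau> \<le> 1 - b"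
  shows "expectation (\<lambda>x. trace (matpow (deflated \<tau> N (\<lambda>i. W i x)) m))
      \<le> CARD('n) * (1 - \<mu> * (b * (1 - exp (- (\<tau> * m / b))))) ^ N"
    and "integrable M (\<lambda>x. trace (matpow (deflated \<tau> N (\<lambda>i. W i x)) m))"
proof -
  have rv: "W i \<in> borel_measurable M" if "i \<in> {1..N}" for i
    using indep that by (simp add: indep_vars_def)
  have all_bounded: "AE x in M. \<forall>i\<in>{1..N}. norm (W i x) \<le> 1"
    using bounded by (simp add: AE_ball_countable)
  define B where "B k x = deflated \<tau> k (\<lambda>i. W i x)" for k x
  define c where "c = b * (1 - exp (- (\<tau> * m / b)))"
  have small: "real k * \<tau> \<le> 1 - b" if "k \<le> N" for k
  proof -
    have "real k * \<tau> \<le> real N * \<tau>" using that \<tau>(1) by (intro mult_right_mono) auto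
    then show ?thesis using \<tau>(2) by simp
  qed
  have B_meas: "B k \<in> borel_measurable M" if "k \<le> N" for k
    unfolding B_def by (rule measurable_deflated) (use that rv in auto)
  have entry_meas: "(\<lambda>x. matpow (B k x) m $ i $ j) \<in> borel_measurable M" if "k \<le> N" for k i j
    by (rule measurable_compose[OF measurable_compose[OF B_meas[OF that] measurable_matpow]
          measurable_matrix_entry])
  have psd_B: "psd (B k x)" if "k \<le> N" "\<forall>i\<in>{1..N}. norm (W i x) \<le> 1" for k x
    unfolding B_def by (rule deflated_psd[OF \<tau>(1) small[OF that(1)]]) (use that b in auto)
  have entry_bound: "AE x in M. norm (matpow (B k x) m $ i $ j) \<le> 1" if "k \<le> N" for k i j
    using all_bounded
  proof eventually_elim
    case (elim x)
    have "\<bar>matpow (B k x) m $ i $ j\<bar> \<le> norm (axis i 1 :: real^'n) * norm (matpow (B k x) m *v axis j 1)"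
      unfolding matrix_entry by (rule Cauchy_Schwarz_ineq2)
    also have "\<dots> \<le> 1"
      using norm_matpow_le[OF psd_B[OF that elim], of m "axis j 1"]
      by (simp add: B_def deflated_le[OF \<tau>(1)])
    finally show ?case by simp
  qed
  have entry_int: "integrable M (\<lambda>x. matpow (B k x) m $ i $ j)" if "k \<le> N" for k i j
    using entry_bound[OF that] entry_meas[OF that] by (rule integrable_const_bound)
  have trace_int: "integrable M (\<lambda>x. trace (matpow (B k x) m))" if "k \<le> N" for k
    unfolding trace_def using entry_int[OF that] by simp
  have W_prod_meas: "(\<lambda>x. W i x $ a * W i x $ d) \<in> borel_measurable M" if "i \<in> {1..N}" for i a d
    using rv[OF that] by measurable
  have W_prod_int: "integrable M (\<lambda>x. W i x $ a * W i x $ d)" if "i \<in> {1..N}" for i a d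
  proof (rule integrable_const_bound[OF _ W_prod_meas[OF that]])
    show "AE x in M. norm (W i x $ a * W i x $ d) \<le> 1"
      using bounded[OF that]
    proof eventually_elim
      case (elim x)
      have "\<bar>W i x $ a\<bar> \<le> 1" "\<bar>W i x $ d\<bar> \<le> 1"
        using component_le_norm_cart[of "W i x"] elim order_trans by blast+
      then show ?case by (simp add: abs_mult mult_le_one)
    qed
  qed
  have indep_step: "indep_var borel (\<lambda>x. W (Suc k) x $ a * W (Suc k) x $ d)
      borel (\<lambda>x. matpow (B k x) m $ i $ j)" if "Suc k \<le> N" for k a d i j
  proof -
    have "indep_var
        borel ((\<lambda>f. f (Suc k) $ a * f (Suc k) $ d) \<circ> (\<lambda>x. restrict (\<lambda>i. W i x) {Suc k}))
        borel ((\<lambda>f. matpow (deflated \<tau> k f) m $ i $ j) \<circ> (\<lambda>x. restrict (\<lambda>i. W i x) {1..k}))"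
    proof (rule indep_var_compose[OF indep_var_restrict[OF indep]])
      show "{Suc k} \<inter> {1..k} = {}" "{Suc k} \<subseteq> {1..N}" "{1..k} \<subseteq> {1..N}"
        using that by auto
      show "(\<lambda>f :: nat \<Rightarrow> real^'n. f (Suc k) $ a * f (Suc k) $ d) \<in> Pi\<^sub>M {Suc k} (\<lambda>_. borel) \<rightarrow>\<^sub>M borel"
        by (intro borel_measurable_times measurable_vec_nth measurable_component_singleton) auto
      have "(\<lambda>f. deflated \<tau> k (\<lambda>i. f i)) \<in> Pi\<^sub>M {1..k} (\<lambda>_. borel) \<rightarrow>\<^sub>M borel"
        by (rule measurable_deflated) simp
      then show "(\<lambda>f. matpow (deflated \<tau> k f) m $ i $ j) \<in> Pi\<^sub>M {1..k} (\<lambda>_. borel) \<rightarrow>\<^sub>M borel"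
        by (intro measurable_compose[OF measurable_compose[OF _ measurable_matpow] measurable_matrix_entry])
    qed
    moreover have "deflated \<tau> k (restrict (\<lambda>i. W i x) {1..k}) = B k x" for x
      unfolding B_def by (rule deflated_cong) simp
    ultimately show ?thesis by (simp add: comp_def)
  qed
  have moment_int: "integrable M (\<lambda>x. moment (B k x) (W (Suc k) x) m)" if "Suc k \<le> N" for k
    unfolding moment_eq_sum_entries
    using indep_var_integrable[OF indep_step[OF that] W_prod_int entry_int] that by simp
  have moment_exp: "expectation (\<lambda>x. moment (B k x) (W (Suc k) x) m)
      = \<mu> * expectation (\<lambda>x. trace (matpow (B k x) m))" if "Suc k \<le> N" for k
  proof -
    have k: "k \<le> N" "Suc k \<in> {1..N}" using that by auto
    have "expectation (\<lambda>x. moment (B k x) (W (Suc k) x) m)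
        = (\<Sum>i\<in>UNIV. \<Sum>j\<in>UNIV. expectation (\<lambda>x. W (Suc k) x $ i * W (Suc k) x $ j * matpow (B k x) m $ i $ j))"
      unfolding moment_eq_sum_entries
      using indep_var_integrable[OF indep_step[OF that] W_prod_int[OF k(2)] entry_int[OF k(1)]] by simp
    also have "\<dots> = (\<Sum>i\<in>UNIV. \<Sum>j\<in>UNIV. (if i = j then \<mu> else 0) * expectation (\<lambda>x. matpow (B k x) m $ i $ j))"
      by (simp only: indep_var_lebesgue_integral[OF indep_step[OF that] W_prod_int[OF k(2)] entry_int[OF k(1)]]
          second[OF k(2)])
    also have "\<dots> = (\<Sum>i\<in>UNIV. \<mu> * expectation (\<lambda>x. matpow (B k x) m $ i $ i))"
      by (simp add: if_distrib[of "\<lambda>y. y * _"] cong: if_cong)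
    also have "\<dots> = \<mu> * expectation (\<lambda>x. trace (matpow (B k x) m))"
      unfolding trace_def using entry_int[OF k(1)] by (simp add: sum_distrib_left)
    finally show ?thesis .
  qed
  have c: "0 \<le> c" "c \<le> 1"
    using b \<tau>(1) by (auto simp: c_def intro!: mult_le_one)
  have step: "expectation (\<lambda>x. trace (matpow (B (Suc k) x) m))
      \<le> (1 - \<mu> * c) * expectation (\<lambda>x. trace (matpow (B k x) m))" if "Suc k \<le> N" for k
  proof -
    have k: "k \<le> N" using that by simp
    have "expectation (\<lambda>x. trace (matpow (B (Suc k) x) m))
        \<le> expectation (\<lambda>x. trace (matpow (B k x) m) - c * moment (B k x) (W (Suc k) x) m)"
    proof (rule integral_mono_AE[OF trace_int[OF that]])
      show "integrable M (\<lambda>x. trace (matpow (B k x) m) - c * moment (B k x) (W (Suc k) x) m)"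
        using trace_int[OF k] moment_int[OF that] by simp
      show "AE x in M. trace (matpow (B (Suc k) x) m)
          \<le> trace (matpow (B k x) m) - c * moment (B k x) (W (Suc k) x) m"
        using all_bounded
      proof eventually_elim
        case (elim x)
        have eq: "B (Suc k) x = B k x - \<tau> *\<^sub>R outer (W (Suc k) x)"
          by (simp add: B_def deflated_Suc)
        have "trace (matpow (B k x - \<tau> *\<^sub>R outer (W (Suc k) x)) m) \<le> trace (matpow (B k x) m)
            - b * (1 - exp (- (\<tau> * m / b))) * moment (B k x) (W (Suc k) x) m"
        proof (rule trace_rank_one_update[OF _ m b(1) \<tau>(1)])
          show "transpose (B k x) = B k x"
            by (simp add: B_def transpose_deflated)
          have "norm (W (Suc k) x) \<le> 1" using elim that by simp
          then show "W (Suc k) x \<bullet> W (Suc k) x \<le> 1"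
            by (simp add: power2_norm_eq_inner[symmetric] power_le_one)
          show "v \<bullet> (B k x *v v) \<le> v \<bullet> v" for v
            unfolding B_def by (rule deflated_le[OF \<tau>(1)])
          show "b * (v \<bullet> v) \<le> v \<bullet> ((B k x - \<tau> *\<^sub>R outer (W (Suc k) x)) *v v)" for v
            unfolding eq[symmetric] unfolding B_def
            by (rule deflated_ge[OF \<tau>(1) small[OF that]]) (use elim that in auto)
        qed
        then show ?case by (simp only: eq c_def)
      qed
    qed
    also have "\<dots> = (1 - \<mu> * c) * expectation (\<lambda>x. trace (matpow (B k x) m))"
      using trace_int[OF k] moment_int[OF that] by (simp add: moment_exp[OF that] algebra_simps)
    finally show ?thesis .
  qed
  have "\<mu> * c \<le> 1" using \<mu> c by (simp add: mult_le_one)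
  have "expectation (\<lambda>x. trace (matpow (B k x) m)) \<le> CARD('n) * (1 - \<mu> * c) ^ k" if "k \<le> N" for k
    using that
  proof (induction k)
    case 0
    have "matpow (mat 1 :: real^'n^'n) j = mat 1" for j by (induction j) simp_all
    then show ?case by (simp add: B_def deflated_0 trace_I prob_space)
  next
    case (Suc k)
    have "(1 - \<mu> * c) * expectation (\<lambda>x. trace (matpow (B k x) m))
        \<le> (1 - \<mu> * c) * (CARD('n) * (1 - \<mu> * c) ^ k)"
      using Suc \<open>\<mu> * c \<le> 1\<close> by (intro mult_left_mono) auto
    with step[OF Suc.prems] show ?case by (simp add: mult.left_commute)
  qed
  from this[of N] show "expectation (\<lambda>x. trace (matpow (deflated \<tau> N (\<lambda>i. W i x)) m))
      \<le> CARD('n) * (1 - \<mu> * (b * (1 - exp (- (\<tau> * m / b))))) ^ N"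
    by (simp add: B_def c_def)
  show "integrable M (\<lambda>x. trace (matpow (deflated \<tau> N (\<lambda>i. W i x)) m))"
    using trace_int[of N] by (simp add: B_def)
qed

text \<open>
  If $\sum_i (w_i\cdot u)^2 < \frac23 N\mu$ for some unit vector $u$, then
  $u\cdot Bu > \beta = 1-\frac23\tau N\mu$ for the final matrix $B$, and therefore
  $\beta^m < (u\cdot Bu)^m \le u\cdot B^mu \le \mathrm{tr}\,B^m$. Markov's inequality for the trace
  bounds the probability of this event. The Chernoff exponent at
  the relative deviation $\frac13$ is about $0.063$; the proof settles for
  $\frac2{35}\approx0.0571$, which still exceeds $\frac1{18}$.
\<close>

lemma matrix_Chernoff_lower:
  fixes W :: "nat \<Rightarrow> 'a \<Rightarrow> real^'n"
  assumes indep: "indep_vars (\<lambda>_. borel) W {1..N}"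
    and bounded: "\<And>i. i \<in> {1..N} \<Longrightarrow> AE x in M. norm (W i x) \<le> 1"
    and second: "\<And>i a c. i \<in> {1..N} \<Longrightarrow>
      expectation (\<lambda>x. W i x $ a * W i x $ c) = (if a = c then \<mu> else 0)"
    and N: "N > 0"
  obtains E where "E \<in> events" "prob (space M - E) \<le> CARD('n) * exp (- (2 / 35 * N * \<mu>))"
    "\<And>x u. x \<in> E \<Longrightarrow> 2 / 3 * N * \<mu> * (u \<bullet> u) \<le> (\<Sum>i=1..N. (W i x \<bullet> u)\<^sup>2)"
proof -
  have rv: "W i \<in> borel_measurable M" if "i \<in> {1..N}" for i
    using indep that by (simp add: indep_vars_def)
  have \<mu>: "0 \<le> \<mu>" "\<mu> \<le> 1"
  proof -
    let ?f = "\<lambda>x. W 1 x $ undefined * W 1 x $ undefined"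
    have 1: "1 \<in> {1..N}" using N by simp
    have \<mu>: "expectation ?f = \<mu>" using second[OF 1] by simp
    then show "0 \<le> \<mu>" by (metis (no_types, lifting) Bochner_Integration.integral_nonneg zero_le_square)
    have "AE x in M. ?f x \<le> 1 \<and> norm (?f x) \<le> 1"
      using bounded[OF 1]
    proof eventually_elim
      case (elim x)
      have "\<bar>W 1 x $ undefined\<bar> \<le> 1"
        using component_le_norm_cart[of "W 1 x"] elim order_trans by blast
      then have "\<bar>?f x\<bar> \<le> 1" unfolding abs_mult by (intro mult_le_one) auto
      then show ?case by auto
    qed
    moreover have "?f \<in> borel_measurable M" using rv[OF 1] by measurable
    ultimately have "expectation ?f \<le> 1"
      by (intro integral_le_const integrable_const_bound[of _ 1]) auto
    then show "\<mu> \<le> 1" using \<mu> by simp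
  qed
  \<comment> \<open>The effective exponent \<open>m \<tau> / b = 2 / 5\<close> is a rational close to the optimal \<open>ln (3 / 2)\<close>, and a
    \<open>m\<close> of order \<open>N\<close> keeps \<open>I - \<tau> \<Sum> w\<^sub>i w\<^sub>i\<^sup>T\<close> above \<open>b I\<close>.\<close>
  define m where "m = 100 * N"
  define b \<tau> :: real where "b = 99 / 100" and "\<tau> = 99 / 25000 / N"
  have m: "even m" "m > 0" using N by (auto simp: m_def)
  have b: "0 < b" "b \<le> 1" by (auto simp: b_def)
  have \<tau>: "0 \<le> \<tau>" "real N * \<tau> \<le> 1 - b" using N by (auto simp: \<tau>_def b_def)
  have rate: "\<tau> * m / b = 2 / 5" using N by (simp add: \<tau>_def m_def b_def)
  define T where "T x = trace (matpow (deflated \<tau> N (\<lambda>i. W i x)) m)" for x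
  \<comment> \<open>The value of the form of \<open>I - \<tau> \<Sum> w\<^sub>i w\<^sub>i\<^sup>T\<close> at the threshold; \<open>\<beta> \<ge> b\<close> will give \<open>1 / \<beta> \<le> exp ((1 - \<beta>) / b)\<close>.\<close>
  define \<beta> where "\<beta> = 1 - \<tau> * (2 / 3 * N * \<mu>)"
  have ET: "expectation T \<le> CARD('n) * (1 - \<mu> * (b * (1 - exp (- (2 / 5))))) ^ N" and intT: "integrable M T"
    using expectation_trace_deflated_le[OF indep bounded second \<mu> m b \<tau>] unfolding T_def rate by simp_all
  have N\<tau>: "real N * \<tau> = 99 / 25000" using N by (simp add: \<tau>_def)
  have "\<tau> * (2 / 3 * N * \<mu>) = 2 / 3 * (real N * \<tau>) * \<mu>" by simp
  then have "\<beta> = 1 - 66 / 25000 * \<mu>"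
    unfolding N\<tau> by (simp only: \<beta>_def)
  with \<mu> have \<beta>: "b \<le> \<beta>" "\<beta> \<le> 1"
    by (auto simp: b_def)
  have \<beta>_pos: "\<beta> > 0" using \<beta> b by simp
  define G where "G = {x \<in> space M. \<forall>i\<in>{1..N}. norm (W i x) \<le> 1}"
  have G_meas: "G \<in> events"
    unfolding G_def using rv by measurable
  have AE_G: "AE x in M. x \<in> G"
    using bounded by (simp add: G_def AE_ball_countable)
  have psd_G: "psd (deflated \<tau> N (\<lambda>i. W i x))" if "x \<in> G" for x
    by (rule deflated_psd[OF \<tau>]) (use that b in \<open>auto simp: G_def\<close>)
  have T_nonneg: "0 \<le> T x" if "x \<in> G" for x
    unfolding T_def
    using moment_le_trace[OF psd_G[OF that] m(1), of "axis undefined 1"]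
      moment_nonneg[OF psd_G[OF that], of "axis undefined 1" m]
    by simp
  define E where "E = G \<inter> {x \<in> space M. \<not> T x \<ge> \<beta> ^ m}"
  have E_meas: "E \<in> events"
    unfolding E_def using G_meas intT by measurable
  have "prob (space M - E) \<le> prob {x \<in> space M. T x \<ge> \<beta> ^ m}"
  proof (rule finite_measure_mono_AE)
    show "AE x in M. x \<in> space M - E \<longrightarrow> x \<in> {x \<in> space M. T x \<ge> \<beta> ^ m}"
      using AE_G by eventually_elim (auto simp: E_def)
    show "{x \<in> space M. T x \<ge> \<beta> ^ m} \<in> events"
      using intT by measurable
  qed
  also have "\<dots> \<le> expectation T / \<beta> ^ m"
    by (rule integral_Markov_inequality_measure[OF intT sets.empty_sets])
      (use AE_G T_nonneg \<beta>_pos in \<open>auto elim: eventually_mono\<close>)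
  also have "\<dots> \<le> CARD('n) * exp (- (N * (\<mu> * (b * (1 - exp (- (2 / 5))))))) * exp (4 / 15 * N * \<mu>)"
  proof -
    define r where "r = \<mu> * (b * (1 - exp (- (2 / 5))))"
    have r: "r \<le> 1" unfolding r_def using \<mu> b by (intro mult_le_one) auto
    have "(1 - r) ^ N \<le> exp (- r) ^ N"
      using r exp_ge_add_one_self[of "- r"] by (intro power_mono) auto
    also have "\<dots> = exp (- (N * r))"
      by (simp add: exp_of_nat_mult[symmetric])
    finally have "CARD('n) * (1 - r) ^ N \<le> CARD('n) * exp (- (N * r))"
      by (rule mult_left_mono) simp
    with ET have 1: "expectation T \<le> CARD('n) * exp (- (N * r))"
      unfolding r_def[symmetric] by (rule order_trans)
    have "1 / \<beta> \<le> exp (\<tau> * (2 / 3 * N * \<mu>) / b)"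
    proof -
      have "1 / \<beta> = 1 + (1 - \<beta>) / \<beta>"
        using \<beta>_pos by (simp add: field_simps)
      also have "\<dots> \<le> 1 + (1 - \<beta>) / b"
        using \<beta> b \<mu> by (intro add_left_mono divide_left_mono) auto
      also have "\<dots> \<le> exp ((1 - \<beta>) / b)"
        by (rule exp_ge_add_one_self)
      finally show ?thesis by (simp add: \<beta>_def)
    qed
    then have "(1 / \<beta>) ^ m \<le> exp (\<tau> * (2 / 3 * N * \<mu>) / b) ^ m"
      using \<beta>_pos by (intro power_mono) auto
    also have "\<dots> = exp (m * (\<tau> * (2 / 3 * N * \<mu>) / b))"
      by (rule exp_of_nat_mult[symmetric])
    also have "m * (\<tau> * (2 / 3 * N * \<mu>) / b) = (\<tau> * m / b) * (2 / 3 * N * \<mu>)"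
      by (simp add: mult_ac)
    also have "\<dots> = 4 / 15 * N * \<mu>"
      unfolding rate by simp
    finally have 2: "(1 / \<beta>) ^ m \<le> exp (4 / 15 * N * \<mu>)" .
    have "expectation T * (1 / \<beta>) ^ m \<le> (CARD('n) * exp (- (N * r))) * exp (4 / 15 * N * \<mu>)"
      using 1 2 \<beta>_pos by (intro mult_mono) auto
    then show ?thesis
      by (simp add: r_def power_one_over)
  qed
  also have "\<dots> \<le> CARD('n) * exp (- (2 / 35 * N * \<mu>))"
  proof -
    \<comment> \<open>\<open>exp (2 / 5) \<ge> 1.22\<^sup>2\<close>, accurate enough for \<open>2 / 35 + 4 / 15 \<le> b (1 - exp (- 2 / 5))\<close>.\<close>
    have "exp (2 / 5 :: real) = exp (1 / 5) * exp (1 / 5)"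
      by (simp add: exp_add[symmetric])
    also have "\<dots> \<ge> (61 / 50) * (61 / 50)"
      using exp_lower_Taylor_quadratic[of "1 / 5 :: real"] by (intro mult_mono) (auto simp: power2_eq_square)
    finally have "exp (- (2 / 5)) \<le> (2500 / 3721 :: real)"
      by (simp add: exp_minus field_simps)
    then have "2 / 35 + 4 / 15 \<le> b * (1 - exp (- (2 / 5)))"
      by (simp add: b_def)
    then have "N * \<mu> * (2 / 35 + 4 / 15) \<le> N * \<mu> * (b * (1 - exp (- (2 / 5))))"
      using \<mu> by (intro mult_left_mono) auto
    then have "- (N * (\<mu> * (b * (1 - exp (- (2 / 5)))))) + 4 / 15 * N * \<mu> \<le> - (2 / 35 * N * \<mu>)"
      by (simp add: algebra_simps)
    then show ?thesis
      by (simp add: mult.assoc exp_add[symmetric])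
  qed
  finally have prob: "prob (space M - E) \<le> CARD('n) * exp (- (2 / 35 * N * \<mu>))" .
  have unit: "2 / 3 * N * \<mu> \<le> (\<Sum>i=1..N. (W i x \<bullet> u)\<^sup>2)" if x: "x \<in> E" and u: "norm u = 1" for x u
  proof (rule ccontr)
    assume "\<not> ?thesis"
    then have "\<tau> * (\<Sum>i=1..N. (W i x \<bullet> u)\<^sup>2) \<le> \<tau> * (2 / 3 * N * \<mu>)"
      using \<tau>(1) by (intro mult_left_mono) auto
    then have "\<beta> \<le> u \<bullet> (deflated \<tau> N (\<lambda>i. W i x) *v u)"
      using u by (simp add: deflated_form \<beta>_def dot_square_norm)
    then have "\<beta> ^ m \<le> (u \<bullet> (deflated \<tau> N (\<lambda>i. W i x) *v u)) ^ m"
      using \<beta>_pos by (intro power_mono) auto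
    also have "\<dots> \<le> moment (deflated \<tau> N (\<lambda>i. W i x)) u m"
      by (rule moment_power_le[OF psd_G u]) (use x in \<open>simp add: E_def\<close>)
    also have "\<dots> \<le> T x"
      unfolding T_def by (rule moment_le_trace[OF psd_G m(1) u]) (use x in \<open>simp add: E_def\<close>)
    finally show False using x by (simp add: E_def)
  qed
  have "2 / 3 * N * \<mu> * (u \<bullet> u) \<le> (\<Sum>i=1..N. (W i x \<bullet> u)\<^sup>2)" if x: "x \<in> E" for x u
  proof (cases "u = 0")
    case False
    define e where "e = inverse (norm u) *\<^sub>R u"
    have e: "norm e = 1" "u = norm u *\<^sub>R e" using False by (auto simp: e_def)
    have "(\<Sum>i=1..N. (W i x \<bullet> u)\<^sup>2) = (norm u)\<^sup>2 * (\<Sum>i=1..N. (W i x \<bullet> e)\<^sup>2)"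
      by (subst e(2)) (simp add: power_mult_distrib sum_distrib_left)
    also have "\<dots> \<ge> (norm u)\<^sup>2 * (2 / 3 * N * \<mu>)"
      using unit[OF x e(1)] by (intro mult_left_mono) auto
    finally show ?thesis by (simp add: power2_norm_eq_inner mult.commute)
  qed simp
  with prob E_meas show ?thesis by (intro that)
qed

end

section \<open>Bernstein's inequality\<close>

text \<open>
  The Taylor coefficients of the terms of degree $2$ to $4$, plus $e/120$ with $e\le3$ for the
  remainder, add up to $\frac{11}{15}<\frac34$. The constant $1$ in place of $\frac34$ would be too
  large for the final numerical comparison with the tuning parameter.
\<close>

lemma exp_le_quadratic:
  fixes x :: real
  assumes "\<bar>x\<bar> \<le> 1"
  shows "exp x \<le> 1 + x + 3 / 4 * x\<^sup>2"
proof -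
  obtain t where t: "\<bar>t\<bar> \<le> \<bar>x\<bar>" "exp x = (\<Sum>m<5. x ^ m / fact m) + exp t / fact 5 * x ^ 5"
    using Maclaurin_exp_le[of x 5] by blast
  have "exp t \<le> exp 1" using t(1) assms by simp
  also have "\<dots> \<le> 3" by (rule exp_le)
  finally have et: "exp t \<le> 3" .
  have pow: "\<bar>x ^ (2 + k)\<bar> \<le> x\<^sup>2" for k
  proof -
    have "\<bar>x ^ k\<bar> \<le> 1" using assms by (simp add: power_abs power_le_one)
    then have "x\<^sup>2 * \<bar>x ^ k\<bar> \<le> x\<^sup>2" by (simp add: mult_left_le)
    then show ?thesis by (simp only: power_add abs_mult) simp
  qed
  have "exp x = 1 + x + x\<^sup>2 / 2 + x ^ 3 / 6 + x ^ 4 / 24 + exp t / 120 * x ^ 5"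
    using t(2) by (simp add: lessThan_nat_numeral fact_numeral eval_nat_numeral)
  also have "\<dots> \<le> 1 + x + x\<^sup>2 / 2 + x\<^sup>2 / 6 + x\<^sup>2 / 24 + 3 / 120 * x\<^sup>2"
  proof -
    have "exp t * x ^ 5 \<le> exp t * x\<^sup>2"
      using pow[of 3] by (intro mult_left_mono) auto
    also have "\<dots> \<le> 3 * x\<^sup>2"
      using et by (intro mult_right_mono) auto
    finally have "exp t / 120 * x ^ 5 \<le> 3 / 120 * x\<^sup>2" by simp
    moreover have "x ^ 3 \<le> x\<^sup>2" "x ^ 4 \<le> x\<^sup>2"
      using pow[of 1] pow[of 2] by (auto simp: abs_le_iff)
    ultimately show ?thesis by linarith
  qed
  also have "\<dots> \<le> 1 + x + 3 / 4 * x\<^sup>2" by simp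
  finally show ?thesis .
qed

context prob_space
begin

text \<open>
  The quadratic bound is applied to the uncentred variable: $E e^{\theta W} \le 1 + \theta E W +
  \frac34\theta^2 E W^2$. So the bound on $|W|$ enters without the factor $2$ that centring costs.
\<close>

lemma expectation_exp_le:
  fixes W :: "'a \<Rightarrow> real"
  assumes [measurable]: "W \<in> borel_measurable M" and bounded: "AE x in M. \<bar>W x\<bar> \<le> c"
    and \<theta>: "0 \<le> \<theta>" "\<theta> * c \<le> 1" and second: "expectation (\<lambda>x. (W x)\<^sup>2) \<le> v"
  shows "expectation (\<lambda>x. exp (\<theta> * W x)) \<le> exp (\<theta> * expectation W + 3 / 4 * \<theta>\<^sup>2 * v)"
    and "integrable M (\<lambda>x. exp (\<theta> * W x))"
proof -
  have small: "AE x in M. \<bar>\<theta> * W x\<bar> \<le> 1"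
    using bounded
  proof eventually_elim
    case (elim x)
    have "\<bar>\<theta> * W x\<bar> = \<theta> * \<bar>W x\<bar>" using \<theta>(1) by (simp add: abs_mult)
    also have "\<dots> \<le> \<theta> * c" using elim \<theta>(1) by (intro mult_left_mono)
    finally show ?case using \<theta>(2) by simp
  qed
  have intW: "integrable M W"
    by (rule integrable_const_bound[where B = c]) (use bounded in auto)
  have intW2: "integrable M (\<lambda>x. (W x)\<^sup>2)"
  proof (rule integrable_const_bound[where B = "c\<^sup>2"])
    show "AE x in M. norm ((W x)\<^sup>2) \<le> c\<^sup>2"
      using bounded
    proof eventually_elim
      case (elim x)
      then have "\<bar>W x\<bar>\<^sup>2 \<le> c\<^sup>2" by (intro power_mono) auto
      then show ?case by simp
    qed
  qed simp
  show int: "integrable M (\<lambda>x. exp (\<theta> * W x))"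
    by (rule integrable_const_bound[where B = "exp 1"])
      (use small in \<open>auto elim!: eventually_mono\<close>)
  have "expectation (\<lambda>x. exp (\<theta> * W x)) \<le> expectation (\<lambda>x. 1 + \<theta> * W x + 3 / 4 * \<theta>\<^sup>2 * (W x)\<^sup>2)"
  proof (rule integral_mono_AE[OF int])
    show "integrable M (\<lambda>x. 1 + \<theta> * W x + 3 / 4 * \<theta>\<^sup>2 * (W x)\<^sup>2)"
      using intW intW2 by simp
    show "AE x in M. exp (\<theta> * W x) \<le> 1 + \<theta> * W x + 3 / 4 * \<theta>\<^sup>2 * (W x)\<^sup>2"
      using small
    proof eventually_elim
      case (elim x)
      from exp_le_quadratic[OF this] show ?case by (simp add: power_mult_distrib)
    qed
  qed
  also have "\<dots> = 1 + (\<theta> * expectation W + 3 / 4 * \<theta>\<^sup>2 * expectation (\<lambda>x. (W x)\<^sup>2))"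
    using intW intW2 by (simp add: prob_space)
  also have "\<dots> \<le> 1 + (\<theta> * expectation W + 3 / 4 * \<theta>\<^sup>2 * v)"
    using second by (intro add_left_mono mult_left_mono) auto
  also have "\<dots> \<le> exp (\<theta> * expectation W + 3 / 4 * \<theta>\<^sup>2 * v)"
    by (rule exp_ge_add_one_self)
  finally show "expectation (\<lambda>x. exp (\<theta> * W x)) \<le> exp (\<theta> * expectation W + 3 / 4 * \<theta>\<^sup>2 * v)" .
qed

text \<open>
  The Chernoff exponent per observation is $\theta t-\frac34\theta^2\sigma^2$ for every
  $\theta\le1/c$. Its unconstrained optimum for the Gaussian part of $t$ is
  $2r/(\sqrt3\,\sigma)$; capping it at $1/c$ is what the term $c r^2$ of the deviation pays for.
\<close>

lemma Bernstein_upper_tail: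
  fixes W :: "'i \<Rightarrow> 'a \<Rightarrow> real" and r :: real
  assumes fin: "finite I" "I \<noteq> {}" and indep: "indep_vars (\<lambda>_. borel) W I"
    and bounded: "\<And>i. i \<in> I \<Longrightarrow> AE x in M. \<bar>W i x\<bar> \<le> c"
    and mean: "\<And>i. i \<in> I \<Longrightarrow> expectation (W i) = \<mu>"
    and second: "\<And>i. i \<in> I \<Longrightarrow> expectation (\<lambda>x. (W i x)\<^sup>2) \<le> \<sigma>\<^sup>2"
    and pos: "c > 0" "\<sigma> > 0" "r > 0"
  shows "prob {x \<in> space M. (\<Sum>i\<in>I. W i x) \<ge> card I * (\<mu> + (sqrt 3 * \<sigma> * r + c * r\<^sup>2))}
      \<le> exp (- (card I * r\<^sup>2))"
proof -
  have rv[measurable]: "W i \<in> borel_measurable M" if "i \<in> I" for i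
    using indep that by (simp add: indep_vars_def)
  define t where "t = sqrt 3 * \<sigma> * r + c * r\<^sup>2"
  define \<theta> where "\<theta> = min (1 / c) (2 * r / (sqrt 3 * \<sigma>))"
  have \<theta>: "\<theta> > 0" "\<theta> * c \<le> 1"
    using pos by (auto simp: \<theta>_def min_def field_simps)
  have exponent: "r\<^sup>2 \<le> \<theta> * t - 3 / 4 * \<theta>\<^sup>2 * \<sigma>\<^sup>2"
  proof (cases "2 * r / (sqrt 3 * \<sigma>) \<le> 1 / c")
    case True
    then have eq: "\<theta> = 2 * r / (sqrt 3 * \<sigma>)" by (simp add: \<theta>_def)
    have "\<theta> * (sqrt 3 * \<sigma> * r) = 2 * r\<^sup>2"
      using pos by (simp add: eq power2_eq_square)
    moreover have "3 / 4 * \<theta>\<^sup>2 * \<sigma>\<^sup>2 = r\<^sup>2"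
      using pos by (simp add: eq power_divide power_mult_distrib)
    moreover have "0 \<le> \<theta> * (c * r\<^sup>2)"
      using \<theta> pos by simp
    ultimately show ?thesis by (simp add: t_def distrib_left)
  next
    case False
    then have eq: "\<theta> = 1 / c" by (simp add: \<theta>_def)
    define s where "s = sqrt 3 * \<sigma> / c"
    have s: "0 < s" "s < 2 * r"
      using False pos by (auto simp: s_def field_simps)
    have "\<theta> * t - 3 / 4 * \<theta>\<^sup>2 * \<sigma>\<^sup>2 = s * r + r\<^sup>2 - s\<^sup>2 / 4"
      using pos by (simp add: eq t_def s_def power_divide power_mult_distrib field_simps)
    moreover have "s * s \<le> s * (2 * r)" using s by (intro mult_left_mono) auto
    ultimately show ?thesis using s pos by (simp add: power2_eq_square)
  qed
  let ?S = "\<lambda>x. \<Sum>i\<in>I. W i x"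
  have exp_le: "expectation (\<lambda>x. exp (\<theta> * W i x)) \<le> exp (\<theta> * \<mu> + 3 / 4 * \<theta>\<^sup>2 * \<sigma>\<^sup>2)"
    and exp_int: "integrable M (\<lambda>x. exp (\<theta> * W i x))" if "i \<in> I" for i
    using expectation_exp_le[OF rv[OF that] bounded[OF that] _ \<theta>(2) second[OF that]] \<theta>(1) mean[OF that]
    by auto
  have indep_exp: "indep_vars (\<lambda>_. borel) (\<lambda>i x. exp (\<theta> * W i x)) I"
    by (rule indep_vars_compose2[OF indep]) measurable
  have S_exp: "exp (\<theta> * ?S x) = (\<Prod>i\<in>I. exp (\<theta> * W i x))" for x
    using fin by (simp add: sum_distrib_left exp_sum)
  have int: "integrable M (\<lambda>x. exp (\<theta> * ?S x))"
    unfolding S_exp by (rule indep_vars_integrable[OF fin(1) indep_exp exp_int])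
  have "expectation (\<lambda>x. exp (\<theta> * ?S x)) = (\<Prod>i\<in>I. expectation (\<lambda>x. exp (\<theta> * W i x)))"
    unfolding S_exp by (rule indep_vars_lebesgue_integral[OF fin(1) indep_exp exp_int])
  also have "\<dots> \<le> (\<Prod>i\<in>I. exp (\<theta> * \<mu> + 3 / 4 * \<theta>\<^sup>2 * \<sigma>\<^sup>2))"
    using exp_le by (intro prod_mono) auto
  also have "\<dots> = exp (card I * (\<theta> * \<mu> + 3 / 4 * \<theta>\<^sup>2 * \<sigma>\<^sup>2))"
    by (simp add: exp_of_nat_mult)
  finally have S: "expectation (\<lambda>x. exp (\<theta> * ?S x)) \<le> exp (card I * (\<theta> * \<mu> + 3 / 4 * \<theta>\<^sup>2 * \<sigma>\<^sup>2))" .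
  have "{x \<in> space M. ?S x \<ge> card I * (\<mu> + t)} = {x \<in> space M. exp (\<theta> * ?S x) \<ge> exp (\<theta> * (card I * (\<mu> + t)))}"
    using \<theta>(1) by (simp add: mult_le_cancel_left_pos)
  then have "prob {x \<in> space M. ?S x \<ge> card I * (\<mu> + t)}
      \<le> expectation (\<lambda>x. exp (\<theta> * ?S x)) / exp (\<theta> * (card I * (\<mu> + t)))"
    using integral_Markov_inequality_measure[OF int sets.empty_sets, of "exp (\<theta> * (card I * (\<mu> + t)))"]
    by simp
  also have "\<dots> \<le> exp (card I * (\<theta> * \<mu> + 3 / 4 * \<theta>\<^sup>2 * \<sigma>\<^sup>2)) / exp (\<theta> * (card I * (\<mu> + t)))"
    using S by (simp add: divide_right_mono)
  also have "\<dots> = exp (- (card I * (\<theta> * t - 3 / 4 * \<theta>\<^sup>2 * \<sigma>\<^sup>2)))"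
    by (simp add: exp_diff[symmetric] algebra_simps)
  also have "\<dots> \<le> exp (- (card I * r\<^sup>2))"
    using exponent by (simp add: mult_left_mono)
  finally show ?thesis by (simp add: t_def)
qed

lemma Bernstein_two_sided:
  fixes W :: "'i \<Rightarrow> 'a \<Rightarrow> real" and r :: real
  assumes fin: "finite I" "I \<noteq> {}" and indep: "indep_vars (\<lambda>_. borel) W I"
    and bounded: "\<And>i. i \<in> I \<Longrightarrow> AE x in M. \<bar>W i x\<bar> \<le> c"
    and mean: "\<And>i. i \<in> I \<Longrightarrow> expectation (W i) = \<mu>"
    and second: "\<And>i. i \<in> I \<Longrightarrow> expectation (\<lambda>x. (W i x)\<^sup>2) \<le> \<sigma>\<^sup>2"
    and pos: "c > 0" "\<sigma> > 0" "r > 0"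
  shows "prob {x \<in> space M. \<bar>(\<Sum>i\<in>I. W i x) / card I - \<mu>\<bar> \<ge> sqrt 3 * \<sigma> * r + c * r\<^sup>2}
      \<le> 2 * exp (- (card I * r\<^sup>2))"
proof -
  have rv[measurable]: "W i \<in> borel_measurable M" if "i \<in> I" for i
    using indep that by (simp add: indep_vars_def)
  define t where "t = sqrt 3 * \<sigma> * r + c * r\<^sup>2"
  have card: "real (card I) > 0" using fin by (simp add: card_gt_0_iff)
  define U L where "U = {x \<in> space M. (\<Sum>i\<in>I. W i x) \<ge> card I * (\<mu> + t)}"
    and "L = {x \<in> space M. (\<Sum>i\<in>I. - W i x) \<ge> card I * (- \<mu> + t)}"
  have sets: "U \<in> events" "L \<in> events" unfolding U_def L_def by measurable
  have "indep_vars (\<lambda>_. borel) (\<lambda>i x. - W i x) I"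
    by (rule indep_vars_compose2[OF indep]) measurable
  then have "prob L \<le> exp (- (card I * r\<^sup>2))"
    unfolding L_def t_def
    by (rule Bernstein_upper_tail[OF fin]) (use bounded mean second pos in auto)
  moreover have "prob U \<le> exp (- (card I * r\<^sup>2))"
    unfolding U_def t_def
    by (rule Bernstein_upper_tail[OF fin indep]) (use bounded mean second pos in auto)
  moreover have "{x \<in> space M. \<bar>(\<Sum>i\<in>I. W i x) / card I - \<mu>\<bar> \<ge> t} = U \<union> L"
  proof -
    have "\<bar>s / card I - \<mu>\<bar> \<ge> t \<longleftrightarrow> s \<ge> card I * (\<mu> + t) \<or> - s \<ge> card I * (- \<mu> + t)" for s
      using card by (auto simp: abs_real_def field_simps split: if_splits)
    then show ?thesis by (auto simp: U_def L_def sum_negf)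
  qed
  ultimately have "prob {x \<in> space M. \<bar>(\<Sum>i\<in>I. W i x) / card I - \<mu>\<bar> \<ge> t} \<le> 2 * exp (- (card I * r\<^sup>2))"
    using measure_Un_le[OF sets] by simp
  then show ?thesis by (simp only: t_def)
qed

end

section \<open>The deterministic inequality for the penalised quadratic\<close>

lemma emp_cov_form: "v \<bullet> (emp_cov N x *v v) = (\<Sum>i=1..N. (x i \<bullet> v)\<^sup>2) / N"
proof -
  have "emp_cov N x = (1 / real N) *\<^sub>R (\<Sum>i=1..N. outer (x i))"
    by (simp add: emp_cov_def outer_def)
  moreover have "v \<bullet> ((\<Sum>i=1..N. outer (x i)) *v v) = (\<Sum>i=1..N. (x i \<bullet> v)\<^sup>2)"
    using deflated_form[of v 1 N x]
    by (simp add: deflated_def matrix_vector_mult_diff_rdistrib inner_diff_right)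
  ultimately show ?thesis by (simp add: scaleR_matrix_vector_assoc[symmetric])
qed

lemma emp_cov_mult: "(emp_cov N x *v \<beta>) $ j = (\<Sum>i=1..N. x i $ j * (x i \<bullet> \<beta>)) / N"
proof -
  have "(emp_cov N x *v \<beta>) $ j = (\<Sum>k\<in>UNIV. (\<Sum>i=1..N. x i $ j * x i $ k) / N * \<beta> $ k)"
    by (simp add: emp_cov_def matrix_vector_mult_def)
  also have "\<dots> = (\<Sum>k\<in>UNIV. \<Sum>i=1..N. x i $ j * (x i $ k * \<beta> $ k) / N)"
    by (simp add: sum_divide_distrib sum_distrib_right mult.assoc)
  also have "\<dots> = (\<Sum>i=1..N. \<Sum>k\<in>UNIV. x i $ j * (x i $ k * \<beta> $ k) / N)"
    by (rule sum.swap)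
  also have "\<dots> = (\<Sum>i=1..N. x i $ j * (x i \<bullet> \<beta>)) / N"
    by (simp add: inner_vec_def sum_divide_distrib sum_distrib_left)
  finally show ?thesis .
qed

lemma psd_emp_cov: "psd (emp_cov N x)"
  by (simp add: psd_def emp_cov_form sum_nonneg)
    (simp add: emp_cov_def transpose_def vec_eq_iff mult.commute)

lemma l1_norm_nonneg: "0 \<le> l1_norm v"
  by (simp add: l1_norm_def sum_nonneg)

lemma l1_norm_scaleR: "l1_norm (t *\<^sub>R v) = \<bar>t\<bar> * l1_norm v"
  by (simp add: l1_norm_def abs_mult sum_distrib_left)

lemma l1_norm_add_le: "l1_norm (u + v) \<le> l1_norm u + l1_norm v"
  unfolding l1_norm_def by (simp add: sum.distrib[symmetric] sum_mono abs_triangle_ineq)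

lemma restr_scaleR: "restr J (t *\<^sub>R v) = t *\<^sub>R restr J v"
  by (simp add: restr_def vec_eq_iff)

lemma inner_le_l1_norm:
  assumes "\<And>j. \<bar>z $ j\<bar> \<le> B"
  shows "z \<bullet> v \<le> B * l1_norm v"
proof -
  have "z \<bullet> v \<le> (\<Sum>j\<in>UNIV. \<bar>z $ j\<bar> * \<bar>v $ j\<bar>)"
    unfolding inner_vec_def by (rule sum_mono) (simp add: abs_mult[symmetric])
  also have "\<dots> \<le> (\<Sum>j\<in>UNIV. B * \<bar>v $ j\<bar>)"
    using assms by (intro sum_mono mult_right_mono) auto
  finally show ?thesis by (simp add: l1_norm_def sum_distrib_left)
qed

text \<open>
  Coordinatewise: on \<open>J\<close> use $|\beta_j|-|\beta'_j|\le|\beta'_j-\beta_j|$, off \<open>J\<close> use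
  $|\beta_j|-|\beta'_j|\le 2|\beta_j|-|\beta'_j-\beta_j|$. The term with the factor one half is what
  the noise costs; the resulting weights $\frac32$ and $-\frac12$ explain the constant $3$ of the
  compatibility cone.
\<close>

lemma l1_norm_cone:
  "l1_norm \<beta> - l1_norm \<beta>' + l1_norm (\<beta>' - \<beta>) / 2
     \<le> (3 * l1_norm (restr J (\<beta>' - \<beta>)) - l1_norm (restr (- J) (\<beta>' - \<beta>))) / 2
       + 2 * l1_norm (restr (- J) \<beta>)"
proof -
  let ?r = "\<lambda>j. (3 * \<bar>restr J (\<beta>' - \<beta>) $ j\<bar> - \<bar>restr (- J) (\<beta>' - \<beta>) $ j\<bar>) / 2 + 2 * \<bar>restr (- J) \<beta> $ j\<bar>"
  have "l1_norm \<beta> - l1_norm \<beta>' + l1_norm (\<beta>' - \<beta>) / 2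
      = (\<Sum>j\<in>UNIV. \<bar>\<beta> $ j\<bar> - \<bar>\<beta>' $ j\<bar> + \<bar>\<beta>' $ j - \<beta> $ j\<bar> / 2)"
    by (simp add: l1_norm_def sum.distrib sum_subtractf sum_divide_distrib)
  also have "\<dots> \<le> (\<Sum>j\<in>UNIV. ?r j)"
  proof (rule sum_mono)
    fix j
    show "\<bar>\<beta> $ j\<bar> - \<bar>\<beta>' $ j\<bar> + \<bar>\<beta>' $ j - \<beta> $ j\<bar> / 2 \<le> ?r j"
      by (cases "j \<in> J") (auto simp: restr_def abs_real_def field_simps)
  qed
  also have "\<dots> = (3 * l1_norm (restr J (\<beta>' - \<beta>)) - l1_norm (restr (- J) (\<beta>' - \<beta>))) / 2
       + 2 * l1_norm (restr (- J) \<beta>)"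
    by (simp add: l1_norm_def sum.distrib sum_subtractf sum_divide_distrib sum_distrib_left diff_divide_distrib)
  finally show ?thesis .
qed

lemma psd_form_convex_combination:
  fixes A :: "real^'n^'n"
  assumes "transpose A = A"
  shows "((1 - t) *\<^sub>R u + t *\<^sub>R v) \<bullet> (A *v ((1 - t) *\<^sub>R u + t *\<^sub>R v))
     = (1 - t) * (u \<bullet> (A *v u)) + t * (v \<bullet> (A *v v)) - t * (1 - t) * ((u - v) \<bullet> (A *v (u - v)))"
proof -
  have "v \<bullet> (A *v u) = u \<bullet> (A *v v)"
    using symmetric_inner[OF assms, of u v] by (simp add: inner_commute)
  then show ?thesis
    by (simp add: matrix_vector_right_distrib matrix_vector_mult_diff_distrib matrix_vector_mult_scaleR
        inner_add_left inner_add_right inner_diff_left inner_diff_right algebra_simps)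
qed

text \<open>
  Compare the minimiser with the point at fraction \<open>t\<close> of the segment towards \<open>\<beta>\<close>: the quadratic part is strongly
  convex in its own seminorm, the rest is convex. Divide by \<open>t\<close> and let \<open>t\<close> tend to $0$.
\<close>

lemma penalized_quadratic_strong_minimum:
  fixes A :: "real^'n^'n" and \<xi> :: "real^'n" and lam :: real
  defines "Q \<equiv> \<lambda>\<beta>. \<beta> \<bullet> (A *v \<beta>) - 2 * (\<xi> \<bullet> \<beta>) + 2 * lam * l1_norm \<beta>"
  assumes A: "psd A" and lam: "lam \<ge> 0" and min: "\<And>\<beta>. Q \<beta>' \<le> Q \<beta>"
  shows "Q \<beta>' + (\<beta>' - \<beta>) \<bullet> (A *v (\<beta>' - \<beta>)) \<le> Q \<beta>"
proof -
  define d where "d = (\<beta>' - \<beta>) \<bullet> (A *v (\<beta>' - \<beta>))"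
  have le: "Q \<beta>' + (1 - t) * d \<le> Q \<beta>" if t: "0 < t" "t < 1" for t
  proof -
    define \<gamma> where "\<gamma> = (1 - t) *\<^sub>R \<beta>' + t *\<^sub>R \<beta>"
    have quad: "\<gamma> \<bullet> (A *v \<gamma>) = (1 - t) * (\<beta>' \<bullet> (A *v \<beta>')) + t * (\<beta> \<bullet> (A *v \<beta>)) - t * (1 - t) * d"
      unfolding \<gamma>_def d_def by (rule psd_form_convex_combination[OF psd_symmetric[OF A]])
    have "l1_norm \<gamma> \<le> (1 - t) * l1_norm \<beta>' + t * l1_norm \<beta>"
      using l1_norm_add_le[of "(1 - t) *\<^sub>R \<beta>'" "t *\<^sub>R \<beta>"] t by (simp add: \<gamma>_def l1_norm_scaleR)
    then have "2 * lam * l1_norm \<gamma> \<le> 2 * lam * ((1 - t) * l1_norm \<beta>' + t * l1_norm \<beta>)"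
      using lam by (intro mult_left_mono) auto
    moreover have "\<xi> \<bullet> \<gamma> = (1 - t) * (\<xi> \<bullet> \<beta>') + t * (\<xi> \<bullet> \<beta>)"
      by (simp add: \<gamma>_def inner_add_right)
    ultimately have "Q \<gamma> \<le> (1 - t) * Q \<beta>' + t * Q \<beta> - t * (1 - t) * d"
      unfolding Q_def quad by (simp add: algebra_simps)
    with min[of \<gamma>] have "t * (Q \<beta>' + (1 - t) * d) \<le> t * Q \<beta>"
      by (simp add: algebra_simps)
    with t show ?thesis by (simp add: mult_le_cancel_left_pos)
  qed
  have "((\<lambda>t. Q \<beta>' + (1 - t) * d) \<longlongrightarrow> Q \<beta>' + (1 - 0) * d) (at_right 0)"
    by (intro tendsto_intros)
  moreover have "\<forall>\<^sub>F t in at_right 0. Q \<beta>' + (1 - t) * d \<le> Q \<beta>"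
    using eventually_at_right_real[OF zero_less_one] by (rule eventually_mono) (simp add: le)
  ultimately show ?thesis
    using tendsto_upperbound[of "\<lambda>t. Q \<beta>' + (1 - t) * d" _ "at_right 0" "Q \<beta>"]
    by (simp add: d_def)
qed

lemma compat_const_nonneg: "0 \<le> compat_const A J c"
  unfolding compat_const_def by (rule INF_greatest) (simp add: divide_nonneg_nonneg)

text \<open>
  With $d$ the cone functional and $q = v\cdot Av$, the definition of the constant gives
  $\kappa \le 9|J|q/d^2$ when $d>0$, and $\lambda d - q/2 \le \lambda^2d^2/(2q)$ is the square
  inequality. If $\kappa=0$ the right-hand side is infinite, and if $d\le0$ the left-hand side is not
  positive.
\<close>

lemma compat_const_bound:
  fixes A :: "real^'n^'n"
  assumes A: "psd A" and lam: "lam \<ge> 0"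
  shows "ereal (lam * (3 * l1_norm (restr J v) - l1_norm (restr (- J) v)) - v \<bullet> (A *v v) / 2)
     \<le> ereal (9 * lam\<^sup>2 * real (card J)) / (2 * compat_const A J 3)"
proof -
  define d q \<kappa> where "d = 3 * l1_norm (restr J v) - l1_norm (restr (- J) v)"
    and "q = v \<bullet> (A *v v)" and "\<kappa> = compat_const A J 3"
  have \<kappa>: "0 \<le> \<kappa>" unfolding \<kappa>_def by (rule compat_const_nonneg)
  have q: "0 \<le> q" using psd_nonneg[OF A] by (simp add: q_def)
  have K: "0 \<le> ereal (9 * lam\<^sup>2 * real (card J)) / (2 * \<kappa>)"
    using \<kappa> by (intro zero_le_divide_ereal) auto
  have "ereal (lam * d - q / 2) \<le> ereal (9 * lam\<^sup>2 * real (card J)) / (2 * \<kappa>)"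
  proof (cases "lam * d - q / 2 \<le> 0")
    case True
    then have "ereal (lam * d - q / 2) \<le> 0" by simp
    then show ?thesis using K by (rule order_trans)
  next
    case False
    then have pos: "lam * d > 0" using q by simp
    then have d: "d > 0" and lam': "lam > 0" using lam by (auto simp: zero_less_mult_iff)
    have "l1_norm (restr J v) > 0"
      using d l1_norm_nonneg[of "restr (- J) v"] by (simp add: d_def)
    then have "restr J v \<noteq> 0" by (auto simp: l1_norm_def)
    then have "J \<noteq> {}" by (auto simp: restr_def vec_eq_iff)
    then have J: "real (card J) > 0" by (simp add: card_gt_0_iff)
    have "\<kappa> \<le> ereal (3\<^sup>2 * real (card J) * (norm (psd_sqrt A *v v))\<^sup>2
        / (3 * l1_norm (restr J v) - l1_norm (restr (- J) v))\<^sup>2)"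
      unfolding \<kappa>_def compat_const_def by (rule INF_lower) (use d in \<open>simp add: d_def\<close>)
    then have \<kappa>_le: "\<kappa> \<le> ereal (9 * real (card J) * q / d\<^sup>2)"
      by (simp add: norm_psd_sqrt_sq[OF A] q_def d_def)
    then obtain k where k: "\<kappa> = ereal k" "0 \<le> k" "k \<le> 9 * real (card J) * q / d\<^sup>2"
      using \<kappa> by (cases \<kappa>) auto
    show ?thesis
    proof (cases "k = 0")
      case True
      then have "ereal (9 * lam\<^sup>2 * real (card J)) / (2 * \<kappa>) = \<infinity>"
        using \<open>J \<noteq> {}\<close> J lam' k(1) by (simp add: divide_ereal_def zero_less_mult_iff)
      then show ?thesis by simp
    next
      case False
      with k(2) have kpos: "k > 0" by simp
      then have "9 * real (card J) * q / d\<^sup>2 > 0" using k(3) by linarith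
      then have qpos: "q > 0" using q by (cases "q = 0") auto
      have "lam * d - q / 2 \<le> lam\<^sup>2 * d\<^sup>2 / (2 * q)"
      proof -
        have "0 \<le> (lam * d - q)\<^sup>2" by simp
        then have "2 * lam * d * q \<le> lam\<^sup>2 * d\<^sup>2 + q * q"
          by (simp add: power2_eq_square algebra_simps)
        then show ?thesis using qpos by (simp add: field_simps)
      qed
      also have "\<dots> \<le> 9 * lam\<^sup>2 * real (card J) / (2 * k)"
      proof -
        have "k * d\<^sup>2 \<le> 9 * real (card J) * q"
          using k(3) d by (simp add: field_simps)
        then have "lam\<^sup>2 * (k * d\<^sup>2) \<le> lam\<^sup>2 * (9 * real (card J) * q)"
          by (intro mult_left_mono) auto
        then show ?thesis using kpos qpos by (simp add: field_simps)
      qed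
      finally have "lam * d - q / 2 \<le> 9 * lam\<^sup>2 * real (card J) / (2 * k)" .
      then show ?thesis using k(1) kpos by simp
    qed
  qed
  then show ?thesis by (simp add: d_def q_def \<kappa>_def)
qed

text \<open>
  Put $D=\beta'-b$ and $Z=(S-A)b+\xi-c$. Strong minimality gives
  \[ \beta'\cdot S\beta'-2c\cdot\beta' - (b\cdot Sb-2c\cdot b)
     \le D\cdot SD-2D\cdot AD+2Z\cdot D+2\lambda(\|b\|_1-\|\beta'\|_1). \]
  By $S\le\frac32A$ the two quadratic terms are at most $-\frac12D\cdot AD$, and the noise term is
  at most $\lambda\|D\|_1$. The cone inequality and the compatibility constant absorb the rest.
  Here \<open>S\<close>, \<open>c\<close> play the population quantities and \<open>A\<close>, \<open>\<xi>\<close> the empirical ones.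
\<close>

lemma lasso_oracle_inequality:
  fixes A S :: "real^'n^'n"
  assumes A: "psd A" and S: "psd S" and le: "\<And>v. v \<bullet> (S *v v) \<le> 3 / 2 * (v \<bullet> (A *v v))"
    and lam: "lam \<ge> 0"
    and min: "\<And>\<beta>. \<beta>' \<bullet> (A *v \<beta>') - 2 * (\<xi> \<bullet> \<beta>') + 2 * lam * l1_norm \<beta>'
        \<le> \<beta> \<bullet> (A *v \<beta>) - 2 * (\<xi> \<bullet> \<beta>) + 2 * lam * l1_norm \<beta>"
    and noise: "\<And>j. \<bar>(S *v b - A *v b + \<xi> - c) $ j\<bar> \<le> lam / 2"
  shows "ereal (\<beta>' \<bullet> (S *v \<beta>') - 2 * (c \<bullet> \<beta>')) \<le>
     ereal (b \<bullet> (S *v b) - 2 * (c \<bullet> b)) + ereal (4 * lam * l1_norm (restr (- J) b))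
       + ereal (9 * lam\<^sup>2 * real (card J)) / (2 * compat_const A J 3)"
proof -
  define D where "D = \<beta>' - b"
  define Z where "Z = S *v b - A *v b + \<xi> - c"
  define d where "d = 3 * l1_norm (restr J D) - l1_norm (restr (- J) D)"
  have expand: "\<beta>' \<bullet> (E *v \<beta>') = b \<bullet> (E *v b) + 2 * ((E *v b) \<bullet> D) + D \<bullet> (E *v D)"
    if "psd E" for E
  proof -
    have "\<beta>' = b + D" by (simp add: D_def)
    moreover have "b \<bullet> (E *v D) = (E *v b) \<bullet> D"
      by (rule psd_inner[OF that, symmetric])
    ultimately show ?thesis
      by (simp add: matrix_vector_right_distrib inner_add_left inner_add_right inner_commute[of D "E *v b"])
  qed
  have strong: "\<beta>' \<bullet> (A *v \<beta>') - 2 * (\<xi> \<bullet> \<beta>') + 2 * lam * l1_norm \<beta>' + D \<bullet> (A *v D)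
      \<le> b \<bullet> (A *v b) - 2 * (\<xi> \<bullet> b) + 2 * lam * l1_norm b"
    unfolding D_def by (rule penalized_quadratic_strong_minimum[OF A lam min])
  have lin: "\<xi> \<bullet> \<beta>' = \<xi> \<bullet> b + \<xi> \<bullet> D" "c \<bullet> \<beta>' = c \<bullet> b + c \<bullet> D"
    by (simp_all add: D_def inner_diff_right)
  have "Z \<bullet> D = (S *v b) \<bullet> D - (A *v b) \<bullet> D + \<xi> \<bullet> D - c \<bullet> D"
    by (simp add: Z_def inner_add_left inner_diff_left)
  moreover have "Z \<bullet> D \<le> lam / 2 * l1_norm D"
    by (rule inner_le_l1_norm) (use noise in \<open>simp add: Z_def\<close>)
  moreover have "2 * lam * (l1_norm b - l1_norm \<beta>' + l1_norm D / 2)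
      \<le> 2 * lam * (d / 2 + 2 * l1_norm (restr (- J) b))"
    using l1_norm_cone[of b \<beta>' J] lam unfolding D_def d_def by (intro mult_left_mono) auto
  ultimately have "\<beta>' \<bullet> (S *v \<beta>') - 2 * (c \<bullet> \<beta>') - (b \<bullet> (S *v b) - 2 * (c \<bullet> b))
      \<le> 4 * lam * l1_norm (restr (- J) b) + (lam * d - D \<bullet> (A *v D) / 2)"
    using strong le[of D] unfolding expand[OF S] expand[OF A] lin by (simp add: algebra_simps)
  then have "ereal (\<beta>' \<bullet> (S *v \<beta>') - 2 * (c \<bullet> \<beta>'))
      \<le> ereal (b \<bullet> (S *v b) - 2 * (c \<bullet> b)) + ereal (4 * lam * l1_norm (restr (- J) b))
        + ereal (lam * d - D \<bullet> (A *v D) / 2)"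
    by simp
  also have "\<dots> \<le> ereal (b \<bullet> (S *v b) - 2 * (c \<bullet> b)) + ereal (4 * lam * l1_norm (restr (- J) b))
        + ereal (9 * lam\<^sup>2 * real (card J)) / (2 * compat_const A J 3)"
    unfolding d_def by (intro add_left_mono compat_const_bound[OF A lam])
  finally show ?thesis .
qed

section \<open>Independence of the pooled sample\<close>

text \<open>
  The rectangle probabilities factor first across the two blocks and then within each block.
\<close>

lemma (in prob_space) indep_vars_labeled_unlabeled:
  fixes X :: "nat \<Rightarrow> 'a \<Rightarrow> 'b::second_countable_topology"
    and Y :: "nat \<Rightarrow> 'a \<Rightarrow> 'c::second_countable_topology"
  assumes lab: "indep_vars (\<lambda>_. borel) (\<lambda>i \<omega>. (X i \<omega>, Y i \<omega>)) {1..n}"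
    and unlab: "indep_vars (\<lambda>_. borel) X {n+1..N}"
    and cross: "indep_set
      (sets (vimage_algebra (space M) (\<lambda>\<omega>. \<lambda>i\<in>{1..n}. (X i \<omega>, Y i \<omega>)) (Pi\<^sub>M {1..n} (\<lambda>_. borel))))
      (sets (vimage_algebra (space M) (\<lambda>\<omega>. \<lambda>i\<in>{n+1..N}. X i \<omega>) (Pi\<^sub>M {n+1..N} (\<lambda>_. borel))))"
    and nN: "1 \<le> n" "n < N"
  shows "indep_vars (\<lambda>_. borel) X {1..N}"
proof -
  have fst_meas: "fst \<in> borel_measurable (borel :: ('b \<times> 'c) measure)"
    by (intro borel_measurable_continuous_onI continuous_intros)
  have "indep_vars (\<lambda>_. borel) (\<lambda>i \<omega>. fst (X i \<omega>, Y i \<omega>)) {1..n}"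
    by (rule indep_vars_compose2[OF lab fst_meas])
  then have lab': "indep_vars (\<lambda>_. borel) X {1..n}" by simp
  have rv: "X i \<in> borel_measurable M" if "i \<in> {1..N}" for i
  proof (cases "i \<le> n")
    case True
    then show ?thesis using lab' that by (simp add: indep_vars_def)
  next
    case False
    then show ?thesis using unlab that by (simp add: indep_vars_def)
  qed
  let ?F = "\<lambda>i. {X i -` A \<inter> space M | A. A \<in> sets (borel :: 'b measure)}"
  have sub: "?F i \<subseteq> events" if "i \<in> {1..N}" for i
    using measurable_sets[OF rv[OF that]] by auto
  have top: "space M \<in> ?F i" for i
    by (rule CollectI, rule exI[of _ UNIV]) simp
  have "indep_sets ?F {1..N}"
  proof (subst indep_sets_finite)
    show "{1..N} \<noteq> {}" "finite {1..N}" using nN by auto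
    show "\<And>i. i \<in> {1..N} \<Longrightarrow> ?F i \<subseteq> events" by (rule sub)
    show "\<And>i. i \<in> {1..N} \<Longrightarrow> space M \<in> ?F i" by (rule top)
    show "\<forall>A\<in>Pi {1..N} ?F. prob (\<Inter>j\<in>{1..N}. A j) = (\<Prod>j\<in>{1..N}. prob (A j))"
    proof
      fix A assume A: "A \<in> Pi {1..N} ?F"
      have "\<exists>D. D \<in> sets borel \<and> A i = X i -` D \<inter> space M" if "i \<in> {1..N}" for i
        using Pi_mem[OF A that] by auto
      then obtain D where D: "\<And>i. i \<in> {1..N} \<Longrightarrow> D i \<in> sets borel"
        "\<And>i. i \<in> {1..N} \<Longrightarrow> A i = X i -` D i \<inter> space M"
        by metis
      have split: "{1..N} = {1..n} \<union> {n+1..N}" "{1..n} \<inter> {n+1..N} = {}" using nN by auto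
      have ne: "{1..n} \<noteq> {}" "{n+1..N} \<noteq> {}" using nN by auto
      have AF: "A j \<in> ?F j" if "j \<in> {1..N}" for j
        by (rule Pi_mem[OF A that])
      have "\<forall>j\<in>{1..n}. A j \<in> ?F j" "\<forall>j\<in>{n+1..N}. A j \<in> ?F j"
        using AF nN by (simp_all del: mem_Collect_eq)
      moreover have "indep_sets ?F {1..n}" "indep_sets ?F {n+1..N}"
        using lab' unlab by (simp_all only: indep_vars_def2)
      ultimately have "prob (\<Inter>j\<in>{1..n}. A j) = (\<Prod>j\<in>{1..n}. prob (A j))"
        "prob (\<Inter>j\<in>{n+1..N}. A j) = (\<Prod>j\<in>{n+1..N}. prob (A j))"
        using ne indep_setsD[OF _ order_refl] by blast+
      moreover have "prob ((\<Inter>j\<in>{1..n}. A j) \<inter> (\<Inter>j\<in>{n+1..N}. A j))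
          = prob (\<Inter>j\<in>{1..n}. A j) * prob (\<Inter>j\<in>{n+1..N}. A j)"
      proof (rule indep_setD[OF cross])
        have "fst -` D i \<inter> space borel \<in> sets (borel :: ('b \<times> 'c) measure)" if "i \<in> {1..n}" for i
          using measurable_sets[OF fst_meas D(1)] that nN by simp
        then have "(\<Pi>\<^sub>E i\<in>{1..n}. fst -` D i) \<in> sets (Pi\<^sub>M {1..n} (\<lambda>_. borel :: ('b \<times> 'c) measure))"
          by (intro sets_PiM_I_finite) auto
        moreover have "(\<Inter>j\<in>{1..n}. A j)
            = (\<lambda>\<omega>. \<lambda>i\<in>{1..n}. (X i \<omega>, Y i \<omega>)) -` (\<Pi>\<^sub>E i\<in>{1..n}. fst -` D i) \<inter> space M"
          using ne(1) nN D(2) by (auto simp: PiE_iff)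
        ultimately show "(\<Inter>j\<in>{1..n}. A j) \<in> sets (vimage_algebra (space M)
            (\<lambda>\<omega>. \<lambda>i\<in>{1..n}. (X i \<omega>, Y i \<omega>)) (Pi\<^sub>M {1..n} (\<lambda>_. borel)))"
          by (simp only: in_vimage_algebra)
        have "(\<Pi>\<^sub>E i\<in>{n+1..N}. D i) \<in> sets (Pi\<^sub>M {n+1..N} (\<lambda>_. borel))"
          using D(1) by (intro sets_PiM_I_finite) auto
        moreover have "(\<Inter>j\<in>{n+1..N}. A j)
            = (\<lambda>\<omega>. \<lambda>i\<in>{n+1..N}. X i \<omega>) -` (\<Pi>\<^sub>E i\<in>{n+1..N}. D i) \<inter> space M"
          using ne(2) nN D(2) by (auto simp: PiE_iff)
        ultimately show "(\<Inter>j\<in>{n+1..N}. A j) \<in> sets (vimage_algebra (space M)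
            (\<lambda>\<omega>. \<lambda>i\<in>{n+1..N}. X i \<omega>) (Pi\<^sub>M {n+1..N} (\<lambda>_. borel)))"
          by (simp only: in_vimage_algebra)
      qed
      moreover have "(\<Inter>j\<in>{1..N}. A j) = (\<Inter>j\<in>{1..n}. A j) \<inter> (\<Inter>j\<in>{n+1..N}. A j)"
        unfolding split(1) by (rule INT_Un)
      moreover have "(\<Prod>j\<in>{1..N}. prob (A j)) = (\<Prod>j\<in>{1..n}. prob (A j)) * (\<Prod>j\<in>{n+1..N}. prob (A j))"
        unfolding split(1) by (rule prod.union_disjoint) (use split(2) in auto)
      ultimately show "prob (\<Inter>j\<in>{1..N}. A j) = (\<Prod>j\<in>{1..N}. prob (A j))" by simp
    qed
  qed
  with rv show ?thesis unfolding indep_vars_def2 by blast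
qed

section \<open>The population risk of linear predictors\<close>

locale bounded_regression = prob_space P
  for P :: "((real^'p::finite) \<times> real) measure" +
  fixes fstar :: "real^'p \<Rightarrow> real" and B_X B_Y :: real
  assumes sets_P: "sets P = sets borel"
    and regression: "is_regression_function P fstar"
    and variance_X: "\<And>j. (\<integral>z. (fst z $ j)\<^sup>2 \<partial>P) = 1"
    and bounded: "AE z in P. \<bar>snd z\<bar> \<le> B_Y \<and> (\<forall>j. \<bar>fst z $ j\<bar> \<le> B_X)"
    and invertible_cov: "invertible (pop_cov P)"
begin

lemma space_P: "space P = UNIV"
  using sets_eq_imp_space_eq[OF sets_P] by simp

lemma measurable_P_iff: "f \<in> borel_measurable P \<longleftrightarrow> f \<in> borel_measurable borel"
  by (simp add: measurable_cong_sets[OF sets_P refl])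

lemma fst_measurable [measurable]: "fst \<in> borel_measurable P"
  unfolding measurable_P_iff by (intro borel_measurable_continuous_onI continuous_intros)

lemma snd_measurable [measurable]: "snd \<in> borel_measurable P"
  unfolding measurable_P_iff by (intro borel_measurable_continuous_onI continuous_intros)

lemma integral_marginal:
  fixes g :: "real^'p \<Rightarrow> real"
  assumes "g \<in> borel_measurable borel"
  shows "(\<integral>x. g x \<partial>marginal_X P) = (\<integral>z. g (fst z) \<partial>P)"
  unfolding marginal_X_def by (rule integral_distr[OF fst_measurable assms])

lemma fstar_measurable [measurable]: "fstar \<in> borel_measurable borel"
  using regression by (simp add: is_regression_function_def)

lemma bounds: "AE z in P. \<bar>snd z\<bar> \<le> B_Y" "AE z in P. \<forall>j. \<bar>fst z $ j\<bar> \<le> B_X"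
  using bounded by (auto elim: eventually_mono)

lemma inner_bound: "AE z in P. \<bar>fst z \<bullet> \<beta>\<bar> \<le> B_X * (\<Sum>j\<in>UNIV. \<bar>\<beta> $ j\<bar>)"
  using bounds(2)
proof eventually_elim
  case (elim z)
  have "\<bar>fst z \<bullet> \<beta>\<bar> \<le> (\<Sum>j\<in>UNIV. \<bar>fst z $ j\<bar> * \<bar>\<beta> $ j\<bar>)"
    unfolding inner_vec_def using sum_abs[of "\<lambda>j. fst z $ j * \<beta> $ j" UNIV] by (simp add: abs_mult)
  also have "\<dots> \<le> (\<Sum>j\<in>UNIV. B_X * \<bar>\<beta> $ j\<bar>)"
    using elim by (intro sum_mono mult_right_mono) auto
  finally show ?case by (simp add: sum_distrib_left)
qed

lemma integrable_mult_bounded: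
  fixes f g :: "(real^'p) \<times> real \<Rightarrow> real"
  assumes [measurable]: "f \<in> borel_measurable P" "g \<in> borel_measurable P"
    and f: "AE z in P. \<bar>f z\<bar> \<le> a" and g: "AE z in P. \<bar>g z\<bar> \<le> b"
  shows "integrable P (\<lambda>z. f z * g z)"
proof (rule integrable_const_bound[where B = "\<bar>a\<bar> * \<bar>b\<bar>"])
  show "AE z in P. norm (f z * g z) \<le> \<bar>a\<bar> * \<bar>b\<bar>"
    using f g by eventually_elim (auto simp: abs_mult intro!: mult_mono)
qed measurable

lemma B_X_ge_1: "1 \<le> B_X"
proof -
  have B0: "0 \<le> B_X"
  proof (rule ccontr)
    assume "\<not> 0 \<le> B_X"
    then have "\<not> \<bar>x\<bar> \<le> B_X" for x by simp
    with bounds(2) show False by simp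
  qed
  have "1 = (\<integral>z. (fst z $ undefined)\<^sup>2 \<partial>P)" by (simp add: variance_X)
  also have "\<dots> \<le> (\<integral>z. B_X\<^sup>2 \<partial>P)"
  proof (rule integral_mono_AE)
    show "integrable P (\<lambda>z. (fst z $ undefined)\<^sup>2)"
      unfolding power2_eq_square
      by (rule integrable_mult_bounded[of _ _ B_X B_X]) (use bounds(2) in \<open>auto elim: eventually_mono\<close>)
    show "AE z in P. (fst z $ undefined)\<^sup>2 \<le> B_X\<^sup>2"
      using bounds(2) 
    proof eventually_elim
      case (elim z)
      then have "\<bar>fst z $ undefined\<bar>\<^sup>2 \<le> B_X\<^sup>2" by (intro power_mono) auto
      then show ?case by simp
    qed
  qed simp
  also have "\<dots> = B_X\<^sup>2" by (simp add: prob_space)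
  finally have "1\<^sup>2 \<le> B_X\<^sup>2" by simp
  then show ?thesis using B0 by (rule power2_le_imp_le)
qed

lemma B_Y_nonneg: "0 \<le> B_Y"
proof (rule ccontr)
  assume "\<not> 0 \<le> B_Y"
  then have "\<not> \<bar>y\<bar> \<le> B_Y" for y by simp
  with bounds(1) show False by simp
qed

lemma pop_cov_entry: "pop_cov P $ j $ k = (\<integral>z. fst z $ j * fst z $ k \<partial>P)"
  unfolding pop_cov_def by (simp add: integral_marginal)

lemma integrable_coordinates: "integrable P (\<lambda>z. fst z $ j * fst z $ k)"
  by (rule integrable_mult_bounded[of _ _ B_X B_X]) (use bounds(2) in \<open>auto elim: eventually_mono\<close>)

lemma pop_cov_mult: "(pop_cov P *v \<beta>) $ j = (\<integral>z. fst z $ j * (fst z \<bullet> \<beta>) \<partial>P)"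
proof -
  have "(pop_cov P *v \<beta>) $ j = (\<Sum>k\<in>UNIV. (\<integral>z. fst z $ j * fst z $ k \<partial>P) * \<beta> $ k)"
    by (simp add: matrix_vector_mult_def pop_cov_entry)
  also have "\<dots> = (\<integral>z. (\<Sum>k\<in>UNIV. fst z $ j * fst z $ k * \<beta> $ k) \<partial>P)"
    using integrable_coordinates by simp
  finally show ?thesis by (simp add: inner_vec_def sum_distrib_left mult.assoc)
qed

lemma pop_cov_form: "\<alpha> \<bullet> (pop_cov P *v \<beta>) = (\<integral>z. (fst z \<bullet> \<alpha>) * (fst z \<bullet> \<beta>) \<partial>P)"
proof -
  have int: "integrable P (\<lambda>z. fst z $ j * (fst z \<bullet> \<beta>))" for j
    by (rule integrable_mult_bounded[of _ _ B_X, OF _ _ _ inner_bound])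
      (use bounds(2) in \<open>auto elim: eventually_mono\<close>)
  have "\<alpha> \<bullet> (pop_cov P *v \<beta>) = (\<Sum>j\<in>UNIV. \<alpha> $ j * (\<integral>z. fst z $ j * (fst z \<bullet> \<beta>) \<partial>P))"
    by (simp add: inner_vec_def[of \<alpha>] pop_cov_mult)
  also have "\<dots> = (\<integral>z. (\<Sum>j\<in>UNIV. \<alpha> $ j * (fst z $ j * (fst z \<bullet> \<beta>))) \<partial>P)"
    using int by simp
  also have "(\<lambda>z. \<Sum>j\<in>UNIV. \<alpha> $ j * (fst z $ j * (fst z \<bullet> \<beta>))) = (\<lambda>z. (fst z \<bullet> \<alpha>) * (fst z \<bullet> \<beta>))"
    by (simp add: fun_eq_iff inner_vec_def[of _ \<alpha>] sum_distrib_left sum_distrib_right mult_ac)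
  finally show ?thesis .
qed

lemma psd_pop_cov: "psd (pop_cov P)"
  unfolding psd_def
proof
  show "transpose (pop_cov P) = pop_cov P"
    by (simp add: transpose_def vec_eq_iff pop_cov_entry mult.commute)
  show "\<forall>v. 0 \<le> v \<bullet> (pop_cov P *v v)"
    by (simp add: pop_cov_form)
qed

definition cross_cov :: "real^'p" where
  "cross_cov = (\<chi> j. \<integral>z. snd z * fst z $ j \<partial>P)"

lemma cross_cov_inner: "cross_cov \<bullet> \<beta> = (\<integral>z. snd z * (fst z \<bullet> \<beta>) \<partial>P)"
proof -
  have int: "integrable P (\<lambda>z. snd z * fst z $ j)" for j
    by (rule integrable_mult_bounded[of _ _ B_Y B_X]) (use bounds in \<open>auto elim: eventually_mono\<close>)
  have "cross_cov \<bullet> \<beta> = (\<Sum>j\<in>UNIV. (\<integral>z. snd z * fst z $ j \<partial>P) * \<beta> $ j)"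
    by (simp add: cross_cov_def inner_vec_def)
  also have "\<dots> = (\<integral>z. (\<Sum>j\<in>UNIV. snd z * fst z $ j * \<beta> $ j) \<partial>P)"
    using int by simp
  finally show ?thesis by (simp add: inner_vec_def sum_distrib_left mult.assoc)
qed

text \<open>
  Since $x\cdot\beta$ is measurable with respect to $x$, the mixed term
  $E[(X\cdot\beta)f^\star(X)]$ equals $E[(X\cdot\beta)Y]$, and the risk becomes a quadratic
  polynomial in \<open>\<beta>\<close>. Boundedness of $Y$ passes to $f^\star$, which makes all the integrals finite.
\<close>

lemma excess_risk_eq:
  "excess_risk P fstar (lin_pred \<beta>)
     = \<beta> \<bullet> (pop_cov P *v \<beta>) - 2 * (cross_cov \<bullet> \<beta>) + (\<integral>z. (fstar (fst z))\<^sup>2 \<partial>P)"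
proof -
  let ?F = "vimage_algebra (space P) fst (borel :: (real^'p) measure)"
  have sub: "subalgebra P ?F"
    unfolding subalgebra_def
  proof
    show "sets ?F \<subseteq> sets P"
      using measurable_sets[OF fst_measurable] by (auto simp: sets_vimage_algebra2 space_P)
  qed simp
  interpret finite_measure_subalgebra P ?F
    by unfold_locales (rule sub)
  have int_snd: "integrable P snd"
    by (rule integrable_const_bound[where B = B_Y]) (use bounds(1) in auto)
  have cond: "AE z in P. real_cond_exp P ?F snd z = fstar (fst z)"
    using regression by (simp add: is_regression_function_def)
  have "AE z in P. real_cond_exp P ?F snd z \<le> B_Y"
    by (rule real_cond_exp_le_c[OF int_snd]) (use bounds(1) in \<open>auto elim: eventually_mono\<close>)
  moreover have "AE z in P. real_cond_exp P ?F snd z \<ge> - B_Y"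
    by (rule real_cond_exp_ge_c[OF int_snd]) (use bounds(1) in \<open>auto elim: eventually_mono\<close>)
  ultimately have fstar_bound: "AE z in P. \<bar>fstar (fst z)\<bar> \<le> B_Y"
    using cond by eventually_elim auto
  have f_meas: "(\<lambda>z. fstar (fst z)) \<in> borel_measurable P"
    by measurable
  have inner_meas: "(\<lambda>z. fst z \<bullet> \<beta>) \<in> borel_measurable P"
    by measurable
  have int1: "integrable P (\<lambda>z. (fst z \<bullet> \<beta>) * (fst z \<bullet> \<beta>))"
    by (rule integrable_mult_bounded[OF inner_meas inner_meas inner_bound inner_bound])
  have int2: "integrable P (\<lambda>z. (fst z \<bullet> \<beta>) * fstar (fst z))"
    by (rule integrable_mult_bounded[OF inner_meas f_meas inner_bound fstar_bound])
  have int3: "integrable P (\<lambda>z. fstar (fst z) * fstar (fst z))"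
    by (rule integrable_mult_bounded[OF f_meas f_meas fstar_bound fstar_bound])
  have int4: "integrable P (\<lambda>z. (fst z \<bullet> \<beta>) * snd z)"
    by (rule integrable_mult_bounded[OF inner_meas snd_measurable inner_bound bounds(1)])
  have "fst \<in> borel_measurable ?F"
    by (rule measurable_vimage_algebra1) simp
  then have "(\<lambda>z. fst z \<bullet> \<beta>) \<in> borel_measurable ?F"
    by measurable
  from real_cond_exp_intg(2)[OF int4 this snd_measurable]
  have "(\<integral>z. (fst z \<bullet> \<beta>) * snd z \<partial>P) = (\<integral>z. (fst z \<bullet> \<beta>) * real_cond_exp P ?F snd z \<partial>P)" ..
  also have "\<dots> = (\<integral>z. (fst z \<bullet> \<beta>) * fstar (fst z) \<partial>P)"
  proof (rule integral_cong_AE)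
    have [measurable]: "real_cond_exp P ?F snd \<in> borel_measurable P"
      by (rule borel_measurable_cond_exp2)
    show "(\<lambda>z. (fst z \<bullet> \<beta>) * real_cond_exp P ?F snd z) \<in> borel_measurable P"
      using inner_meas by measurable
    show "(\<lambda>z. (fst z \<bullet> \<beta>) * fstar (fst z)) \<in> borel_measurable P"
      using inner_meas f_meas by measurable
    show "AE z in P. (fst z \<bullet> \<beta>) * real_cond_exp P ?F snd z = (fst z \<bullet> \<beta>) * fstar (fst z)"
      using cond by eventually_elim simp
  qed
  finally have cross: "cross_cov \<bullet> \<beta> = (\<integral>z. (fst z \<bullet> \<beta>) * fstar (fst z) \<partial>P)"
    by (simp add: cross_cov_inner mult.commute)
  have "excess_risk P fstar (lin_pred \<beta>) = (\<integral>z. (fst z \<bullet> \<beta> - fstar (fst z))\<^sup>2 \<partial>P)"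
    unfolding excess_risk_def lin_pred_def by (rule integral_marginal) measurable
  also have "\<dots> = (\<integral>z. (fst z \<bullet> \<beta>) * (fst z \<bullet> \<beta>) - 2 * ((fst z \<bullet> \<beta>) * fstar (fst z))
      + fstar (fst z) * fstar (fst z) \<partial>P)"
    by (simp add: power2_eq_square algebra_simps)
  also have "\<dots> = (\<integral>z. (fst z \<bullet> \<beta>) * (fst z \<bullet> \<beta>) \<partial>P) - 2 * (\<integral>z. (fst z \<bullet> \<beta>) * fstar (fst z) \<partial>P)
      + (\<integral>z. fstar (fst z) * fstar (fst z) \<partial>P)"
    using int1 int2 int3 by simp
  finally show ?thesis by (simp add: pop_cov_form cross power2_eq_square)
qed

end

section \<open>Whitening and the penalised population minimiser\<close>

lemma matrix_inv_inverse:
  fixes A :: "real^'n^'n"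
  assumes "invertible A"
  shows "A ** matrix_inv A = mat 1" "matrix_inv A ** A = mat 1"
proof -
  have "\<exists>A'. A ** A' = mat 1 \<and> A' ** A = mat 1"
    using assms by (simp add: invertible_def)
  then have "A ** matrix_inv A = mat 1 \<and> matrix_inv A ** A = mat 1"
    unfolding matrix_inv_def by (rule someI_ex)
  then show "A ** matrix_inv A = mat 1" "matrix_inv A ** A = mat 1" by auto
qed

lemma spectral_norm_bound: "norm (A *v x) \<le> spectral_norm A * norm x"
  unfolding spectral_norm_def by (rule onorm) (rule matrix_vector_mul_bounded_linear)

lemma spectral_norm_inverse_pos:
  fixes A :: "real^'n^'n"
  assumes "invertible A"
  shows "0 < spectral_norm (matrix_inv A)"
proof -
  define v :: "real^'n" where "v = axis undefined 1"
  have "v = matrix_inv A *v (A *v v)"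
    by (simp add: matrix_vector_mul_assoc matrix_inv_inverse[OF assms])
  then have "1 \<le> spectral_norm (matrix_inv A) * norm (A *v v)"
    using spectral_norm_bound[of "matrix_inv A" "A *v v"] by (simp add: v_def)
  moreover have "0 \<le> norm (A *v v)" by simp
  ultimately show ?thesis
    by (metis less_le_trans mult_nonpos_nonneg not_le not_one_le_zero order_trans)
qed

text \<open>
  \<open>C\<close> is the square root of the inverse of \<open>S\<close>, and $CS$ is its inverse. So $Cx$ has second-moment
  matrix $CSC=I$ when $x$ has second-moment matrix \<open>S\<close>.
\<close>

lemma whitening:
  fixes S :: "real^'n^'n"
  assumes S: "psd S" and inv: "invertible S"
  obtains C where "transpose C = C" "C ** S ** C = mat 1" "\<And>v. C *v ((C ** S) *v v) = v"
    "\<And>v. (norm ((C ** S) *v v))\<^sup>2 = v \<bullet> (S *v v)"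
    "\<And>x. (norm (C *v x))\<^sup>2 \<le> spectral_norm (matrix_inv S) * (norm x)\<^sup>2"
proof -
  let ?T = "matrix_inv S"
  note ST = matrix_inv_inverse[OF inv]
  have STv: "S *v (?T *v x) = x" for x
    by (simp add: matrix_vector_mul_assoc ST)
  have "(?T *v x) \<bullet> y = x \<bullet> (?T *v y)" for x y
  proof -
    have "(?T *v x) \<bullet> y = (?T *v x) \<bullet> (S *v (?T *v y))" by (simp only: STv)
    also have "\<dots> = (S *v (?T *v x)) \<bullet> (?T *v y)" by (rule psd_inner[OF S, symmetric])
    finally show ?thesis by (simp only: STv)
  qed
  moreover from this have "0 \<le> x \<bullet> (?T *v x)" for x
    using psd_nonneg[OF S, of "?T *v x"] by (simp add: STv inner_commute)
  ultimately have T: "psd ?T"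
    unfolding psd_def using transpose_eqI by blast
  define C where "C = psd_sqrt ?T"
  have C: "psd C" and CC: "C ** C = ?T"
    using psd_sqrt[OF T] by (auto simp: C_def)
  have right: "C ** (C ** S) = mat 1"
    by (simp add: matrix_mul_assoc CC ST)
  then have left: "(C ** S) ** C = mat 1"
    by (simp add: matrix_left_right_inverse)
  show ?thesis
  proof
    show "transpose C = C" by (rule psd_symmetric[OF C])
    show "C ** S ** C = mat 1" by (rule left)
    show "C *v ((C ** S) *v v) = v" for v
      by (simp add: matrix_vector_mul_assoc right)
    show "(norm ((C ** S) *v v))\<^sup>2 = v \<bullet> (S *v v)" for v
    proof -
      have "(norm ((C ** S) *v v))\<^sup>2 = (C *v (S *v v)) \<bullet> (C *v (S *v v))"
        by (simp add: power2_norm_eq_inner matrix_vector_mul_assoc)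
      also have "\<dots> = (S *v v) \<bullet> (C *v (C *v (S *v v)))"
        by (rule psd_inner[OF C])
      also have "C *v (C *v (S *v v)) = v"
        by (simp add: matrix_vector_mul_assoc matrix_mul_assoc CC ST)
      finally show ?thesis by (simp add: inner_commute)
    qed
    show "(norm (C *v x))\<^sup>2 \<le> spectral_norm ?T * (norm x)\<^sup>2" for x
    proof -
      have "(norm (C *v x))\<^sup>2 = x \<bullet> (?T *v x)"
        using norm_psd_sqrt_sq[OF T] by (simp add: C_def)
      also have "\<dots> \<le> norm x * norm (?T *v x)"
        by (rule norm_cauchy_schwarz)
      also have "\<dots> \<le> norm x * (spectral_norm ?T * norm x)"
        by (intro mult_left_mono spectral_norm_bound) simp
      finally show ?thesis by (simp add: power2_eq_square mult_ac)
    qed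
  qed
qed

lemma l1_norm_restr: "l1_norm (restr K v) = (\<Sum>j\<in>K. \<bar>v $ j\<bar>)"
  unfolding l1_norm_def restr_def by (simp add: sum.If_cases if_distrib[of abs] cong: if_cong)

context bounded_regression
begin

text \<open>
  Cauchy--Schwarz for $E[Y(X\cdot\beta)]$, obtained from the arithmetic-geometric mean inequality
  with the weight that balances the two terms.
\<close>

lemma cross_cov_le:
  assumes "\<beta> \<bullet> (pop_cov P *v \<beta>) = q" "q > 0" "B_Y > 0"
  shows "cross_cov \<bullet> \<beta> \<le> sqrt q * B_Y"
proof -
  have int: "integrable P (\<lambda>z. (fst z \<bullet> \<beta>) * (fst z \<bullet> \<beta>))"
    by (rule integrable_mult_bounded[OF _ _ inner_bound inner_bound]) measurable
  have intY: "integrable P (\<lambda>z. snd z * (fst z \<bullet> \<beta>))"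
    by (rule integrable_mult_bounded[OF _ _ bounds(1) inner_bound]) measurable
  define s where "s = B_Y / sqrt q"
  have s: "s > 0" "s * q = B_Y * sqrt q" "B_Y\<^sup>2 / s = B_Y * sqrt q"
    using assms by (auto simp: s_def field_simps power2_eq_square real_sqrt_mult_self)
  have "cross_cov \<bullet> \<beta> = (\<integral>z. snd z * (fst z \<bullet> \<beta>) \<partial>P)"
    by (rule cross_cov_inner)
  also have "\<dots> \<le> (\<integral>z. s / 2 * ((fst z \<bullet> \<beta>) * (fst z \<bullet> \<beta>)) + B_Y\<^sup>2 / s / 2 \<partial>P)"
  proof (rule integral_mono_AE[OF intY])
    show "integrable P (\<lambda>z. s / 2 * ((fst z \<bullet> \<beta>) * (fst z \<bullet> \<beta>)) + B_Y\<^sup>2 / s / 2)"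
      using int by simp
    show "AE z in P. snd z * (fst z \<bullet> \<beta>) \<le> s / 2 * ((fst z \<bullet> \<beta>) * (fst z \<bullet> \<beta>)) + B_Y\<^sup>2 / s / 2"
      using bounds(1)
    proof eventually_elim
      case (elim z)
      have "\<bar>snd z\<bar>\<^sup>2 \<le> B_Y\<^sup>2" using elim by (intro power_mono) auto
      moreover have "0 \<le> (s * (fst z \<bullet> \<beta>) - snd z)\<^sup>2" by simp
      ultimately have "2 * s * (snd z * (fst z \<bullet> \<beta>)) \<le> s * s * ((fst z \<bullet> \<beta>) * (fst z \<bullet> \<beta>)) + B_Y\<^sup>2"
        by (simp add: power2_diff power2_eq_square algebra_simps)
      then show ?case using s(1) by (simp add: field_simps power2_eq_square)
    qed
  qed
  also have "\<dots> = s * q / 2 + B_Y\<^sup>2 / s / 2"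
    using int assms(1) by (simp add: pop_cov_form prob_space)
  also have "\<dots> = sqrt q * B_Y"
    using s by (simp add: mult.commute)
  finally show ?thesis .
qed

text \<open>
  The noise vector of the comparison with a vector \<open>b\<close> contains $(\hat\Sigma-\Sigma)b$, so \<open>b\<close> has to be
  deterministic and of controlled size. A minimiser of the penalised risk over the compact
  ellipsoid $\beta\cdot\Sigma\beta\le B_Y^2$ is also a global minimiser: outside the ellipsoid,
  shrinking \<open>\<beta>\<close> to its boundary does not increase the objective, because
  $E[Y(X\cdot\beta)]\le B_Y(\beta\cdot\Sigma\beta)^{1/2}$.
\<close>

lemma penalized_risk_minimizer:
  assumes B_Y: "B_Y > 0" and lam: "lam \<ge> 0"
  obtains b where "b \<bullet> (pop_cov P *v b) \<le> B_Y\<^sup>2"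
    "\<And>\<beta>. excess_risk P fstar (lin_pred b) + 4 * lam * l1_norm (restr K b)
       \<le> excess_risk P fstar (lin_pred \<beta>) + 4 * lam * l1_norm (restr K \<beta>)"
proof -
  define q where "q \<beta> = \<beta> \<bullet> (pop_cov P *v \<beta>)" for \<beta>
  define G where "G \<beta> = q \<beta> - 2 * (cross_cov \<bullet> \<beta>) + 4 * lam * l1_norm (restr K \<beta>)" for \<beta>
  obtain C where C: "\<And>v. C *v ((C ** pop_cov P) *v v) = v"
    "\<And>v. (norm ((C ** pop_cov P) *v v))\<^sup>2 = q v"
    unfolding q_def using whitening[OF psd_pop_cov invertible_cov] by metis
  define E where "E = (\<lambda>v. C *v v) ` cball 0 B_Y"
  have "compact E"
    unfolding E_def by (intro compact_continuous_image linear_continuous_on matrix_vector_mul_bounded_linear compact_cball)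
  have mem_E: "v \<in> E" if "q v \<le> B_Y\<^sup>2" for v
  proof -
    have "(norm ((C ** pop_cov P) *v v))\<^sup>2 \<le> B_Y\<^sup>2"
      unfolding C(2) by (rule that)
    then have "norm ((C ** pop_cov P) *v v) \<le> B_Y"
      by (rule power2_le_imp_le) (use B_Y in simp)
    then show ?thesis
      unfolding E_def by (intro image_eqI[of _ _ "(C ** pop_cov P) *v v"]) (simp_all add: C(1))
  qed
  have q_cont: "continuous_on UNIV q"
    unfolding q_def by (intro continuous_intros linear_continuous_on matrix_vector_mul_bounded_linear)
  have G_cont: "continuous_on UNIV G"
    unfolding G_def l1_norm_restr by (intro continuous_intros q_cont)
  define F where "F = E \<inter> {v. q v \<le> B_Y\<^sup>2}"
  have "compact F"
    unfolding F_def
    by (rule compact_Int_closed[OF \<open>compact E\<close> closed_Collect_le[OF q_cont continuous_on_const]])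
  moreover have F: "v \<in> F \<longleftrightarrow> q v \<le> B_Y\<^sup>2" for v
    using mem_E by (auto simp: F_def)
  moreover have "0 \<in> F" by (simp add: F q_def)
  ultimately obtain b where b: "b \<in> F" "\<And>v. v \<in> F \<Longrightarrow> G b \<le> G v"
    using continuous_attains_inf[of F G] continuous_on_subset[OF G_cont] by blast
  have "G b \<le> G \<beta>" for \<beta>
  proof (cases "q \<beta> \<le> B_Y\<^sup>2")
    case True
    then show ?thesis using b(2) F by simp
  next
    case False
    \<comment> \<open>Shrinking \<open>\<beta>\<close> to the boundary of the ellipsoid does not increase the objective.\<close>
    define t where "t = B_Y / sqrt (q \<beta>)"
    have q: "q \<beta> > 0" using False zero_le_power2[of B_Y] by linarith
    have "B_Y < sqrt (q \<beta>)"
      using False B_Y by (simp add: real_less_rsqrt)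
    then have t: "0 < t" "t < 1" "t * q \<beta> = sqrt (q \<beta>) * B_Y"
      using B_Y q by (auto simp: t_def field_simps real_sqrt_mult_self)
    have qt: "q (t *\<^sub>R \<beta>) = t\<^sup>2 * q \<beta>"
      by (simp add: q_def matrix_vector_mult_scaleR power2_eq_square)
    also have "\<dots> = B_Y\<^sup>2"
      using q by (simp add: t_def power_divide)
    finally have "G b \<le> G (t *\<^sub>R \<beta>)"
      using b(2) F by simp
    also have "\<dots> \<le> G \<beta>"
    proof -
      have "G \<beta> - G (t *\<^sub>R \<beta>)
          = (1 - t) * ((1 + t) * q \<beta> - 2 * (cross_cov \<bullet> \<beta>) + 4 * lam * l1_norm (restr K \<beta>))"
        using t by (simp add: G_def qt restr_scaleR l1_norm_scaleR power2_eq_square algebra_simps)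
      moreover have "0 \<le> (1 + t) * q \<beta> - 2 * (cross_cov \<bullet> \<beta>) + 4 * lam * l1_norm (restr K \<beta>)"
      proof -
        have "cross_cov \<bullet> \<beta> \<le> t * q \<beta>"
          using cross_cov_le[OF q_def[symmetric] q B_Y] t(3) by simp
        moreover have "t * q \<beta> \<le> q \<beta>" using t(2) q by simp
        moreover have "0 \<le> 4 * lam * l1_norm (restr K \<beta>)"
          using lam by (simp add: l1_norm_nonneg)
        ultimately show ?thesis by (simp add: algebra_simps)
      qed
      ultimately show ?thesis
        using t by (metis diff_ge_0_iff_ge less_imp_le mult_nonneg_nonneg)
    qed
    finally show ?thesis .
  qed
  then have "excess_risk P fstar (lin_pred b) + 4 * lam * l1_norm (restr K b)
      \<le> excess_risk P fstar (lin_pred \<beta>) + 4 * lam * l1_norm (restr K \<beta>)" for \<beta>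
    unfolding excess_risk_eq G_def q_def by (simp add: add_ac diff_add_eq)
  moreover have "b \<bullet> (pop_cov P *v b) \<le> B_Y\<^sup>2"
    using b(1) by (simp only: F q_def)
  ultimately show ?thesis by (intro that)
qed

end

section \<open>Concentration of the empirical moments\<close>

text \<open>
  All \<open>N\<close> covariate vectors form one i.i.d. sample here, whether or not they carry a label.
\<close>

locale semi_supervised_sample = bounded_regression P fstar B_X B_Y + data: prob_space M
  for P :: "((real^'p::finite) \<times> real) measure" and fstar B_X B_Y and M :: "'w measure" +
  fixes X :: "nat \<Rightarrow> 'w \<Rightarrow> real^'p" and Y :: "nat \<Rightarrow> 'w \<Rightarrow> real" and n N :: nat
  assumes n: "1 \<le> n" and nN: "n < N"
    and labeled_law: "\<And>i. i \<in> {1..n} \<Longrightarrow> distr M borel (\<lambda>\<omega>. (X i \<omega>, Y i \<omega>)) = P"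
    and labeled_indep: "data.indep_vars (\<lambda>_. borel) (\<lambda>i \<omega>. (X i \<omega>, Y i \<omega>)) {1..n}"
    and X_law: "\<And>i. i \<in> {1..N} \<Longrightarrow> distr M borel (X i) = marginal_X P"
    and X_indep: "data.indep_vars (\<lambda>_. borel) X {1..N}"
begin

lemma X_measurable: "i \<in> {1..N} \<Longrightarrow> X i \<in> borel_measurable M"
  using X_indep by (simp add: data.indep_vars_def)

lemma XY_measurable: "i \<in> {1..n} \<Longrightarrow> (\<lambda>\<omega>. (X i \<omega>, Y i \<omega>)) \<in> borel_measurable M"
  using labeled_indep by (simp add: data.indep_vars_def)

lemma X_expectation:
  fixes g :: "real^'p \<Rightarrow> real"
  assumes "i \<in> {1..N}" "g \<in> borel_measurable borel"
  shows "data.expectation (\<lambda>\<omega>. g (X i \<omega>)) = (\<integral>z. g (fst z) \<partial>P)"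
  using integral_distr[OF X_measurable[OF assms(1)] assms(2)] integral_marginal[OF assms(2)]
  by (simp add: X_law[OF assms(1)])

lemma X_AE:
  assumes "i \<in> {1..N}" "AE z in P. Q (fst z)" "{x. Q x} \<in> sets borel"
  shows "AE \<omega> in M. Q (X i \<omega>)"
proof -
  have "AE x in marginal_X P. Q x"
    unfolding marginal_X_def using assms(2,3) by (subst AE_distr_iff[OF fst_measurable]) auto
  then have "AE x in distr M borel (X i). Q x" by (simp only: X_law[OF assms(1)])
  then show ?thesis
    using assms(3) by (subst (asm) AE_distr_iff[OF X_measurable[OF assms(1)]]) auto
qed

lemma XY_expectation:
  fixes g :: "(real^'p) \<times> real \<Rightarrow> real"
  assumes "i \<in> {1..n}" "g \<in> borel_measurable borel"
  shows "data.expectation (\<lambda>\<omega>. g (X i \<omega>, Y i \<omega>)) = (\<integral>z. g z \<partial>P)"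
  using integral_distr[OF XY_measurable[OF assms(1)] assms(2)] by (simp add: labeled_law[OF assms(1)])

lemma XY_AE:
  assumes "i \<in> {1..n}" "AE z in P. Q z" "{z. Q z} \<in> sets borel"
  shows "AE \<omega> in M. Q (X i \<omega>, Y i \<omega>)"
proof -
  have "AE z in distr M borel (\<lambda>\<omega>. (X i \<omega>, Y i \<omega>)). Q z"
    using assms(2) by (simp only: labeled_law[OF assms(1)])
  then show ?thesis
    using assms(3) by (subst (asm) AE_distr_iff[OF XY_measurable[OF assms(1)]]) auto
qed

text \<open>
  An almost sure bound on $X\cdot\Sigma^{-1}X$.
\<close>

definition leverage :: real where
  "leverage = B_X\<^sup>2 * real CARD('p) * spectral_norm (matrix_inv (pop_cov P))"

lemma leverage_pos: "leverage > 0"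
  unfolding leverage_def using B_X_ge_1 spectral_norm_inverse_pos[OF invertible_cov] by simp

lemma norm_sq_le:
  fixes x :: "real^'p"
  assumes "\<forall>j. \<bar>x $ j\<bar> \<le> B_X"
  shows "(norm x)\<^sup>2 \<le> B_X\<^sup>2 * CARD('p)"
proof -
  have "(norm x)\<^sup>2 = (\<Sum>j\<in>UNIV. \<bar>x $ j\<bar>\<^sup>2)"
    unfolding power2_norm_eq_inner by (simp add: inner_vec_def power2_eq_square)
  also have "\<dots> \<le> (\<Sum>j\<in>(UNIV :: 'p set). B_X\<^sup>2)"
    using assms by (intro sum_mono power_mono) auto
  finally show ?thesis by (simp add: mult.commute)
qed

lemma whitened_bound:
  fixes C :: "real^'p^'p" and x :: "real^'p"
  assumes C: "\<And>x. (norm (C *v x))\<^sup>2 \<le> spectral_norm (matrix_inv (pop_cov P)) * (norm x)\<^sup>2"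
    and x: "\<forall>j. \<bar>x $ j\<bar> \<le> B_X"
  shows "norm (C *v x) \<le> sqrt leverage"
proof -
  have "(norm (C *v x))\<^sup>2 \<le> spectral_norm (matrix_inv (pop_cov P)) * (B_X\<^sup>2 * CARD('p))"
    using C[of x] mult_left_mono[OF norm_sq_le[OF x] less_imp_le[OF spectral_norm_inverse_pos[OF invertible_cov]]]
    by linarith
  then show ?thesis
    by (intro real_le_rsqrt) (simp add: leverage_def mult_ac)
qed

lemma bounded_set_borel: "{x :: real^'p. \<forall>j. \<bar>x $ j\<bar> \<le> B_X} \<in> sets borel"
proof -
  have "closed {x :: real^'p. \<forall>j. \<bar>x $ j\<bar> \<le> B_X}"
    by (intro closed_Collect_all closed_Collect_le continuous_intros)
  then show ?thesis by (rule borel_closed)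
qed

lemma X_bounded: "i \<in> {1..N} \<Longrightarrow> AE \<omega> in M. \<forall>j. \<bar>X i \<omega> $ j\<bar> \<le> B_X"
  by (rule X_AE[OF _ bounds(2) bounded_set_borel])

text \<open>
  The whitened vectors, scaled by the root of the leverage, lie in the unit ball and have second moment
  $I$ divided by the leverage; undoing the whitening in the Chernoff bound compares $\Sigma$
  with $\hat\Sigma$.
\<close>

lemma covariance_event:
  obtains E where "E \<in> sets M" "data.prob (space M - E) \<le> CARD('p) * exp (- (2 / 35 * N / leverage))"
    "\<And>\<omega> v. \<omega> \<in> E \<Longrightarrow> v \<bullet> (pop_cov P *v v) \<le> 3 / 2 * (v \<bullet> (emp_cov N (\<lambda>i. X i \<omega>) *v v))"
proof -
  obtain C where sym: "transpose C = C" and CSC: "C ** pop_cov P ** C = mat 1"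
    and inv: "\<And>v. C *v ((C ** pop_cov P) *v v) = v"
    and nrm: "\<And>v. (norm ((C ** pop_cov P) *v v))\<^sup>2 = v \<bullet> (pop_cov P *v v)"
    and op: "\<And>x. (norm (C *v x))\<^sup>2 \<le> spectral_norm (matrix_inv (pop_cov P)) * (norm x)\<^sup>2"
    by (rule whitening[OF psd_pop_cov invertible_cov], rule that)
  define L where "L = leverage"
  have L: "L > 0" unfolding L_def by (rule leverage_pos)
  define W where "W i \<omega> = (1 / sqrt L) *\<^sub>R (C *v X i \<omega>)" for i \<omega>
  have map_meas: "(\<lambda>x. (1 / sqrt L) *\<^sub>R (C *v x)) \<in> borel_measurable borel"
    by (intro borel_measurable_continuous_onI continuous_intros linear_continuous_on matrix_vector_mul_bounded_linear)
  have indep: "data.indep_vars (\<lambda>_. borel) W {1..N}"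
    unfolding W_def by (rule data.indep_vars_compose2[OF X_indep map_meas])
  have bounded: "AE \<omega> in M. norm (W i \<omega>) \<le> 1" if "i \<in> {1..N}" for i
    using X_bounded[OF that]
  proof eventually_elim
    case (elim \<omega>)
    then have "norm (C *v X i \<omega>) \<le> sqrt L"
      unfolding L_def by (rule whitened_bound[OF op])
    then show ?case using L by (simp add: W_def field_simps)
  qed
  have second: "data.expectation (\<lambda>\<omega>. W i \<omega> $ a * W i \<omega> $ c) = (if a = c then 1 / L else 0)"
    if i: "i \<in> {1..N}" for i a c
  proof -
    have entry: "(C *v x) $ k = x \<bullet> (C *v axis k 1)" for x k
    proof -
      have "(C *v x) $ k = (C *v x) \<bullet> axis k 1" by (simp add: inner_axis)
      then show ?thesis using symmetric_inner[OF sym] by simp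
    qed
    have "data.expectation (\<lambda>\<omega>. W i \<omega> $ a * W i \<omega> $ c)
        = data.expectation (\<lambda>\<omega>. 1 / L * ((X i \<omega> \<bullet> (C *v axis a 1)) * (X i \<omega> \<bullet> (C *v axis c 1))))"
      using L by (simp add: W_def entry field_simps)
    also have "\<dots> = 1 / L * data.expectation (\<lambda>\<omega>. (X i \<omega> \<bullet> (C *v axis a 1)) * (X i \<omega> \<bullet> (C *v axis c 1)))"
      by simp
    also have "data.expectation (\<lambda>\<omega>. (X i \<omega> \<bullet> (C *v axis a 1)) * (X i \<omega> \<bullet> (C *v axis c 1)))
        = (C *v axis a 1) \<bullet> (pop_cov P *v (C *v axis c 1))"
      unfolding pop_cov_form by (rule X_expectation[OF i]) measurable
    also have "\<dots> = axis a 1 \<bullet> ((C ** pop_cov P ** C) *v axis c 1)"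
      using symmetric_inner[OF sym] by (simp add: matrix_vector_mul_assoc matrix_mul_assoc)
    also have "\<dots> = (if a = c then 1 else 0)"
      by (simp add: CSC inner_axis_axis)
    finally show ?thesis by simp
  qed
  have "N > 0" using n nN by simp
  from data.matrix_Chernoff_lower[OF indep bounded second this]
  obtain E where E: "E \<in> sets M" "data.prob (space M - E) \<le> CARD('p) * exp (- (2 / 35 * N * (1 / L)))"
    "\<And>\<omega> u. \<omega> \<in> E \<Longrightarrow> 2 / 3 * N * (1 / L) * (u \<bullet> u) \<le> (\<Sum>i=1..N. (W i \<omega> \<bullet> u)\<^sup>2)"
    by blast
  show ?thesis
  proof
    show "E \<in> sets M" by (rule E(1))
    show "data.prob (space M - E) \<le> CARD('p) * exp (- (2 / 35 * N / leverage))"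
      using E(2) by (simp add: L_def)
    show "v \<bullet> (pop_cov P *v v) \<le> 3 / 2 * (v \<bullet> (emp_cov N (\<lambda>i. X i \<omega>) *v v))" if "\<omega> \<in> E" for \<omega> v
    proof -
      let ?u = "(C ** pop_cov P) *v v"
      have "(W i \<omega> \<bullet> ?u)\<^sup>2 = (X i \<omega> \<bullet> v)\<^sup>2 / L" for i
        using L symmetric_inner[OF sym, of "X i \<omega>" ?u] inv[of v]
        by (simp add: W_def power_divide)
      then have "2 / 3 * N * (1 / L) * (v \<bullet> (pop_cov P *v v)) \<le> (\<Sum>i=1..N. (X i \<omega> \<bullet> v)\<^sup>2) / L"
        using E(3)[OF that, of ?u] nrm[of v] by (simp add: power2_norm_eq_inner sum_divide_distrib)
      then have "2 / 3 * N * (v \<bullet> (pop_cov P *v v)) \<le> (\<Sum>i=1..N. (X i \<omega> \<bullet> v)\<^sup>2)"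
        using L by (simp add: field_simps)
      then show ?thesis
        using \<open>N > 0\<close> by (simp add: emp_cov_form field_simps)
    qed
  qed
qed

definition emp_cross_cov :: "'w \<Rightarrow> real^'p" where
  "emp_cross_cov \<omega> = (1 / real n) *\<^sub>R (\<Sum>i=1..n. Y i \<omega> *\<^sub>R X i \<omega>)"

text \<open>
  The standard deviation is bounded by $B_Y$ and not only by $B_XB_Y$, because the coordinates of
  $X$ have second moment $1$.
\<close>

lemma cross_cov_deviation:
  fixes r :: real
  assumes "B_Y > 0" "r > 0"
  shows "data.prob {\<omega> \<in> space M. \<bar>(emp_cross_cov \<omega> - cross_cov) $ j\<bar> \<ge> sqrt 3 * B_Y * r + B_X * B_Y * r\<^sup>2}
      \<le> 2 * exp (- (n * r\<^sup>2))"
proof -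
  let ?g = "\<lambda>z :: (real^'p) \<times> real. snd z * fst z $ j"
  have g: "?g \<in> borel_measurable borel"
    by (intro borel_measurable_continuous_onI continuous_intros)
  have "AE z in P. \<bar>?g z\<bar> \<le> B_X * B_Y"
    using bounds
  proof eventually_elim
    case (elim z)
    then have "\<bar>snd z\<bar> * \<bar>fst z $ j\<bar> \<le> B_Y * B_X"
      using B_Y_nonneg by (intro mult_mono) auto
    then show ?case by (simp add: abs_mult mult.commute)
  qed
  moreover have "{z. \<bar>?g z\<bar> \<le> B_X * B_Y} \<in> sets borel"
    by (intro borel_closed closed_Collect_le continuous_intros)
  ultimately have bounded: "AE \<omega> in M. \<bar>?g (X i \<omega>, Y i \<omega>)\<bar> \<le> B_X * B_Y" if "i \<in> {1..n}" for i
    by (rule XY_AE[OF that])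
  have second: "(\<integral>z. (?g z)\<^sup>2 \<partial>P) \<le> B_Y\<^sup>2"
  proof -
    have sq: "integrable P (\<lambda>z. (fst z $ j)\<^sup>2)"
      using integrable_coordinates[of j j] by (simp add: power2_eq_square)
    have "(\<integral>z. (?g z)\<^sup>2 \<partial>P) \<le> (\<integral>z. B_Y\<^sup>2 * (fst z $ j)\<^sup>2 \<partial>P)"
    proof (rule integral_mono_AE')
      show "integrable P (\<lambda>z. B_Y\<^sup>2 * (fst z $ j)\<^sup>2)" using sq by simp
      show "AE z in P. (?g z)\<^sup>2 \<le> B_Y\<^sup>2 * (fst z $ j)\<^sup>2"
        using bounds(1)
      proof eventually_elim
        case (elim z)
        then have "\<bar>snd z\<bar>\<^sup>2 \<le> B_Y\<^sup>2" by (intro power_mono) auto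
        then show ?case by (simp add: power_mult_distrib mult_right_mono)
      qed
    qed simp
    then show ?thesis by (simp add: variance_X)
  qed
  have mean: "(\<integral>z. ?g z \<partial>P) = cross_cov $ j"
    by (simp add: cross_cov_def)
  have "data.prob {\<omega> \<in> space M. \<bar>(\<Sum>i\<in>{1..n}. ?g (X i \<omega>, Y i \<omega>)) / card {1..n} - cross_cov $ j\<bar>
      \<ge> sqrt 3 * B_Y * r + B_X * B_Y * r\<^sup>2} \<le> 2 * exp (- (card {1..n} * r\<^sup>2))"
  proof (rule data.Bernstein_two_sided)
    show "finite {1..n}" "{1..n} \<noteq> {}" using n by auto
    show "data.indep_vars (\<lambda>_. borel) (\<lambda>i \<omega>. ?g (X i \<omega>, Y i \<omega>)) {1..n}"
      by (rule data.indep_vars_compose2[OF labeled_indep g])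
    show "data.expectation (\<lambda>\<omega>. ?g (X i \<omega>, Y i \<omega>)) = cross_cov $ j" if "i \<in> {1..n}" for i
      using XY_expectation[OF that g] mean by simp
    show "data.expectation (\<lambda>\<omega>. (?g (X i \<omega>, Y i \<omega>))\<^sup>2) \<le> B_Y\<^sup>2" if "i \<in> {1..n}" for i
      using XY_expectation[OF that borel_measurable_power[OF g]] second by simp
    show "B_X * B_Y > 0" using assms(1) B_X_ge_1 by simp
  qed (use bounded assms in auto)
  then show ?thesis by (simp add: emp_cross_cov_def)
qed

text \<open>
  The summands $x_j(x\cdot b)$ have second moment at most $B_X^2\,b\cdot\Sigma b$. Their size is
  controlled by Cauchy--Schwarz after whitening:
  $|x\cdot b|\le(x\cdot\Sigma^{-1}x)^{1/2}(b\cdot\Sigma b)^{1/2}$.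
\<close>

lemma covariance_deviation:
  fixes r :: real
  assumes "B_Y > 0" "r > 0" and b: "b \<bullet> (pop_cov P *v b) \<le> B_Y\<^sup>2"
  shows "data.prob {\<omega> \<in> space M. \<bar>(emp_cov N (\<lambda>i. X i \<omega>) *v b - pop_cov P *v b) $ j\<bar>
        \<ge> sqrt 3 * (B_X * B_Y) * r + B_X * B_Y * sqrt leverage * r\<^sup>2}
      \<le> 2 * exp (- (N * r\<^sup>2))"
proof -
  let ?g = "\<lambda>x :: real^'p. x $ j * (x \<bullet> b)"
  have g: "?g \<in> borel_measurable borel"
    by (intro borel_measurable_continuous_onI continuous_intros)
  obtain C where sym: "transpose C = C" and "C ** pop_cov P ** C = mat 1"
    and inv: "\<And>v. C *v ((C ** pop_cov P) *v v) = v"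
    and nrm: "\<And>v. (norm ((C ** pop_cov P) *v v))\<^sup>2 = v \<bullet> (pop_cov P *v v)"
    and op: "\<And>x. (norm (C *v x))\<^sup>2 \<le> spectral_norm (matrix_inv (pop_cov P)) * (norm x)\<^sup>2"
    by (rule whitening[OF psd_pop_cov invertible_cov], rule that)
  have lin: "\<bar>x \<bullet> b\<bar> \<le> sqrt leverage * B_Y" if "\<forall>j. \<bar>x $ j\<bar> \<le> B_X" for x
  proof -
    let ?u = "(C ** pop_cov P) *v b"
    have "(norm ?u)\<^sup>2 \<le> B_Y\<^sup>2"
      unfolding nrm by (rule b)
    then have "norm ?u \<le> B_Y"
      by (rule power2_le_imp_le) (rule B_Y_nonneg)
    have "x \<bullet> b = (C *v x) \<bullet> ?u"
      using symmetric_inner[OF sym, of x ?u] inv[of b] by simp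
    then have "\<bar>x \<bullet> b\<bar> \<le> norm (C *v x) * norm ?u"
      using Cauchy_Schwarz_ineq2[of "C *v x" ?u] by simp
    also have "\<dots> \<le> sqrt leverage * B_Y"
      using whitened_bound[OF op that] \<open>norm ?u \<le> B_Y\<close> leverage_pos by (intro mult_mono) auto
    finally show ?thesis .
  qed
  have bounded: "AE \<omega> in M. \<bar>?g (X i \<omega>)\<bar> \<le> B_X * B_Y * sqrt leverage" if "i \<in> {1..N}" for i
    using X_bounded[OF that]
  proof eventually_elim
    case (elim \<omega>)
    then have "\<bar>X i \<omega> $ j\<bar> * \<bar>X i \<omega> \<bullet> b\<bar> \<le> B_X * (sqrt leverage * B_Y)"
      using lin[OF elim] B_X_ge_1 by (intro mult_mono) auto
    then show ?case by (simp add: abs_mult mult_ac)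
  qed
  have second: "(\<integral>z. (?g (fst z))\<^sup>2 \<partial>P) \<le> (B_X * B_Y)\<^sup>2"
  proof -
    have sq: "integrable P (\<lambda>z. (fst z \<bullet> b) * (fst z \<bullet> b))"
      by (rule integrable_mult_bounded[OF _ _ inner_bound inner_bound]) measurable
    have "(\<integral>z. (?g (fst z))\<^sup>2 \<partial>P) \<le> (\<integral>z. B_X\<^sup>2 * ((fst z \<bullet> b) * (fst z \<bullet> b)) \<partial>P)"
    proof (rule integral_mono_AE')
      show "integrable P (\<lambda>z. B_X\<^sup>2 * ((fst z \<bullet> b) * (fst z \<bullet> b)))" using sq by simp
      show "AE z in P. (?g (fst z))\<^sup>2 \<le> B_X\<^sup>2 * ((fst z \<bullet> b) * (fst z \<bullet> b))"
        using bounds(2)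
      proof eventually_elim
        case (elim z)
        then have "\<bar>fst z $ j\<bar>\<^sup>2 \<le> B_X\<^sup>2" by (intro power_mono) auto
        then have "(fst z $ j)\<^sup>2 * (fst z \<bullet> b)\<^sup>2 \<le> B_X\<^sup>2 * (fst z \<bullet> b)\<^sup>2"
          by (intro mult_right_mono) auto
        then show ?case by (simp add: power_mult_distrib power2_eq_square[of "fst z \<bullet> b"])
      qed
    qed simp
    also have "\<dots> = B_X\<^sup>2 * (b \<bullet> (pop_cov P *v b))"
      by (simp add: pop_cov_form)
    also have "\<dots> \<le> B_X\<^sup>2 * B_Y\<^sup>2"
      using b by (intro mult_left_mono) auto
    finally show ?thesis by (simp add: power_mult_distrib)
  qed
  have mean: "(\<integral>z. ?g (fst z) \<partial>P) = (pop_cov P *v b) $ j"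
    by (simp add: pop_cov_mult)
  have "data.prob {\<omega> \<in> space M. \<bar>(\<Sum>i\<in>{1..N}. ?g (X i \<omega>)) / card {1..N} - (pop_cov P *v b) $ j\<bar>
      \<ge> sqrt 3 * (B_X * B_Y) * r + B_X * B_Y * sqrt leverage * r\<^sup>2} \<le> 2 * exp (- (card {1..N} * r\<^sup>2))"
  proof (rule data.Bernstein_two_sided)
    show "finite {1..N}" "{1..N} \<noteq> {}" using n nN by auto
    show "data.indep_vars (\<lambda>_. borel) (\<lambda>i \<omega>. ?g (X i \<omega>)) {1..N}"
      by (rule data.indep_vars_compose2[OF X_indep g])
    show "data.expectation (\<lambda>\<omega>. ?g (X i \<omega>)) = (pop_cov P *v b) $ j" if "i \<in> {1..N}" for i
      using X_expectation[OF that g] mean by simp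
    show "data.expectation (\<lambda>\<omega>. (?g (X i \<omega>))\<^sup>2) \<le> (B_X * B_Y)\<^sup>2" if "i \<in> {1..N}" for i
      using X_expectation[OF that borel_measurable_power[OF g]] second by simp
    show "B_X * B_Y * sqrt leverage > 0" "B_X * B_Y > 0" using assms(1) B_X_ge_1 leverage_pos by auto
  qed (use bounded assms in auto)
  then show ?thesis by (simp add: emp_cov_mult)
qed

end

section \<open>The semi-supervised lasso\<close>

lemma ssl_objective_eq:
  "ssl_objective n N lam x y \<beta> = \<beta> \<bullet> (emp_cov N x *v \<beta>)
     - 2 * (((1 / real n) *\<^sub>R (\<Sum>i=1..n. y i *\<^sub>R x i)) \<bullet> \<beta>) + 2 * lam * l1_norm \<beta>"
  by (simp add: ssl_objective_def norm_psd_sqrt_sq[OF psd_emp_cov] inner_sum_left)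

context semi_supervised_sample
begin

text \<open>
  Three events of probability at most $\delta/3$ are removed: failure of
  $\Sigma\le\frac32\hat\Sigma$, a large deviation of the labeled cross-covariance in some
  coordinate, and a large deviation of $\hat\Sigma b$ in some coordinate, for the deterministic
  minimiser \<open>b\<close>. The last two are union bounds over the $p$ coordinates and the two signs, whence
  the logarithm of $6p/\delta$. The first has probability strictly less than $\delta/3$ since
  $\frac2{35}>\frac1{18}$, and this makes the final inequality strict. Off these events
  \<open>lasso_oracle_inequality\<close> applies.
\<close>

lemma lasso_oracle_probability:
  fixes \<beta>hat :: "'w \<Rightarrow> real^'p"
  assumes B_Y: "B_Y > 0" and \<delta>: "0 < \<delta>" "\<delta> < 1"
    and N_large: "real N \<ge> 18 * leverage * ln (3 * real CARD('p) / \<delta>)"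
    and lam_large: "lam \<ge> 8 * B_X * B_Y * sqrt (ln (6 * real CARD('p) / \<delta>) / real n)
      * (1 + B_X / 3 * sqrt (ln (6 * real CARD('p) / \<delta>) / real n))"
    and \<beta>hat: "\<And>\<omega>. \<omega> \<in> space M \<Longrightarrow>
      is_arg_min (ssl_objective n N lam (\<lambda>i. X i \<omega>) (\<lambda>i. Y i \<omega>)) (\<lambda>_. True) (\<beta>hat \<omega>)"
  shows "\<exists>E \<in> sets M. measure M E > 1 - \<delta> \<and>
    (\<forall>\<omega>\<in>E. ereal (excess_risk P fstar (lin_pred (\<beta>hat \<omega>))) \<le>
      (INF \<beta>. ereal (excess_risk P fstar (lin_pred \<beta>))
         + ereal (4 * lam * l1_norm (restr (- J) \<beta>))
         + ereal (9 * lam\<^sup>2 * real (card J)) / (2 * compat_const (emp_cov N (\<lambda>i. X i \<omega>)) J 3)))"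
proof -
  define p where "p = real CARD('p)"
  define l3 l6 where "l3 = ln (3 * p / \<delta>)" and "l6 = ln (6 * p / \<delta>)"
  define r rN where "r = sqrt (l6 / n)" and "rN = sqrt (l6 / N)"
  define L where "L = leverage"
  have p: "p \<ge> 1" by (simp add: p_def Suc_leI)
  have L: "L > 0" unfolding L_def by (rule leverage_pos)
  have "3 < 3 * p / \<delta>" using p \<delta> by (simp add: less_divide_eq)
  then have "ln 3 < l3" unfolding l3_def by simp
  moreover have "0 < ln (2::real)" "ln 2 < ln (3::real)" by simp_all
  moreover have "l6 = ln 2 + l3"
  proof -
    have "6 * p / \<delta> = 2 * (3 * p / \<delta>)" by simp
    then show ?thesis unfolding l6_def l3_def using p \<delta> by (subst ln_mult_pos[symmetric]) auto
  qed
  ultimately have l: "0 < l3" "0 < l6" "l6 \<le> 2 * l3" by linarith+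
  have exp_l: "exp (- l3) = \<delta> / (3 * p)" "exp (- l6) = \<delta> / (6 * p)"
    using p \<delta> by (simp_all add: l3_def l6_def exp_minus)
  have pos: "0 < real n" "0 < real N" "real n \<le> real N" using n nN by auto
  have r: "0 < r" "0 < rN" "rN \<le> r" "n * r\<^sup>2 = l6" "N * rN\<^sup>2 = l6"
    using l pos by (auto simp: r_def rN_def divide_left_mono)
  \<comment> \<open>The size condition on \<open>N\<close> makes the second-order term of the deviation of the empirical \<open>\<Sigma>b\<close> a third of the first-order scale.\<close>
  have leverage_rN: "sqrt L * rN\<^sup>2 \<le> rN / 3"
  proof -
    have "L * l6 \<le> L * (2 * l3)" using L l by (intro mult_left_mono) auto
    also have "\<dots> \<le> N / 9" using N_large by (simp add: L_def l3_def p_def)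
    finally have "L * l6 / N \<le> (1 / 3)\<^sup>2"
      using pos by (simp add: field_simps power2_eq_square)
    then have "sqrt (L * l6 / N) \<le> 1 / 3"
      by (intro real_le_lsqrt) auto
    then have "sqrt L * rN \<le> 1 / 3"
      by (simp add: rN_def real_sqrt_mult real_sqrt_divide)
    then have "sqrt L * rN * rN \<le> 1 / 3 * rN" using r by (intro mult_right_mono) auto
    then show ?thesis by (simp add: power2_eq_square)
  qed
  define s1 s2 where "s1 = sqrt 3 * B_Y * r + B_X * B_Y * r\<^sup>2"
    and "s2 = sqrt 3 * (B_X * B_Y) * rN + B_X * B_Y * sqrt L * rN\<^sup>2"
  \<comment> \<open>The coefficients of \<open>B_X B_Y r\<close> add up to \<open>2 sqrt 3 + 1 / 3 \<le> 2 * 11 / 6 + 1 / 3 = 4\<close>.\<close>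
  have noise_level: "s1 + s2 \<le> lam / 2"
  proof -
    have sqrt3: "sqrt 3 \<le> 11 / 6" by (rule real_le_lsqrt) (simp_all add: power2_eq_square)
    have BB: "0 < B_X * B_Y" "B_Y \<le> B_X * B_Y" using B_X_ge_1 B_Y by auto
    have "sqrt 3 * B_Y * r \<le> 11 / 6 * (B_X * B_Y) * r"
      using sqrt3 BB B_Y r by (intro mult_mono) auto
    moreover have "sqrt 3 * (B_X * B_Y) * rN \<le> 11 / 6 * (B_X * B_Y) * r"
      using sqrt3 BB r by (intro mult_mono[OF mult_right_mono]) auto
    moreover have "B_X * B_Y * (sqrt L * rN\<^sup>2) \<le> B_X * B_Y * (r / 3)"
      using leverage_rN r BB by (intro mult_left_mono) auto
    moreover have "B_X * B_Y * r\<^sup>2 \<le> B_X * B_Y * (4 / 3 * B_X * r\<^sup>2)"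
    proof -
      have "1 * r\<^sup>2 \<le> (4 / 3 * B_X) * r\<^sup>2" using B_X_ge_1 by (intro mult_right_mono) auto
      then show ?thesis using BB by (intro mult_left_mono) auto
    qed
    moreover have "8 * B_X * B_Y * r * (1 + B_X / 3 * r) \<le> lam"
      using lam_large by (simp add: r_def l6_def p_def)
    moreover have "8 * B_X * B_Y * r * (1 + B_X / 3 * r)
        = 8 * (B_X * B_Y * r) + 2 * (B_X * B_Y * (4 / 3 * B_X * r\<^sup>2))"
      by (simp add: power2_eq_square algebra_simps)
    ultimately show ?thesis by (simp add: s1_def s2_def mult.assoc)
  qed
  have lam: "lam \<ge> 0"
  proof -
    have "0 \<le> s1 + s2" using B_X_ge_1 B_Y r L by (simp add: s1_def s2_def)
    with noise_level show ?thesis by simp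
  qed
  obtain b where b: "b \<bullet> (pop_cov P *v b) \<le> B_Y\<^sup>2"
    and opt: "\<And>\<beta>. excess_risk P fstar (lin_pred b) + 4 * lam * l1_norm (restr (- J) b)
       \<le> excess_risk P fstar (lin_pred \<beta>) + 4 * lam * l1_norm (restr (- J) \<beta>)"
    using penalized_risk_minimizer[OF B_Y lam, of "- J"] by blast
  define A D where "A j = {\<omega> \<in> space M. \<bar>(emp_cross_cov \<omega> - cross_cov) $ j\<bar> \<ge> s1}"
    and "D j = {\<omega> \<in> space M. \<bar>(emp_cov N (\<lambda>i. X i \<omega>) *v b - pop_cov P *v b) $ j\<bar> \<ge> s2}" for j
  have XY_meas: "X i \<in> borel_measurable M" "Y i \<in> borel_measurable M" if "i \<in> {1..n}" for i
  proof -
    show "X i \<in> borel_measurable M" using that nN by (intro X_measurable) auto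
    have "snd \<in> borel_measurable (borel :: ((real^'p) \<times> real) measure)"
      by (intro borel_measurable_continuous_onI continuous_intros)
    from measurable_compose[OF XY_measurable[OF that] this]
    show "Y i \<in> borel_measurable M" by simp
  qed
  have A_meas: "A j \<in> sets M" for j
  proof -
    have "(\<lambda>\<omega>. emp_cross_cov \<omega> $ j) \<in> borel_measurable M"
      unfolding emp_cross_cov_def
      by (intro measurable_vec_nth borel_measurable_scaleR borel_measurable_const borel_measurable_sum XY_meas)
    then show ?thesis unfolding A_def by simp
  qed
  have D_meas: "D j \<in> sets M" for j
  proof -
    have "(\<lambda>\<omega>. (emp_cov N (\<lambda>i. X i \<omega>) *v b) $ j) \<in> borel_measurable M"
      unfolding emp_cov_mult
      by (intro borel_measurable_divide borel_measurable_const borel_measurable_sum borel_measurable_times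
          measurable_vec_nth borel_measurable_inner X_measurable)
    then show ?thesis unfolding D_def by simp
  qed
  have A_prob: "data.prob (A j) \<le> 2 * exp (- l6)" for j
    using cross_cov_deviation[OF B_Y r(1), of j] by (simp add: A_def s1_def r(4))
  have D_prob: "data.prob (D j) \<le> 2 * exp (- l6)" for j
    using covariance_deviation[OF B_Y r(2) b, of j] by (simp add: D_def s2_def r(5) L_def)
  obtain E0 where E0: "E0 \<in> sets M" "data.prob (space M - E0) \<le> CARD('p) * exp (- (2 / 35 * N / leverage))"
    and cov: "\<And>\<omega> v. \<omega> \<in> E0 \<Longrightarrow> v \<bullet> (pop_cov P *v v) \<le> 3 / 2 * (v \<bullet> (emp_cov N (\<lambda>i. X i \<omega>) *v v))"
    by (rule covariance_event, rule that)
  define F where "F = (\<Union>j. A j) \<union> (\<Union>j. D j)"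
  have F_meas: "F \<in> sets M"
    unfolding F_def using A_meas D_meas by auto
  have F_prob: "data.prob F \<le> 2 * \<delta> / 3"
  proof -
    have "data.prob F \<le> data.prob (\<Union>j. A j) + data.prob (\<Union>j. D j)"
      unfolding F_def by (rule measure_Un_le) (use A_meas D_meas in auto)
    also have "\<dots> \<le> (\<Sum>j\<in>UNIV. data.prob (A j)) + (\<Sum>j\<in>UNIV. data.prob (D j))"
      using A_meas D_meas by (intro add_mono measure_UNION_le) auto
    also have "\<dots> \<le> (\<Sum>j\<in>(UNIV :: 'p set). 2 * exp (- l6)) + (\<Sum>j\<in>(UNIV :: 'p set). 2 * exp (- l6))"
      using A_prob D_prob by (intro add_mono sum_mono)
    also have "\<dots> = 4 * p * exp (- l6)" by (simp add: p_def)
    also have "\<dots> = 2 * \<delta> / 3" using p by (simp add: exp_l)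
    finally show ?thesis .
  qed
  have E0_prob: "data.prob (space M - E0) < \<delta> / 3"
  proof -
    have "18 * l3 \<le> N / L"
      using N_large L by (simp add: L_def l3_def p_def field_simps)
    then have "l3 < 2 / 35 * (N / L)" using l by simp
    then have "p * exp (- (2 / 35 * N / L)) < p * exp (- l3)"
      using p by simp
    then show ?thesis using E0(2) p by (simp add: exp_l p_def L_def)
  qed
  define E where "E = E0 \<inter> (space M - F)"
  have E_meas: "E \<in> sets M" using E0(1) F_meas by (auto simp: E_def)
  have "data.prob (space M - E) \<le> data.prob ((space M - E0) \<union> F)"
    using E0(1) F_meas by (intro data.finite_measure_mono) (auto simp: E_def)
  also have "\<dots> \<le> data.prob (space M - E0) + data.prob F"
    using E0(1) F_meas by (intro measure_Un_le) auto
  also have "\<dots> < \<delta>" using E0_prob F_prob by simp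
  finally have "measure M E > 1 - \<delta>"
    using data.prob_compl[OF E_meas] by simp
  moreover have "ereal (excess_risk P fstar (lin_pred (\<beta>hat \<omega>))) \<le>
      ereal (excess_risk P fstar (lin_pred \<beta>)) + ereal (4 * lam * l1_norm (restr (- J) \<beta>))
       + ereal (9 * lam\<^sup>2 * real (card J)) / (2 * compat_const (emp_cov N (\<lambda>i. X i \<omega>)) J 3)"
    if \<omega>: "\<omega> \<in> E" for \<omega> \<beta>
  proof -
    let ?A = "emp_cov N (\<lambda>i. X i \<omega>)"
    let ?K = "ereal (9 * lam\<^sup>2 * real (card J)) / (2 * compat_const ?A J 3)"
    have \<omega>': "\<omega> \<in> space M" "\<omega> \<in> E0" "\<omega> \<notin> F" using \<omega> by (auto simp: E_def)
    have min: "\<beta>hat \<omega> \<bullet> (?A *v \<beta>hat \<omega>) - 2 * (emp_cross_cov \<omega> \<bullet> \<beta>hat \<omega>) + 2 * lam * l1_norm (\<beta>hat \<omega>)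
        \<le> \<beta> \<bullet> (?A *v \<beta>) - 2 * (emp_cross_cov \<omega> \<bullet> \<beta>) + 2 * lam * l1_norm \<beta>" for \<beta>
      using \<beta>hat[OF \<omega>'(1)] unfolding is_arg_min_def ssl_objective_eq emp_cross_cov_def
      by (simp add: not_less)
    have noise: "\<bar>(pop_cov P *v b - ?A *v b + emp_cross_cov \<omega> - cross_cov) $ j\<bar> \<le> lam / 2" for j
    proof -
      have "\<omega> \<notin> A j" "\<omega> \<notin> D j" using \<omega>'(3) by (auto simp: F_def)
      then have "\<bar>(emp_cross_cov \<omega> - cross_cov) $ j\<bar> < s1" "\<bar>(?A *v b - pop_cov P *v b) $ j\<bar> < s2"
        using \<omega>'(1) by (auto simp: A_def D_def)
      then show ?thesis
        using noise_level unfolding vector_minus_component vector_add_component by linarith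
    qed
    have ineq: "ereal (\<beta>hat \<omega> \<bullet> (pop_cov P *v \<beta>hat \<omega>) - 2 * (cross_cov \<bullet> \<beta>hat \<omega>)) \<le>
        ereal (b \<bullet> (pop_cov P *v b) - 2 * (cross_cov \<bullet> b)) + ereal (4 * lam * l1_norm (restr (- J) b)) + ?K"
      by (rule lasso_oracle_inequality[OF psd_emp_cov psd_pop_cov cov[OF \<omega>'(2)] lam min noise])
    have "?K \<noteq> - \<infinity>"
      using zero_le_divide_ereal[of "ereal (9 * lam\<^sup>2 * real (card J))" "2 * compat_const ?A J 3"]
        compat_const_nonneg[of ?A J 3] by auto
    then consider "?K = \<infinity>" | k where "?K = ereal k" by (cases ?K) auto
    then show ?thesis
    proof cases
      case 1
      then show ?thesis by simp
    next
      case (2 k)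
      show ?thesis
        using ineq opt[of \<beta>] unfolding 2 by (simp add: excess_risk_eq)
    qed
  qed
  ultimately show ?thesis
    using E_meas by (intro bexI[of _ E] conjI ballI INF_greatest)
qed

end

theorem theorem7:
  fixes M :: "'w measure"
    and P :: "((real ^ 'p::finite) \<times> real) measure"
    and X :: "nat \<Rightarrow> 'w \<Rightarrow> real ^ 'p"
    and Y :: "nat \<Rightarrow> 'w \<Rightarrow> real"
    and n N :: nat
    and fstar :: "real ^ 'p \<Rightarrow> real"
    and B_X B_Y lam \<delta> :: real
    and J :: "'p set"
    and \<beta>hat :: "'w \<Rightarrow> real ^ 'p"
  assumes n: "1 \<le> n" and nN: "n < N"
    and prob_M: "prob_space M"
    and prob_P: "prob_space P" and sets_P: "sets P = sets borel"
    and labeled_law: "\<And>i. i \<in> {1..n} \<Longrightarrow> distr M borel (\<lambda>\<omega>. (X i \<omega>, Y i \<omega>)) = P"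
    and labeled_indep:
      "prob_space.indep_vars M (\<lambda>_. borel) (\<lambda>i \<omega>. (X i \<omega>, Y i \<omega>)) {1..n}"
    and unlabeled_law: "\<And>i. i \<in> {n+1..N} \<Longrightarrow> distr M borel (X i) = marginal_X P"
    and unlabeled_indep: "prob_space.indep_vars M (\<lambda>_. borel) X {n+1..N}"
    and labeled_unlabeled_indep:
      "prob_space.indep_set M
         (sets (vimage_algebra (space M) (\<lambda>\<omega>. \<lambda>i\<in>{1..n}. (X i \<omega>, Y i \<omega>)) (Pi\<^sub>M {1..n} (\<lambda>_. borel))))
         (sets (vimage_algebra (space M) (\<lambda>\<omega>. \<lambda>i\<in>{n+1..N}. X i \<omega>) (Pi\<^sub>M {n+1..N} (\<lambda>_. borel))))"
    and fstar: "is_regression_function P fstar"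
    and A1_Y: "integrable P (\<lambda>z. (snd z)\<^sup>2)" "(\<integral>z. snd z \<partial>P) = 0"
    and A1_X: "\<And>j. integrable P (\<lambda>z. (fst z $ j)\<^sup>2)"
      "\<And>j. (\<integral>z. fst z $ j \<partial>P) = 0"
      "\<And>j. (\<integral>z. (fst z $ j)\<^sup>2 \<partial>P) = 1"
    and A2: "AE z in P. \<bar>snd z\<bar> \<le> B_Y \<and> (MAX j\<in>UNIV. \<bar>fst z $ j\<bar>) \<le> B_X"
    and Sigma_inv: "invertible (pop_cov P)"
    and \<delta>: "0 < \<delta>" "\<delta> < 1"
    and N_large: "real N \<ge> 18 * B_X\<^sup>2 * real CARD('p) * spectral_norm (matrix_inv (pop_cov P))
                    * ln (3 * real CARD('p) / \<delta>)"
    and lam_pos: "lam > 0"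
    and lam_large: "lam \<ge> 8 * B_X * B_Y * sqrt (ln (6 * real CARD('p) / \<delta>) / real n)
                    * (1 + B_X / 3 * sqrt (ln (6 * real CARD('p) / \<delta>) / real n))"
    and \<beta>hat: "\<And>\<omega>. \<omega> \<in> space M \<Longrightarrow>
           is_arg_min (ssl_objective n N lam (\<lambda>i. X i \<omega>) (\<lambda>i. Y i \<omega>)) (\<lambda>_. True) (\<beta>hat \<omega>)"
  shows "\<exists>E \<in> sets M. measure M E > 1 - \<delta> \<and>
           (\<forall>\<omega>\<in>E. ereal (excess_risk P fstar (lin_pred (\<beta>hat \<omega>))) \<le>
              (INF \<beta>. ereal (excess_risk P fstar (lin_pred \<beta>))
                 + ereal (4 * lam * l1_norm (restr (- J) \<beta>))
                 + ereal (9 * lam\<^sup>2 * real (card J))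
                   / (2 * compat_const (emp_cov N (\<lambda>i. X i \<omega>)) J 3)))"
proof -
  interpret M: prob_space M by (rule prob_M)
  interpret P: prob_space P by (rule prob_P)
  have bounded: "AE z in P. \<bar>snd z\<bar> \<le> B_Y \<and> (\<forall>j. \<bar>fst z $ j\<bar> \<le> B_X)"
    using A2
  proof eventually_elim
    case (elim z)
    have "\<bar>fst z $ j\<bar> \<le> (MAX j\<in>UNIV. \<bar>fst z $ j\<bar>)" for j by (rule Max_ge) auto
    with elim show ?case by (meson order_trans)
  qed
  define K where "K = 8 * B_X * sqrt (ln (6 * real CARD('p) / \<delta>) / real n)
      * (1 + B_X / 3 * sqrt (ln (6 * real CARD('p) / \<delta>) / real n))"
  have lam_K: "lam \<ge> K * B_Y" using lam_large by (simp add: K_def mult_ac)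
  \<comment> \<open>A vanishing bound on \<open>Y\<close> is replaced by a positive one small enough for \<open>lam\<close>.\<close>
  obtain B where B: "B > 0" "B_Y \<le> B" "lam \<ge> K * B"
  proof (cases "B_Y > 0")
    case True
    then show ?thesis using lam_K that by blast
  next
    case False
    have "K * (lam / (\<bar>K\<bar> + 1)) \<le> \<bar>K\<bar> * (lam / (\<bar>K\<bar> + 1))"
      using lam_pos by (intro mult_right_mono) auto
    also have "\<dots> \<le> lam"
      using lam_pos by (simp add: field_simps)
    finally show ?thesis
      using False lam_pos by (intro that[of "lam / (\<bar>K\<bar> + 1)"]) (auto intro: order_trans[of _ 0])
  qed
  interpret bounded_regression P fstar B_X B
  proof
    show "AE z in P. \<bar>snd z\<bar> \<le> B \<and> (\<forall>j. \<bar>fst z $ j\<bar> \<le> B_X)"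
      using bounded by (rule eventually_mono) (use B(2) in auto)
  qed (use sets_P fstar A1_X(3) Sigma_inv in auto)
  have X_indep: "M.indep_vars (\<lambda>_. borel) X {1..N}"
    by (rule M.indep_vars_labeled_unlabeled[OF labeled_indep unlabeled_indep labeled_unlabeled_indep n nN])
  have X_law: "distr M borel (X i) = marginal_X P" if "i \<in> {1..N}" for i
  proof (cases "i \<le> n")
    case True
    then have i: "i \<in> {1..n}" using that by simp
    then have "(\<lambda>\<omega>. (X i \<omega>, Y i \<omega>)) \<in> borel_measurable M"
      using labeled_indep by (simp add: M.indep_vars_def)
    moreover have "fst \<in> borel_measurable (borel :: ((real^'p) \<times> real) measure)"
      by (intro borel_measurable_continuous_onI continuous_intros)
    ultimately have "distr (distr M borel (\<lambda>\<omega>. (X i \<omega>, Y i \<omega>))) borel fst = distr M borel (X i)"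
      by (subst distr_distr) (auto simp: comp_def)
    then show ?thesis by (simp add: labeled_law[OF i] marginal_X_def)
  next
    case False
    then show ?thesis using that unlabeled_law by simp
  qed
  interpret semi_supervised_sample P fstar B_X B M X Y n N
    by unfold_locales (use n nN labeled_law labeled_indep X_law X_indep in auto)
  show ?thesis
  proof (rule lasso_oracle_probability[OF B(1) \<delta>])
    show "real N \<ge> 18 * leverage * ln (3 * real CARD('p) / \<delta>)"
      using N_large by (simp add: leverage_def mult_ac)
    show "lam \<ge> 8 * B_X * B * sqrt (ln (6 * real CARD('p) / \<delta>) / real n)
        * (1 + B_X / 3 * sqrt (ln (6 * real CARD('p) / \<delta>) / real n))"
      using B(3) by (simp add: K_def mult_ac)
  qed (rule \<beta>hat)
qed

end
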